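(* Let $n\ge2$. The subgroups $\mathrm{Cent}_{\mathcal{C}_n}(z_1)$ and $\mathcal{IN}_n$ are conjugate within the $n$-qubit projective Clifford group $\mathcal{C}_n$, where $z_1=s_1^2$.
   Context: Let $\omega$ be a primitive 8th root of unity and $Z=\begin{bmatrix}1&0\\0&-1\end{bmatrix}$, $X=\begin{bmatrix}0&1\\1&0\end{bmatrix}$, $H=\frac1{\sqrt2}\begin{bmatrix}1&1\\1&-1\end{bmatrix}$, $S=\begin{bmatrix}1&0\\0&\omega^2\end{bmatrix}$, $CZ=\mathrm{diag}(1,1,1,-1)$. For $U\in\{Z,X,H,S\}$ put $U_i=I_2^{\otimes(i-1)}\otimes U\otimes I_2^{\otimes(n-i)}$, and put $CZ_{i\to i+1}=I_2^{\otimes(i-1)}\otimes CZ\otimes I_2^{\otimes(n-i-1)}$ for $1\le i\le n-1$. The $n$-qubit Pauli group $\mathrm{Pauli}_n$ is the group generated by all $X_i$, $Z_i$ and $\omega^2 I_2^{\otimes n}$. The $n$-qubit Clifford group $\mathrm{Cliff}_n$ is the normalizer of $\mathrm{Pauli}_n$ in the unitary group $U(2^n)$ with global phases restricted to powers of $\omega$; it is the finite group generated by $\omega I_2^{\otimes n}$, all $H_i$, all $S_i$ and all $CZ_{i\to i+1}$. The $n$-qubit projective Clifford group is $\mathcal{C}_n=\mathrm{Cliff}_n/\langle\omega I_2^{\otimes n}\rangle$ (equivalently the normalizer of $\mathrm{Pauli}_n$ in $U(2^n)$ modulo all scalars). Write $h_i,s_i,\Lambda_i$ for the classes of $H_i,S_i,CZ_{i\to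 i+1}$ in $\mathcal{C}_n$; they generate $\mathcal{C}_n$. The class of $Z_1$ is $z_1=s_1^2$. Convention: products in $\mathcal{C}_n$ are written from left to right (circuit order), i.e. the opposite of matrix multiplication: $[U][V]=[VU]$. For $u\in\mathcal{C}_n$, $\mathrm{Cent}_{\mathcal{C}_n}(u)=\{g\in\mathcal{C}_n: ug=gu\}$. The group $\mathcal{IN}_n$ is the following subgroup of $\mathcal{C}_n$: with $M=h_2\Lambda_1s_2^2h_2h_1s_1^2h_2\Lambda_1h_2$, $$\mathcal{IN}_2=\langle h_1,h_2,s_2,h_1s_1^2h_1,M\rangle,\qquad \mathcal{IN}_n=\langle h_1,h_2,\dots,h_n,\ s_2,\dots,s_n,\ M,\Lambda_2,\dots,\Lambda_{n-1}\rangle\ (n\ge3).$$ *)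

theory Defs
  imports
    "Jordan_Normal_Form.Schur_Decomposition"
    "HOL-Algebra.Algebra"
begin

definition primitive_root_of_unity :: "nat \<Rightarrow> complex \<Rightarrow> bool" where
  "primitive_root_of_unity k w \<longleftrightarrow> w ^ k = 1 \<and> (\<forall>j. 0 < j \<and> j < k \<longrightarrow> w ^ j \<noteq> 1)"

definition kron :: "complex mat \<Rightarrow> complex mat \<Rightarrow> complex mat" where
  "kron A B = mat (dim_row A * dim_row B) (dim_col A * dim_col B)
     (\<lambda>(i, j). A $$ (i div dim_row B, j div dim_col B) * B $$ (i mod dim_row B, j mod dim_col B))"

definition H_mat :: "complex mat" where
  "H_mat = complex_of_real (1 / sqrt 2) \<cdot>\<^sub>m mat_of_rows_list 2 [[1, 1], [1, -1]]"

definition S_mat :: "complex \<Rightarrow> complex mat" where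
  "S_mat \<omega> = mat_of_rows_list 2 [[1, 0], [0, \<omega>\<^sup>2]]"

definition CZ_mat :: "complex mat" where
  "CZ_mat = mat_of_rows_list 4 [[1, 0, 0, 0], [0, 1, 0, 0], [0, 0, 1, 0], [0, 0, 0, -1]]"

text \<open>
  Qubits are numbered from 1. The k-fold tensor power of the 2 by 2 identity is written
  as the identity matrix of size \<open>2 ^ k\<close>.
\<close>

definition on_qubit :: "nat \<Rightarrow> nat \<Rightarrow> complex mat \<Rightarrow> complex mat" where
  "on_qubit n i U = kron (kron (1\<^sub>m (2 ^ (i - 1))) U) (1\<^sub>m (2 ^ (n - i)))"

definition on_adjacent_qubits :: "nat \<Rightarrow> nat \<Rightarrow> complex mat \<Rightarrow> complex mat" where
  "on_adjacent_qubits n i U = kron (kron (1\<^sub>m (2 ^ (i - 1))) U) (1\<^sub>m (2 ^ (n - i - 1)))"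

text \<open>
  Products are taken in circuit order: the group product of A and B is the matrix product
  \<open>B * A\<close>. This order is inherited by all groups below.
\<close>

definition unitary_group :: "nat \<Rightarrow> complex mat monoid" where
  "unitary_group d =
     \<lparr>carrier = {A \<in> carrier_mat d d. mat_adjoint A * A = 1\<^sub>m d},
      monoid.mult = (\<lambda>A B. B * A), one = 1\<^sub>m d\<rparr>"

text \<open>
  The normalizer of the Pauli group in the unitary group contains all scalars of modulus 1. The
  Clifford group is that normalizer with the global phases cut down to the powers of \<open>\<omega>\<close>, that is,
  the finite group with the following generators.
\<close>

definition clifford :: "complex \<Rightarrow> nat \<Rightarrow> complex mat monoid" where
  "clifford \<omega> n = subgroup_generated (unitary_group (2 ^ n))
     ({\<omega> \<cdot>\<^sub>m 1\<^sub>m (2 ^ n)}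
      \<union> (\<lambda>i. on_qubit n i H_mat) ` {1..n}
      \<union> (\<lambda>i. on_qubit n i (S_mat \<omega>)) ` {1..n}
      \<union> (\<lambda>i. on_adjacent_qubits n i CZ_mat) ` {1..n - 1})"

definition phases :: "complex \<Rightarrow> nat \<Rightarrow> complex mat set" where
  "phases \<omega> n = generate (clifford \<omega> n) {\<omega> \<cdot>\<^sub>m 1\<^sub>m (2 ^ n)}"

definition proj_clifford :: "complex \<Rightarrow> nat \<Rightarrow> complex mat set monoid" where
  "proj_clifford \<omega> n = clifford \<omega> n Mod phases \<omega> n"

definition proj_class :: "complex \<Rightarrow> nat \<Rightarrow> complex mat \<Rightarrow> complex mat set" where
  "proj_class \<omega> n U = phases \<omega> n #>\<^bsub>clifford \<omega> n\<^esub> U"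

definition h_gate :: "complex \<Rightarrow> nat \<Rightarrow> nat \<Rightarrow> complex mat set" where
  "h_gate \<omega> n i = proj_class \<omega> n (on_qubit n i H_mat)"

definition s_gate :: "complex \<Rightarrow> nat \<Rightarrow> nat \<Rightarrow> complex mat set" where
  "s_gate \<omega> n i = proj_class \<omega> n (on_qubit n i (S_mat \<omega>))"

definition cz_gate :: "complex \<Rightarrow> nat \<Rightarrow> nat \<Rightarrow> complex mat set" where
  "cz_gate \<omega> n i = proj_class \<omega> n (on_adjacent_qubits n i CZ_mat)"

definition centralizer :: "('a, 'b) monoid_scheme \<Rightarrow> 'a \<Rightarrow> 'a set" where
  "centralizer G u = {g \<in> carrier G. u \<otimes>\<^bsub>G\<^esub> g = g \<otimes>\<^bsub>G\<^esub> u}"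

definition M_elt :: "complex \<Rightarrow> nat \<Rightarrow> complex mat set" where
  "M_elt \<omega> n =
     (let C = proj_clifford \<omega> n; h = h_gate \<omega> n; s = s_gate \<omega> n; \<Lambda> = cz_gate \<omega> n in
      h 2 \<otimes>\<^bsub>C\<^esub> \<Lambda> 1 \<otimes>\<^bsub>C\<^esub> s 2 [^]\<^bsub>C\<^esub> (2::nat) \<otimes>\<^bsub>C\<^esub> h 2 \<otimes>\<^bsub>C\<^esub> h 1
      \<otimes>\<^bsub>C\<^esub> s 1 [^]\<^bsub>C\<^esub> (2::nat) \<otimes>\<^bsub>C\<^esub> h 2 \<otimes>\<^bsub>C\<^esub> \<Lambda> 1 \<otimes>\<^bsub>C\<^esub> h 2)"

text \<open>Only meant for \<open>n \<ge> 2\<close>; the generator \<open>h\<^sub>1 s\<^sub>1\<^sup>2 h\<^sub>1\<close> occurs for \<open>n = 2\<close> only.\<close>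

definition IN_group :: "complex \<Rightarrow> nat \<Rightarrow> complex mat set set" where
  "IN_group \<omega> n =
     (let C = proj_clifford \<omega> n; h = h_gate \<omega> n; s = s_gate \<omega> n; \<Lambda> = cz_gate \<omega> n in
      if n = 2
      then generate C {h 1, h 2, s 2, h 1 \<otimes>\<^bsub>C\<^esub> s 1 [^]\<^bsub>C\<^esub> (2::nat) \<otimes>\<^bsub>C\<^esub> h 1, M_elt \<omega> n}
      else generate C (h ` {1..n} \<union> s ` {2..n} \<union> {M_elt \<omega> n} \<union> \<Lambda> ` {2..n - 1}))"

definition conjugate_in :: "('a, 'b) monoid_scheme \<Rightarrow> 'a set \<Rightarrow> 'a set \<Rightarrow> bool" where
  "conjugate_in G H K \<longleftrightarrow> (\<exists>g \<in> carrier G. g <#\<^bsub>G\<^esub> H #>\<^bsub>G\<^esub> (inv\<^bsub>G\<^esub> g) = K)"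

end

theory Submission
  imports Defs
begin

text \<open>
  Write \<open>y\<close> for the class of \<open>Z\<^sub>1 X\<^sub>1\<close>, which is \<open>Y\<^sub>1\<close> up to a phase. All generators of
  \<open>IN\<^sub>n\<close> fix \<open>y\<close>: \<open>h\<^sub>1\<close> exchanges \<open>X\<^sub>1\<close> and \<open>Z\<^sub>1\<close>, the gates on the other qubits commute with
  everything on the first one, and \<open>M\<close> is the product of \<open>X\<^sub>2\<close> and \<open>exp ((\<pi> / 4) Z\<^sub>1 X\<^sub>1 X\<^sub>2)\<close>
  (lemma \<open>m_mat_product\<close>). Since \<open>z\<^sub>1\<close> and \<open>y\<close> are conjugate, the theorem says that \<open>IN\<^sub>n\<close> is the
  whole centralizer of \<open>y\<close> (lemma \<open>IN_eq_centralizer\<close>).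

  The proof of this works with quarter turns \<open>exp ((\<pi> / 4) J) = (1 + J) / sqrt 2\<close>, where \<open>J\<close> is a
  Pauli matrix with \<open>J\<^sup>2 = -1\<close>. Conjugation by a quarter turn is a symplectic transvection of the
  Pauli matrices modulo phases, and up to phases \<open>H\<close>, \<open>S\<close> and \<open>CZ\<close> are products of quarter turns and
  Pauli matrices.

  First, \<open>IN\<^sub>n\<close> contains the quarter turns in all directions that commute with \<open>y\<close>
  (lemma \<open>commuting_quarter_turn\<close>). The set of available directions is closed under products of
  anticommuting elements (lemma \<open>turning_mult\<close>). So the directions \<open>x\<^sub>i\<close>, \<open>z\<^sub>i\<close>, \<open>z\<^sub>i z\<^sub>i\<^sub>+\<^sub>1\<close>
  with \<open>i \<ge> 2\<close> yield every nontrivial direction \<open>A\<close> on the qubits from \<open>2\<close> on, and \<open>M\<close> adds all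
  \<open>A y\<close>. The isolated direction \<open>y\<close> is obtained for \<open>n \<ge> 3\<close> from a relation between
  controlled Pauli matrices (lemma \<open>quarter_turn_from_controls\<close>), and for \<open>n = 2\<close> from the additional
  generator \<open>x\<^sub>1\<close>.

  Second, these quarter turns suffice to undo any Clifford matrix \<open>U\<close> that fixes \<open>y\<close> up to sign.
  One after another, the images under \<open>U\<close> of \<open>x\<^sub>1, z\<^sub>2, x\<^sub>2, z\<^sub>3, \<dots>\<close> are moved back, each time by at
  most two transvections that fix what has been settled before (lemmas \<open>move_back\<close>, \<open>fix_prefix\<close>).
  What remains is a Pauli matrix times a scalar (lemma \<open>stabilizer_in_K\<close>).

  Third, this scalar lies in the Clifford group. Entries of Clifford matrices are cyclotomic integers
  divided by powers of \<open>2\<close>, and such a number of modulus \<open>1\<close> is a power of \<open>\<omega>\<close>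
  (lemma \<open>dyadic_unit\<close>), so it disappears in the projective group.
\<close>


section \<open>Matrices that commute up to a sign\<close>

text \<open>
  The factor is kept explicit, so that commuting (\<open>s = 1\<close>) and anticommuting (\<open>s = -1\<close>) pairs are
  treated together and the factors of products multiply.
\<close>

definition twist :: "complex \<Rightarrow> complex mat \<Rightarrow> complex mat \<Rightarrow> bool" where
  "twist s A B \<longleftrightarrow> A * B = s \<cdot>\<^sub>m (B * A)"

definition is_sign :: "complex \<Rightarrow> bool" where
  "is_sign s \<longleftrightarrow> s = 1 \<or> s = -1"

lemma is_sign_simps [simp]: "is_sign 1" "is_sign (-1)" "is_sign s \<Longrightarrow> s * s = 1"
  by (auto simp: is_sign_def)

lemma is_sign_mult: "is_sign s \<Longrightarrow> is_sign t \<Longrightarrow> is_sign (s * t)"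
  by (auto simp: is_sign_def)

definition quarter_turn :: "complex mat \<Rightarrow> complex mat" where
  "quarter_turn J = complex_of_real (1 / sqrt 2) \<cdot>\<^sub>m (1\<^sub>m (dim_row J) + J)"

lemma smult_smult_mat: "a \<cdot>\<^sub>m (b \<cdot>\<^sub>m (A :: complex mat)) = (a * b) \<cdot>\<^sub>m A"
  by (intro eq_matI) auto

lemma one_smult_mat [simp]: "1 \<cdot>\<^sub>m (A :: complex mat) = A"
  by (intro eq_matI) auto

lemma half_root: "complex_of_real (1 / sqrt 2) * complex_of_real (1 / sqrt 2) = 1 / 2"
  by (simp flip: of_real_mult add: real_sqrt_mult_self)

locale square_matrices =
  fixes d :: nat
begin

abbreviation Mat :: "complex mat set" where
  "Mat \<equiv> carrier_mat d d"

lemma mat_assoc: "A \<in> Mat \<Longrightarrow> B \<in> Mat \<Longrightarrow> C \<in> Mat \<Longrightarrow> (A * B) * C = A * (B * C)"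
  by (rule assoc_mult_mat)

lemma mat_smult_left: "A \<in> Mat \<Longrightarrow> B \<in> Mat \<Longrightarrow> (a \<cdot>\<^sub>m A) * B = a \<cdot>\<^sub>m (A * B)"
  by (rule mult_smult_assoc_mat)

lemma mat_smult_right: "A \<in> Mat \<Longrightarrow> B \<in> Mat \<Longrightarrow> A * (a \<cdot>\<^sub>m B) = a \<cdot>\<^sub>m (A * B)"
  by (rule mult_smult_distrib)

lemma mat_distrib_left: "A \<in> Mat \<Longrightarrow> B \<in> Mat \<Longrightarrow> C \<in> Mat \<Longrightarrow> A * (B + C) = A * B + A * C"
  by (rule mult_add_distrib_mat)

lemma mat_distrib_right: "A \<in> Mat \<Longrightarrow> B \<in> Mat \<Longrightarrow> C \<in> Mat \<Longrightarrow> (A + B) * C = A * C + B * C"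
  by (rule add_mult_distrib_mat)

lemma mat_smult_add: "A \<in> Mat \<Longrightarrow> B \<in> Mat \<Longrightarrow> a \<cdot>\<^sub>m (A + B) = a \<cdot>\<^sub>m A + a \<cdot>\<^sub>m B"
  by (rule add_smult_distrib_left_mat)

lemma mat_mult_closed [simp, intro]: "A \<in> Mat \<Longrightarrow> B \<in> Mat \<Longrightarrow> A * B \<in> Mat"
  by (rule mult_carrier_mat)

lemma mat_add_closed [simp, intro]: "A \<in> Mat \<Longrightarrow> B \<in> Mat \<Longrightarrow> A + B \<in> Mat"
  by (rule add_carrier_mat)

lemma mat_one_left: "A \<in> Mat \<Longrightarrow> 1\<^sub>m d * A = A"
  by (rule left_mult_one_mat)

lemma mat_one_right: "A \<in> Mat \<Longrightarrow> A * 1\<^sub>m d = A"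
  by (rule right_mult_one_mat)

lemmas mat_norm = mat_assoc mat_smult_left mat_smult_right smult_smult_mat
  mat_one_left mat_one_right

lemmas mat_expand = mat_norm mat_distrib_left mat_distrib_right mat_smult_add

lemma mat_cancel_right:
  assumes "A \<in> Mat" "B \<in> Mat" "U \<in> Mat" "V \<in> Mat" "U * V = 1\<^sub>m d" "A * U = B * U"
  shows "A = B"
proof -
  have "A * U * V = B * U * V" using assms(6) by simp
  then show ?thesis using assms(1-5) by (simp add: mat_norm)
qed

lemma twist_mult_right:
  assumes "A \<in> Mat" "B \<in> Mat" "C \<in> Mat" "twist s A B" "twist t A C"
  shows "twist (s * t) A (B * C)"
proof -
  have "A * (B * C) = (A * B) * C" using assms by (simp add: mat_norm)
  also have "\<dots> = s \<cdot>\<^sub>m (B * (A * C))" using assms by (simp add: twist_def mat_norm)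
  also have "\<dots> = (s * t) \<cdot>\<^sub>m (B * C * A)" using assms by (simp add: twist_def mat_norm)
  finally show ?thesis by (simp add: twist_def)
qed

lemma twist_mult_left:
  assumes "A \<in> Mat" "B \<in> Mat" "C \<in> Mat" "twist s A C" "twist t B C"
  shows "twist (s * t) (A * B) C"
proof -
  have "A * B * C = A * (B * C)" using assms by (simp add: mat_norm)
  also have "\<dots> = t \<cdot>\<^sub>m ((A * C) * B)" using assms(1-3,5) by (simp add: twist_def mat_norm)
  also have "\<dots> = (s * t) \<cdot>\<^sub>m (C * (A * B))" using assms by (simp add: twist_def mat_norm mult.commute)
  finally show ?thesis by (simp add: twist_def)
qed

lemma twist_sym: "is_sign s \<Longrightarrow> twist s A B \<Longrightarrow> twist s B A"
  by (simp add: twist_def smult_smult_mat)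

lemma twist_smult_left: "A \<in> Mat \<Longrightarrow> B \<in> Mat \<Longrightarrow> twist s A B \<Longrightarrow> twist s (c \<cdot>\<^sub>m A) B"
  by (simp add: twist_def mat_norm mult.commute)

lemma twist_smult_right: "A \<in> Mat \<Longrightarrow> B \<in> Mat \<Longrightarrow> twist s A B \<Longrightarrow> twist s A (c \<cdot>\<^sub>m B)"
  by (simp add: twist_def mat_norm mult.commute)

lemma twist_self: "twist 1 A A"
  by (simp add: twist_def)

lemma twist_one [simp]: "A \<in> Mat \<Longrightarrow> twist 1 A (1\<^sub>m d)" "A \<in> Mat \<Longrightarrow> twist 1 (1\<^sub>m d) A"
  by (simp_all add: twist_def mat_norm)

subsection \<open>Quarter turns\<close>

lemma quarter_turn_closed [simp, intro]: "J \<in> Mat \<Longrightarrow> quarter_turn J \<in> Mat"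
  by (auto simp: quarter_turn_def)

lemma quarter_turn_alt:
  "J \<in> Mat \<Longrightarrow> quarter_turn J = complex_of_real (1 / sqrt 2) \<cdot>\<^sub>m (1\<^sub>m d + J)"
  by (auto simp: quarter_turn_def)

text \<open>
  With \<open>J\<^sup>2 = -1\<close> the matrix \<open>quarter_turn J\<close> is \<open>exp ((\<pi> / 4) J)\<close>. Conjugation by it multiplies
  everything that anticommutes with \<open>J\<close> by \<open>J\<close>: on Pauli matrices modulo phases it acts
  as the symplectic transvection in the direction \<open>J\<close>.
\<close>

lemma quarter_turn_anticommute:
  assumes "J \<in> Mat" "L \<in> Mat" "J * J = (-1) \<cdot>\<^sub>m 1\<^sub>m d" "twist (-1) J L"
  shows "quarter_turn J * L = J * L * quarter_turn J"
proof -
  have LJ: "L * J = (-1) \<cdot>\<^sub>m (J * L)"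
    using twist_sym[of "-1" J L] assms by (simp add: twist_def)
  have "J * (L * J) = (-1) \<cdot>\<^sub>m ((J * J) * L)"
    unfolding LJ using assms(1,2) by (simp add: mat_norm)
  then have JLJ: "J * (L * J) = L"
    unfolding assms(3) using assms(1,2) by (simp add: mat_norm)
  show ?thesis
    using assms(1,2) JLJ by (simp add: quarter_turn_alt mat_expand) (intro eq_matI, auto)
qed

lemma quarter_turn_commute:
  assumes "J \<in> Mat" "L \<in> Mat" "twist 1 J L"
  shows "twist 1 (quarter_turn J) L"
  using assms by (simp add: quarter_turn_alt twist_def mat_expand)

lemma quarter_turn_inverse:
  assumes "J \<in> Mat" "J * J = (-1) \<cdot>\<^sub>m 1\<^sub>m d"
  shows "quarter_turn J * quarter_turn ((-1) \<cdot>\<^sub>m J) = 1\<^sub>m d"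
        "quarter_turn ((-1) \<cdot>\<^sub>m J) * quarter_turn J = 1\<^sub>m d"
  using assms half_root
  by (simp_all add: quarter_turn_alt mat_expand del: of_real_divide)
    (intro eq_matI, auto simp flip: distrib_left)+

lemma quarter_turn_square:
  assumes "J \<in> Mat" "J * J = (-1) \<cdot>\<^sub>m 1\<^sub>m d"
  shows "quarter_turn J * quarter_turn J = J"
  using assms half_root
  by (simp_all add: quarter_turn_alt mat_expand del: of_real_divide)
    (intro eq_matI, auto)

lemma quarter_turn_conjugate:
  assumes "J \<in> Mat" "L \<in> Mat" "J * J = (-1) \<cdot>\<^sub>m 1\<^sub>m d" "twist (-1) J L"
  shows "quarter_turn J * quarter_turn L = quarter_turn (J * L) * quarter_turn J"
  using assms(1,2) quarter_turn_anticommute[OF assms]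
  by (simp add: quarter_turn_alt[of L] quarter_turn_alt[of "J * L"] mat_expand)

lemma square_mult:
  assumes "A \<in> Mat" "B \<in> Mat" "twist s A B" "A * A = a \<cdot>\<^sub>m 1\<^sub>m d" "B * B = b \<cdot>\<^sub>m 1\<^sub>m d" "is_sign s"
  shows "(A * B) * (A * B) = (s * a * b) \<cdot>\<^sub>m 1\<^sub>m d"
proof -
  have BA: "B * A = s \<cdot>\<^sub>m (A * B)"
    using twist_sym[OF assms(6,3)] by (simp add: twist_def)
  have "(A * B) * (A * B) = A * (B * A) * B" using assms by (simp add: mat_norm)
  also have "\<dots> = s \<cdot>\<^sub>m ((A * A) * (B * B))" unfolding BA using assms(1,2) by (simp add: mat_norm)
  also have "\<dots> = (s * a * b) \<cdot>\<^sub>m 1\<^sub>m d" unfolding assms(4,5) by (simp add: mat_norm mult_ac)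
  finally show ?thesis .
qed

end

section \<open>Pauli matrices\<close>

text \<open>
  The relations of the operators \<open>X\<^sub>i\<close> and \<open>Z\<^sub>i\<close> on \<open>n\<close> qubits. The last assumption is
  irreducibility; it makes the commutation form nondegenerate.
\<close>

locale pauli_system = square_matrices d for d :: nat +
  fixes n :: nat and \<zeta> :: complex and x z :: "nat \<Rightarrow> complex mat"
  assumes d_pos: "0 < d"
    and zeta_square: "\<zeta> * \<zeta> = -1"
    and x_closed [simp]: "i \<in> {1..n} \<Longrightarrow> x i \<in> Mat"
    and z_closed [simp]: "i \<in> {1..n} \<Longrightarrow> z i \<in> Mat"
    and x_square: "i \<in> {1..n} \<Longrightarrow> x i * x i = 1\<^sub>m d"
    and z_square: "i \<in> {1..n} \<Longrightarrow> z i * z i = 1\<^sub>m d"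
    and twist_xx: "i \<in> {1..n} \<Longrightarrow> j \<in> {1..n} \<Longrightarrow> twist 1 (x i) (x j)"
    and twist_zz: "i \<in> {1..n} \<Longrightarrow> j \<in> {1..n} \<Longrightarrow> twist 1 (z i) (z j)"
    and twist_xz: "i \<in> {1..n} \<Longrightarrow> j \<in> {1..n} \<Longrightarrow> twist (if i = j then -1 else 1) (x i) (z j)"
    and commutant: "A \<in> Mat \<Longrightarrow> (\<And>i. i \<in> {1..n} \<Longrightarrow> twist 1 A (x i))
      \<Longrightarrow> (\<And>i. i \<in> {1..n} \<Longrightarrow> twist 1 A (z i)) \<Longrightarrow> \<exists>c. A = c \<cdot>\<^sub>m 1\<^sub>m d"
begin

text \<open>
  \<open>pauli S\<close> is the Pauli group of the qubits in \<open>S\<close>, with the fourth roots of unity as phases.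
\<close>

inductive_set pauli :: "nat set \<Rightarrow> complex mat set" for S where
  one: "1\<^sub>m d \<in> pauli S"
| phase: "P \<in> pauli S \<Longrightarrow> \<zeta> \<cdot>\<^sub>m P \<in> pauli S"
| generator: "i \<in> S \<inter> {1..n} \<Longrightarrow> G \<in> {x i, z i} \<Longrightarrow> P \<in> pauli S \<Longrightarrow> G * P \<in> pauli S"

lemma generator_closed: "i \<in> {1..n} \<Longrightarrow> G \<in> {x i, z i} \<Longrightarrow> G \<in> Mat"
  by auto

lemma pauli_closed [simp, intro]: "P \<in> pauli S \<Longrightarrow> P \<in> Mat"
  by (induction rule: pauli.induct) auto

lemma pauli_mono: "S \<subseteq> T \<Longrightarrow> P \<in> pauli S \<Longrightarrow> P \<in> pauli T"
proof (rotate_tac, induction rule: pauli.induct)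
  case (generator i G P)
  then show ?case by (intro pauli.generator[of i]) auto
qed (auto intro: pauli.intros)

lemma pauli_generator: "i \<in> S \<Longrightarrow> i \<in> {1..n} \<Longrightarrow> G \<in> {x i, z i} \<Longrightarrow> G \<in> pauli S"
  using pauli.generator[OF _ _ pauli.one, of i S G] generator_closed[of i G] by (auto simp: mat_norm)

lemma pauli_x: "i \<in> S \<Longrightarrow> i \<in> {1..n} \<Longrightarrow> x i \<in> pauli S"
  using pauli_generator[of i S "x i"] by simp

lemma pauli_z: "i \<in> S \<Longrightarrow> i \<in> {1..n} \<Longrightarrow> z i \<in> pauli S"
  using pauli_generator[of i S "z i"] by simp

lemma pauli_mult [intro]: "P \<in> pauli S \<Longrightarrow> Q \<in> pauli S \<Longrightarrow> P * Q \<in> pauli S"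
proof (induction rule: pauli.induct)
  case (generator i G P)
  then have "(G * P) * Q = G * (P * Q)" using generator_closed[of i G] by (intro mat_assoc) blast+
  moreover have "G * (P * Q) \<in> pauli S" using pauli.generator[OF generator(1,2)] generator by blast
  ultimately show ?case by simp
qed (auto simp: mat_norm intro: pauli.intros)

lemma pauli_uminus: "P \<in> pauli S \<Longrightarrow> (-1) \<cdot>\<^sub>m P \<in> pauli S"
  using pauli.phase[OF pauli.phase[of P S]] by (simp add: smult_smult_mat zeta_square)

lemma pauli_sign: "is_sign s \<Longrightarrow> P \<in> pauli S \<Longrightarrow> s \<cdot>\<^sub>m P \<in> pauli S"
  using pauli_uminus by (auto simp: is_sign_def)

lemma twist_zx: "i \<in> {1..n} \<Longrightarrow> j \<in> {1..n} \<Longrightarrow> twist (if i = j then -1 else 1) (z i) (x j)"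
  using twist_sym[OF _ twist_xz[of j i]] by (auto split: if_splits)

lemma generator_twist:
  assumes "i \<in> {1..n}" "j \<in> {1..n}" "G \<in> {x i, z i}" "H \<in> {x j, z j}"
  shows "\<exists>s. is_sign s \<and> twist s G H \<and> (i \<noteq> j \<longrightarrow> s = 1)"
  using assms(3,4) twist_xx[OF assms(1,2)] twist_zz[OF assms(1,2)] twist_xz[OF assms(1,2)] twist_zx[OF assms(1,2)]
  by (auto split: if_splits intro: exI[of _ 1] exI[of _ "-1"])

lemma generator_pauli_twist:
  assumes "P \<in> pauli S" and G: "i \<in> {1..n}" "G \<in> {x i, z i}"
  shows "\<exists>s. is_sign s \<and> twist s G P \<and> (i \<notin> S \<longrightarrow> s = 1)"
  using assms(1)
proof (induction rule: pauli.induct)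
  case one
  then show ?case using generator_closed[OF G] by (intro exI[of _ 1]) auto
next
  case phase
  then show ?case using generator_closed[OF G] pauli_closed twist_smult_right by blast
next
  case (generator j H P)
  obtain s where s: "is_sign s" "twist s G P" "i \<notin> S \<longrightarrow> s = 1" using generator by blast
  obtain t where t: "is_sign t" "twist t G H" "i \<noteq> j \<longrightarrow> t = 1"
    using generator_twist[OF G(1) _ G(2), of j H] generator by blast
  have "twist (t * s) G (H * P)"
    using twist_mult_right[OF generator_closed[OF G] _ _ t(2) s(2)] generator_closed[of j H] generator by blast
  then show ?case using s t generator is_sign_mult by (intro exI[of _ "t * s"]) auto
qed

text \<open>Commutation signs multiply along products, and generators on different qubits commute.\<close>

lemma pauli_twist:
  assumes "P \<in> pauli S" "Q \<in> pauli T"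
  obtains s where "is_sign s" "twist s P Q" "S \<inter> T = {} \<longrightarrow> s = 1"
proof -
  have "\<exists>s. is_sign s \<and> twist s P Q \<and> (S \<inter> T = {} \<longrightarrow> s = 1)" using assms(1)
  proof (induction rule: pauli.induct)
    case one
    then show ?case using assms(2) by (intro exI[of _ 1]) auto
  next
    case phase
    then show ?case using assms(2) pauli_closed twist_smult_left by blast
  next
    case (generator i G P)
    obtain s where s: "is_sign s" "twist s P Q" "S \<inter> T = {} \<longrightarrow> s = 1" using generator by blast
    obtain t where t: "is_sign t" "twist t G Q" "i \<notin> T \<longrightarrow> t = 1"
      using generator_pauli_twist[OF assms(2), of i G] generator by blast
    have "twist (t * s) (G * P) Q"
      using twist_mult_left[OF _ _ _ t(2) s(2)] generator_closed[of i G] generator assms(2) by blast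
    then show ?case using s t generator is_sign_mult by (intro exI[of _ "t * s"]) auto
  qed
  then show ?thesis using that by blast
qed

lemma pauli_disjoint_commute: "P \<in> pauli S \<Longrightarrow> Q \<in> pauli T \<Longrightarrow> S \<inter> T = {} \<Longrightarrow> twist 1 P Q"
  using pauli_twist by metis

lemma scalar_inject:
  assumes "a \<cdot>\<^sub>m 1\<^sub>m d = b \<cdot>\<^sub>m (1\<^sub>m d :: complex mat)"
  shows "a = b"
proof -
  have "(a \<cdot>\<^sub>m 1\<^sub>m d) $$ (0, 0) = (b \<cdot>\<^sub>m (1\<^sub>m d :: complex mat)) $$ (0, 0)" using assms by simp
  then show ?thesis using d_pos by simp
qed

lemma pauli_square:
  assumes "P \<in> pauli S"
  obtains s where "is_sign s" "P * P = s \<cdot>\<^sub>m 1\<^sub>m d"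
proof -
  have "\<exists>s. is_sign s \<and> P * P = s \<cdot>\<^sub>m 1\<^sub>m d" using assms
  proof (induction rule: pauli.induct)
    case one
    then show ?case by (intro exI[of _ 1]) (auto simp: mat_norm)
  next
    case (phase P)
    then obtain s where "is_sign s" "P * P = s \<cdot>\<^sub>m 1\<^sub>m d" by auto
    then show ?case using phase(1)
      by (intro exI[of _ "-s"]) (auto simp: mat_norm is_sign_def zeta_square mult.assoc[symmetric])
  next
    case (generator i G P)
    then obtain s t where s: "is_sign s" "P * P = s \<cdot>\<^sub>m 1\<^sub>m d" and t: "is_sign t" "twist t G P"
      using generator_pauli_twist by blast
    have "G * G = 1 \<cdot>\<^sub>m 1\<^sub>m d" using generator x_square z_square by auto
    then have "(G * P) * (G * P) = (t * 1 * s) \<cdot>\<^sub>m 1\<^sub>m d"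
      using square_mult[OF _ _ t(2) _ s(2) t(1)] generator_closed[of i G] generator by blast
    then show ?case using s t is_sign_mult by (intro exI[of _ "t * s"]) auto
  qed
  then show ?thesis using that by blast
qed

text \<open>
  Within \<open>pauli S\<close>, being active is the same as not being a scalar; the witness is what the
  arguments with transvections use.
\<close>

definition active :: "nat set \<Rightarrow> complex mat \<Rightarrow> bool" where
  "active S A \<longleftrightarrow> (\<exists>B \<in> pauli S. twist (-1) A B)"

lemma twist_sign_unique:
  assumes "A \<in> pauli S" "B \<in> pauli T" "twist (-1) A B"
  shows "\<not> twist 1 A B"
proof
  assume "twist 1 A B"
  then have "(-1) \<cdot>\<^sub>m (B * A) = B * A" using assms(3) by (simp add: twist_def)
  moreover obtain s where s: "is_sign s" "(B * A) * (B * A) = s \<cdot>\<^sub>m 1\<^sub>m d"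
    using pauli_square[of "B * A" UNIV] pauli_mono[OF subset_UNIV] assms(1,2) by (metis pauli_mult)
  have BA: "B * A \<in> Mat" using assms by auto
  have "((-1) \<cdot>\<^sub>m (B * A)) * (B * A) = (-1) \<cdot>\<^sub>m ((B * A) * (B * A))"
    using BA by (rule mat_smult_left[OF _ BA])
  ultimately have "s \<cdot>\<^sub>m 1\<^sub>m d = (- s) \<cdot>\<^sub>m (1\<^sub>m d :: complex mat)"
    using s(2) by (simp add: smult_smult_mat)
  then have "s = - s" by (rule scalar_inject)
  then show False using s(1) by (auto simp: is_sign_def)
qed

text \<open>
  The commutation form is nondegenerate on every block of qubits: a Pauli matrix of the block that
  commutes with the block also commutes with the other qubits, so it is a scalar.
\<close>

lemma pauli_active_or_scalar:
  assumes "A \<in> pauli S"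
  shows "active S A \<or> (\<exists>c. A = c \<cdot>\<^sub>m 1\<^sub>m d)"
proof (cases "active S A")
  case False
  have in_S: "twist 1 A B" if "B \<in> pauli S" for B
    using pauli_twist[OF assms that] that False by (metis active_def is_sign_def)
  have "twist 1 A (x i)" if "i \<in> {1..n}" for i
    using in_S[OF pauli_x[of i S]] pauli_disjoint_commute[OF assms pauli_x[of i "{i}"]] that
    by (cases "i \<in> S") auto
  moreover have "twist 1 A (z i)" if "i \<in> {1..n}" for i
    using in_S[OF pauli_z[of i S]] pauli_disjoint_commute[OF assms pauli_z[of i "{i}"]] that
    by (cases "i \<in> S") auto
  ultimately show ?thesis using commutant assms by blast
qed simp

text \<open>
  If neither the partner of \<open>A\<close> nor that of \<open>B\<close> serves for both, their product does.
\<close>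

lemma common_anticommuting:
  assumes "A \<in> pauli S" "B \<in> pauli S" "active T A" "active T B"
  obtains R where "R \<in> pauli T" "twist (-1) A R" "twist (-1) B R"
proof -
  obtain P Q where P: "P \<in> pauli T" "twist (-1) A P" and Q: "Q \<in> pauli T" "twist (-1) B Q"
    using assms unfolding active_def by auto
  obtain s t where s: "is_sign s" "twist s A Q" and t: "is_sign t" "twist t B P"
    using pauli_twist assms P Q by metis
  consider "s = -1" | "t = -1" | "s = 1" "t = 1" using s t by (auto simp: is_sign_def)
  then show ?thesis
  proof cases
    case 3
    have "twist (-1) A (P * Q)" "twist (-1) B (P * Q)"
      using twist_mult_right[of A P Q "-1" 1] twist_mult_right[of B P Q 1 "-1"] 3 s t P Q assms by auto
    then show ?thesis using that P Q by blast
  qed (use that s t P Q in auto)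
qed

lemma pauli_single:
  assumes "A \<in> pauli {i}" "i \<in> {1..n}"
  obtains c B where "c \<noteq> 0" "A = c \<cdot>\<^sub>m B" "B \<in> {1\<^sub>m d, x i, z i, z i * x i}"
proof -
  have xz: "x i * z i = (-1) \<cdot>\<^sub>m (z i * x i)" using twist_xz[of i i] assms(2) by (simp add: twist_def)
  have xzx: "x i * (z i * x i) = (-1) \<cdot>\<^sub>m z i"
    using xz x_square[of i] assms(2) by (simp flip: mat_assoc) (simp add: mat_norm)
  have zzx: "z i * (z i * x i) = x i"
    using z_square[of i] assms(2) by (simp flip: mat_assoc) (simp add: mat_norm)
  have zeta0: "\<zeta> \<noteq> 0" using zeta_square by auto
  have "\<exists>c B. c \<noteq> 0 \<and> A = c \<cdot>\<^sub>m B \<and> B \<in> {1\<^sub>m d, x i, z i, z i * x i}" using assms(1)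
  proof (induction rule: pauli.induct)
    case one then show ?case by (intro exI[of _ 1] exI[of _ "1\<^sub>m d"]) auto
  next
    case (phase P)
    then obtain c B where "c \<noteq> 0" "P = c \<cdot>\<^sub>m B" "B \<in> {1\<^sub>m d, x i, z i, z i * x i}" by blast
    then show ?case by (intro exI[of _ "\<zeta> * c"] exI[of _ B]) (auto simp: smult_smult_mat zeta0)
  next
    case (generator j G P)
    then obtain c B where B: "c \<noteq> 0" "P = c \<cdot>\<^sub>m B" "B \<in> {1\<^sub>m d, x i, z i, z i * x i}" "j = i" by blast
    have m: "G \<in> {x i, z i}" "B \<in> Mat" using generator(2) B(3,4) assms(2) by auto
    have "G * P = c \<cdot>\<^sub>m (G * B)"
      unfolding B(2) by (rule mat_smult_right[OF generator_closed[OF assms(2) m(1)] m(2)])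
    moreover have "\<exists>e B'. e \<noteq> 0 \<and> G * B = e \<cdot>\<^sub>m B' \<and> B' \<in> {1\<^sub>m d, x i, z i, z i * x i}"
      using B(3) m(1) assms(2) xz xzx zzx x_square[of i] z_square[of i]
      by (elim insertE) (auto simp: mat_norm intro: exI[of _ 1] exI[of _ "-1"])
    ultimately show ?case using B(1) by (metis no_zero_divisors smult_smult_mat)
  qed
  then show ?thesis using that by blast
qed

text \<open>
  The factors on different qubits commute, so they can be sorted.
\<close>

lemma pauli_split:
  assumes "A \<in> pauli (S \<union> T)" "S \<inter> T = {}"
  obtains B C where "B \<in> pauli S" "C \<in> pauli T" "A = B * C"
proof -
  have "\<exists>B C. B \<in> pauli S \<and> C \<in> pauli T \<and> A = B * C" using assms(1)
  proof (induction rule: pauli.induct)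
    case one then show ?case
      by (intro exI[of _ "1\<^sub>m d"]) (auto simp: mat_norm intro: pauli.one)
  next
    case (phase P)
    then obtain B C where "B \<in> pauli S" "C \<in> pauli T" "P = B * C" by blast
    then show ?case
      by (intro exI[of _ "\<zeta> \<cdot>\<^sub>m B"] exI[of _ C]) (auto simp: mat_norm intro: pauli.phase)
  next
    case (generator i G P)
    then obtain B C where P: "B \<in> pauli S" "C \<in> pauli T" "P = B * C" by blast
    have G: "G \<in> Mat" using generator_closed[of i G] generator by blast
    show ?case
    proof (cases "i \<in> S")
      case True
      then have "G * B \<in> pauli S" using generator P by (intro pauli.generator[of i]) auto
      moreover have "G * P = (G * B) * C" using P G by (simp add: mat_norm)
      ultimately show ?thesis using P(2) by blast
    next
      case False
      then have i: "i \<in> T" "i \<in> {1..n}" using generator by auto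
      then have "G * C \<in> pauli T" using generator(2) P by (intro pauli.generator[of i]) auto
      moreover have "twist 1 G B"
        using pauli_disjoint_commute[OF pauli_generator[OF i generator(2)] P(1)] assms(2) by blast
      then have "G * P = B * (G * C)"
        using P G by (simp add: twist_def flip: mat_assoc)
      ultimately show ?thesis using P(1) by blast
    qed
  qed
  then show ?thesis using that by blast
qed

lemma scalar_not_active:
  assumes "c \<cdot>\<^sub>m 1\<^sub>m d \<in> pauli S"
  shows "\<not> active T (c \<cdot>\<^sub>m 1\<^sub>m d)"
proof
  assume "active T (c \<cdot>\<^sub>m 1\<^sub>m d)"
  then obtain B where B: "B \<in> pauli T" "twist (-1) (c \<cdot>\<^sub>m 1\<^sub>m d) B" by (auto simp: active_def)
  then show False using twist_sign_unique[OF assms B] twist_smult_left[of "1\<^sub>m d" B 1 c] by auto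
qed

subsection \<open>Controlled Pauli matrices\<close>

definition control :: "complex mat \<Rightarrow> complex mat \<Rightarrow> complex mat" where
  "control p q = (1 / 2) \<cdot>\<^sub>m (1\<^sub>m d + p + q + (-1) \<cdot>\<^sub>m (p * q))"

lemma control_closed [simp, intro]: "p \<in> Mat \<Longrightarrow> q \<in> Mat \<Longrightarrow> control p q \<in> Mat"
  by (auto simp: control_def)

text \<open>
  On the two eigenspaces of \<open>p\<close>, \<open>control p a\<close> is \<open>1\<close> and \<open>a\<close>, so for fixed \<open>p\<close> it is
  multiplicative in \<open>a\<close>.
\<close>

lemma control_mult:
  assumes "p \<in> Mat" "a \<in> Mat" "b \<in> Mat" "p * p = 1\<^sub>m d" "twist 1 p a"
  shows "control p a * control p b = control p (a * b)"
proof -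
  have ap: "a * p = p * a" using assms(5) by (simp add: twist_def)
  have app: "a * (p * C) = p * (a * C)" "p * (p * C) = C" if "C \<in> Mat" for C
    using that assms(1,2,4) ap mat_assoc[of a p C] mat_assoc[of p a C] mat_assoc[of p p C]
    by (simp_all add: mat_one_left)
  show ?thesis
    using assms(1-3) by (simp add: control_def mat_expand app ap assms(4)) (intro eq_matI, auto)
qed

lemma control_one: "p \<in> Mat \<Longrightarrow> control p (1\<^sub>m d) = 1\<^sub>m d"
  unfolding control_def by (simp add: mat_norm) (intro eq_matI, auto)

lemma control_square:
  assumes "p \<in> Mat" "q \<in> Mat" "p * p = 1\<^sub>m d" "q * q = 1\<^sub>m d" "twist 1 p q"
  shows "control p q * control p q = 1\<^sub>m d"
  using control_mult[OF assms(1,2,2,3,5)] control_one[OF assms(1)] assms(4) by simp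

lemma control_commute:
  assumes "p \<in> Mat" "q \<in> Mat" "A \<in> Mat" "twist 1 p A" "twist 1 q A"
  shows "twist 1 (control p q) A"
proof -
  have "p * A = A * p" "q * A = A * q" "(p * q) * A = A * (p * q)"
    using assms twist_mult_left[OF assms(1-5)] by (simp_all add: twist_def)
  then show ?thesis
    using assms(1-3) by (simp add: twist_def control_def mat_distrib_left mat_distrib_right mat_smult_left mat_smult_right mat_one_left mat_one_right)
qed

text \<open>A controlled \<open>q\<close> spreads whatever anticommutes with its control to \<open>q\<close>.\<close>

lemma control_anticommute:
  assumes m: "p \<in> Mat" "q \<in> Mat" "A \<in> Mat" and q: "q * q = 1\<^sub>m d"
    and t: "twist 1 p q" "twist (-1) p A" "twist 1 q A"
  shows "control p q * A = A * q * control p q"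
proof -
  have c: "p * A = (-1) \<cdot>\<^sub>m (A * p)" "q * A = A * q" "q * p = p * q"
    using t by (simp_all add: twist_def)
  have "p * (A * q) = (p * A) * q" using m by (simp add: mat_assoc)
  also have "\<dots> = (-1) \<cdot>\<^sub>m (A * (p * q))" unfolding c(1) using m by (simp add: mat_smult_left mat_assoc)
  finally have c3: "p * (A * q) = (-1) \<cdot>\<^sub>m (A * (p * q))" .
  have "q * (p * q) = (q * p) * q" using m by (simp add: mat_assoc)
  also have "\<dots> = p" unfolding c(3) using m q by (simp add: mat_assoc mat_one_right)
  finally have c4: "q * (p * q) = p" .
  show ?thesis
    using m by (simp add: control_def mat_expand c q c3 c4) (intro eq_matI, auto)
qed

text \<open>
  With \<open>p\<^sup>2 = q\<^sup>2 = 1\<close> and \<open>p q = q p\<close>, all factors are diagonal in a common basis; \<open>control p q\<close> is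
  \<open>-1\<close> where \<open>p = q = -1\<close> and \<open>1\<close> elsewhere.
\<close>

lemma control_quarter_turns:
  assumes "p \<in> Mat" "q \<in> Mat" "p * p = 1\<^sub>m d" "q * q = 1\<^sub>m d" "twist 1 p q"
  shows "quarter_turn (\<zeta> \<cdot>\<^sub>m (p * q)) * (quarter_turn ((- \<zeta>) \<cdot>\<^sub>m p) * quarter_turn ((- \<zeta>) \<cdot>\<^sub>m q))
       = ((1 - \<zeta>) * complex_of_real (1 / sqrt 2)) \<cdot>\<^sub>m control p q"
proof -
  define r where "r = complex_of_real (1 / sqrt 2)"
  have rr: "r * r = 1 / 2" unfolding r_def by (rule half_root)
  have qp: "q * p = p * q" using assms(5) by (simp add: twist_def)
  have qt: "quarter_turn (t \<cdot>\<^sub>m J) = r \<cdot>\<^sub>m (1\<^sub>m d + t \<cdot>\<^sub>m J)" if "J \<in> Mat" for t J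
    using that by (simp add: quarter_turn_alt r_def)
  define w where "w = p * q"
  have w: "w \<in> Mat" "p * q = w" "w * p = q" "w * q = p" "w * w = 1\<^sub>m d"
  proof -
    show "w \<in> Mat" "p * q = w" using assms by (auto simp: w_def)
    have "w * p = p * (p * q)" unfolding w_def using assms(1,2) qp by (simp add: mat_assoc)
    then show 1: "w * p = q" using assms by (simp add: mat_norm flip: mat_assoc[of p p q])
    have "w * q = p * (q * q)" unfolding w_def using assms(1,2) by (simp add: mat_assoc)
    then show 2: "w * q = p" using assms by (simp add: mat_norm)
    have "w * w = (w * p) * q" using assms(1,2) by (simp add: w_def mat_assoc)
    then show "w * w = 1\<^sub>m d" unfolding 1 using assms by simp
  qed
  have "quarter_turn ((- \<zeta>) \<cdot>\<^sub>m p) * quarter_turn ((- \<zeta>) \<cdot>\<^sub>m q)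
      = (r * r) \<cdot>\<^sub>m ((1\<^sub>m d + (- \<zeta>) \<cdot>\<^sub>m p) * (1\<^sub>m d + (- \<zeta>) \<cdot>\<^sub>m q))"
    unfolding qt[OF assms(1)] qt[OF assms(2)] using assms(1,2) by (simp add: mat_norm)
  also have "(1\<^sub>m d + (- \<zeta>) \<cdot>\<^sub>m p) * (1\<^sub>m d + (- \<zeta>) \<cdot>\<^sub>m q)
      = 1\<^sub>m d + (- \<zeta>) \<cdot>\<^sub>m p + (- \<zeta>) \<cdot>\<^sub>m q + (-1) \<cdot>\<^sub>m w"
    using assms(1,2) w zeta_square by (simp add: mat_expand) (intro eq_matI, auto)
  finally have two: "quarter_turn ((- \<zeta>) \<cdot>\<^sub>m p) * quarter_turn ((- \<zeta>) \<cdot>\<^sub>m q)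
      = (r * r) \<cdot>\<^sub>m (1\<^sub>m d + (- \<zeta>) \<cdot>\<^sub>m p + (- \<zeta>) \<cdot>\<^sub>m q + (-1) \<cdot>\<^sub>m w)" .
  have "(1\<^sub>m d + \<zeta> \<cdot>\<^sub>m w) * (1\<^sub>m d + (- \<zeta>) \<cdot>\<^sub>m p + (- \<zeta>) \<cdot>\<^sub>m q + (-1) \<cdot>\<^sub>m w)
      = (1 - \<zeta>) \<cdot>\<^sub>m (1\<^sub>m d + p + q + (-1) \<cdot>\<^sub>m w)"
    using assms(1,2) w zeta_square
    by (simp add: mat_expand) (intro eq_matI, auto simp: left_diff_distrib)
  then show ?thesis
    unfolding two w(2) control_def qt[OF w(1)] r_def[symmetric]
    using assms(1,2) w(1) by (simp add: mat_norm rr mult.commute)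
qed

end

section \<open>Groups containing many quarter turns\<close>

text \<open>
  In the application \<open>K\<close> is the preimage of \<open>IN\<^sub>n\<close> in the Clifford group. Inverses of
  quarter turns come from products, since a quarter turn has order eight.
\<close>

locale quarter_turn_monoid = pauli_system +
  fixes K :: "complex mat set"
  assumes K_closed [simp, intro]: "A \<in> K \<Longrightarrow> A \<in> Mat"
    and K_mult [intro]: "A \<in> K \<Longrightarrow> B \<in> K \<Longrightarrow> A * B \<in> K"
    and K_phase: "c ^ 8 = 1 \<Longrightarrow> c \<cdot>\<^sub>m 1\<^sub>m d \<in> K"
begin

lemma K_smult: "c ^ 8 = 1 \<Longrightarrow> A \<in> K \<Longrightarrow> c \<cdot>\<^sub>m A \<in> K"
  using K_mult[OF K_phase, of c A] by (simp add: mat_norm)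

lemma K_uminus: "A \<in> K \<Longrightarrow> (-1) \<cdot>\<^sub>m A \<in> K"
  by (rule K_smult) auto

text \<open>
  Directions matter only up to phases: exactly two multiples of a Pauli matrix have square \<open>-1\<close>,
  they differ by a sign, and their quarter turns are inverse to each other.
\<close>

definition turning :: "complex mat \<Rightarrow> bool" where
  "turning A \<longleftrightarrow> (\<exists>c. (c \<cdot>\<^sub>m A) * (c \<cdot>\<^sub>m A) = (-1) \<cdot>\<^sub>m 1\<^sub>m d \<and> quarter_turn (c \<cdot>\<^sub>m A) \<in> K)"

lemma quarter_turn_uminus_in_K:
  assumes "J \<in> Mat" "J * J = (-1) \<cdot>\<^sub>m 1\<^sub>m d" "quarter_turn J \<in> K"
  shows "quarter_turn ((-1) \<cdot>\<^sub>m J) \<in> K"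
proof -
  have "(-1) \<cdot>\<^sub>m (quarter_turn J * (quarter_turn J * quarter_turn J)) = (-1) \<cdot>\<^sub>m (quarter_turn J * J)"
    using quarter_turn_square[OF assms(1,2)] by simp
  also have "\<dots> = quarter_turn ((-1) \<cdot>\<^sub>m J)"
    using assms(1,2) by (simp add: quarter_turn_alt mat_expand) (intro eq_matI, auto)
  finally show ?thesis using assms(3) by (metis K_mult K_uminus)
qed

lemma turning_quarter_turn:
  assumes "A \<in> pauli S" "turning A" "(e \<cdot>\<^sub>m A) * (e \<cdot>\<^sub>m A) = (-1) \<cdot>\<^sub>m 1\<^sub>m d"
  shows "quarter_turn (e \<cdot>\<^sub>m A) \<in> K"
proof -
  obtain c where c: "(c \<cdot>\<^sub>m A) * (c \<cdot>\<^sub>m A) = (-1) \<cdot>\<^sub>m 1\<^sub>m d" "quarter_turn (c \<cdot>\<^sub>m A) \<in> K"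
    using assms(2) by (auto simp: turning_def)
  obtain s where s: "is_sign s" "A * A = s \<cdot>\<^sub>m 1\<^sub>m d" using pauli_square assms(1) by blast
  have A: "A \<in> Mat" using assms(1) by auto
  have "t * t * s = -1" if "(t \<cdot>\<^sub>m A) * (t \<cdot>\<^sub>m A) = (-1) \<cdot>\<^sub>m 1\<^sub>m d" for t
  proof -
    have "(t * t * s) \<cdot>\<^sub>m (1\<^sub>m d :: complex mat) = (-1) \<cdot>\<^sub>m 1\<^sub>m d" using that A s by (simp add: mat_norm mult.assoc)
    then show ?thesis by (rule scalar_inject)
  qed
  then have "c * c * s = e * e * s" using c assms(3) by metis
  then have "c * c = e * e" using s by (auto simp: is_sign_def)
  then have "e = c \<or> e = - c" by (metis power2_eq_iff power2_eq_square)
  then show ?thesis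
  proof
    assume "e = - c"
    then have "e \<cdot>\<^sub>m A = (-1) \<cdot>\<^sub>m (c \<cdot>\<^sub>m A)" by (simp add: smult_smult_mat)
    then show ?thesis using quarter_turn_uminus_in_K[OF _ c] A by simp
  qed (use c in simp)
qed

lemma turning_smult: "c \<noteq> 0 \<Longrightarrow> turning (c \<cdot>\<^sub>m A) \<longleftrightarrow> turning A"
proof -
  have "turning (c \<cdot>\<^sub>m A)" if nz: "c \<noteq> 0" and A: "turning A" for c A
  proof -
    obtain e where e: "(e \<cdot>\<^sub>m A) * (e \<cdot>\<^sub>m A) = (-1) \<cdot>\<^sub>m 1\<^sub>m d" "quarter_turn (e \<cdot>\<^sub>m A) \<in> K"
      using A by (auto simp: turning_def)
    have "(e / c) \<cdot>\<^sub>m (c \<cdot>\<^sub>m A) = e \<cdot>\<^sub>m A" using nz by (simp add: smult_smult_mat)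
    then show ?thesis unfolding turning_def using e by metis
  qed
  from this[of c A] this[of "1 / c" "c \<cdot>\<^sub>m A"] show "c \<noteq> 0 \<Longrightarrow> turning (c \<cdot>\<^sub>m A) \<longleftrightarrow> turning A"
    by (auto simp: smult_smult_mat)
qed

text \<open>
  A quarter turn in the direction \<open>A\<close> conjugates the one in the direction \<open>B\<close> to the one in the
  direction \<open>A B\<close>.
\<close>

lemma turning_mult:
  assumes "A \<in> pauli S" "B \<in> pauli T" "turning A" "turning B" "twist (-1) A B"
  shows "turning (A * B)"
proof -
  obtain a b where a: "(a \<cdot>\<^sub>m A) * (a \<cdot>\<^sub>m A) = (-1) \<cdot>\<^sub>m 1\<^sub>m d" "quarter_turn (a \<cdot>\<^sub>m A) \<in> K"
    and b: "(b \<cdot>\<^sub>m B) * (b \<cdot>\<^sub>m B) = (-1) \<cdot>\<^sub>m 1\<^sub>m d" "quarter_turn (b \<cdot>\<^sub>m B) \<in> K"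
    using assms(3,4) by (auto simp: turning_def)
  define J L where "J = a \<cdot>\<^sub>m A" and "L = b \<cdot>\<^sub>m B"
  have m: "A \<in> Mat" "B \<in> Mat" "J \<in> Mat" "L \<in> Mat" using assms by (auto simp: J_def L_def)
  have tw: "twist (-1) J L" unfolding J_def L_def
    using m assms(5) by (intro twist_smult_left twist_smult_right) auto
  have JL: "J * L = (a * b) \<cdot>\<^sub>m (A * B)" using m unfolding J_def L_def by (simp add: mat_norm mult.commute)
  have "quarter_turn J * quarter_turn L * quarter_turn ((-1) \<cdot>\<^sub>m J)
      = quarter_turn (J * L) * (quarter_turn J * quarter_turn ((-1) \<cdot>\<^sub>m J))"
    using quarter_turn_conjugate[OF m(3,4) _ tw] a m unfolding J_def[symmetric] by (simp add: mat_norm)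
  also have "\<dots> = quarter_turn (J * L)"
    using quarter_turn_inverse(1)[OF m(3)] a m unfolding J_def[symmetric] by (simp add: mat_norm)
  finally have "quarter_turn (J * L) \<in> K"
    using a b quarter_turn_uminus_in_K[OF m(3)] K_mult unfolding J_def[symmetric] L_def[symmetric] by metis
  moreover have "(J * L) * (J * L) = (-1) \<cdot>\<^sub>m 1\<^sub>m d"
    using square_mult[OF m(3,4) tw, of "-1" "-1"] a b by (simp add: J_def L_def)
  ultimately show ?thesis unfolding turning_def JL by blast
qed

text \<open>
  Enlarging a block: one product \<open>A\<^sub>0 C\<close> suffices, because any two nontrivial elements of the block
  are linked by a chain of anticommuting ones inside the block.
\<close>

lemma turning_extend:
  assumes block: "\<And>A. A \<in> pauli S \<Longrightarrow> active S A \<Longrightarrow> turning A"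
    and C: "C \<in> pauli T" "\<And>A. A \<in> pauli S \<Longrightarrow> twist 1 A C"
    and A0: "A0 \<in> pauli S" "active S A0" "turning (A0 * C)"
    and A: "A \<in> pauli S" "active S A"
  shows "turning (A * C)"
proof -
  have link: "turning (D * C)"
    if D: "D \<in> pauli S" and E: "E \<in> pauli S" "turning (E * C)" and DE: "twist (-1) D E" for D E
  proof -
    have m: "C \<in> Mat" "D \<in> Mat" "E \<in> Mat" using C D E by auto
    have DE_E: "twist (-1) (D * E) E"
      using twist_mult_left[OF m(2,3,3) DE twist_self] by simp
    have "turning (D * E)" using block[of "D * E"] D E DE_E by (auto simp: active_def)
    moreover have "twist (-1) (D * E) (E * C)"
      using twist_mult_right[OF _ m(3,1) DE_E C(2)[of "D * E"]] D E m by auto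
    moreover have "E * C \<in> pauli UNIV" "D * E \<in> pauli UNIV"
      using D E C pauli_mono[OF subset_UNIV] by blast+
    ultimately have "turning ((D * E) * (E * C))" using turning_mult E(2) by blast
    moreover obtain s where s: "is_sign s" "E * E = s \<cdot>\<^sub>m 1\<^sub>m d" using pauli_square E(1) by blast
    have "(D * E) * (E * C) = D * ((E * E) * C)" using m by (simp add: mat_norm)
    then have "(D * E) * (E * C) = s \<cdot>\<^sub>m (D * C)" unfolding s(2) using m by (simp add: mat_norm)
    moreover have "s \<noteq> 0" using s by (auto simp: is_sign_def)
    ultimately show ?thesis using turning_smult by simp
  qed
  obtain B where B: "B \<in> pauli S" "twist (-1) A B" "twist (-1) A0 B"
    using common_anticommuting A A0 by metis
  then have "turning (B * C)" using link[OF B(1) A0(1,3)] twist_sym[of "-1"] by simp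
  then show ?thesis using link[OF A(1) B(1) _ B(2)] by simp
qed

lemma turning_single:
  assumes i: "i \<in> {1..n}" "turning (x i)" "turning (z i)" and A: "A \<in> pauli {i}" "active T A"
  shows "turning A"
proof -
  obtain c B where B: "c \<noteq> 0" "A = c \<cdot>\<^sub>m B" "B \<in> {1\<^sub>m d, x i, z i, z i * x i}"
    using pauli_single A i by blast
  have "B \<noteq> 1\<^sub>m d" using scalar_not_active A B by blast
  moreover have "turning (z i * x i)"
    using turning_mult[of "z i" "{i}" "x i" "{i}"] pauli_x pauli_z twist_zx[of i i] i by auto
  ultimately show ?thesis using B i turning_smult by auto
qed

text \<open>
  Induction on the number of qubits. For the new qubit \<open>k\<close>, the products of \<open>z\<^sub>m\<close> on the last old
  qubit with the three Pauli matrices on \<open>k\<close> come from \<open>z\<^sub>m z\<^sub>k\<close>, \<open>x\<^sub>k\<close> and \<open>z\<^sub>k\<close>; then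
  \<open>turning_extend\<close> replaces \<open>z\<^sub>m\<close> by an arbitrary active element of the old block.
\<close>

lemma turning_block:
  assumes single: "\<And>i. i \<in> {2..n} \<Longrightarrow> turning (x i)" "\<And>i. i \<in> {2..n} \<Longrightarrow> turning (z i)"
    and pair: "\<And>i. i \<in> {2..<n} \<Longrightarrow> turning (z i * z (i + 1))"
    and m: "2 \<le> m" "m \<le> n"
  shows "A \<in> pauli {2..m} \<Longrightarrow> active {2..m} A \<Longrightarrow> turning A"
  using m
proof (induction m arbitrary: A rule: dec_induct)
  case base
  then show ?case using turning_single[of 2 A] single by auto
next
  case (step m)
  define k where "k = Suc m"
  have k: "k \<in> {2..n}" "k \<in> {1..n}" "k \<noteq> m" and m: "m \<in> {2..n}" "m \<in> {1..n}" "m \<in> {2..m}"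
    using step by (auto simp: k_def)
  have "{2..Suc m} = {2..m} \<union> {k}" "{2..m} \<inter> {k} = {}" using step(1) by (auto simp: k_def)
  then obtain B C where BC: "B \<in> pauli {2..m}" "C \<in> pauli {k}" "A = B * C"
    using pauli_split step.prems by metis
  have BCm: "B \<in> Mat" "C \<in> Mat" using BC by auto
  obtain c D where D: "c \<noteq> 0" "C = c \<cdot>\<^sub>m D" "D \<in> {1\<^sub>m d, x k, z k, z k * x k}"
    using pauli_single[OF BC(2) k(2)] by blast
  have Dm: "D \<in> Mat" using D k by auto
  have A: "A = c \<cdot>\<^sub>m (B * D)" using BC D BCm Dm by (simp add: mat_norm)
  have IH: "turning E" if "E \<in> pauli {2..m}" "active {2..m} E" for E
    using step.IH[OF that] step.prems by simp
  consider "active {2..m} B" | b where "B = b \<cdot>\<^sub>m 1\<^sub>m d" using pauli_active_or_scalar BC by blast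
  then show ?case
  proof cases
    case 1
    show ?thesis
    proof (cases "D = 1\<^sub>m d")
      case True then show ?thesis using A IH[OF BC(1) 1] turning_smult D(1) BCm by (simp add: mat_norm)
    next
      case False
      have zz: "turning (z m * z k)" using pair[of m] step by (simp add: k_def)
      have pz: "z m \<in> pauli {2..m}" "x m \<in> pauli {2..m}" using pauli_z pauli_x m by auto
      have pk: "z k \<in> pauli {k}" "x k \<in> pauli {k}" using pauli_z pauli_x k by auto
      have mm: "z m \<in> Mat" "z k \<in> Mat" "x k \<in> Mat" using m k by auto
      have zzp: "z m * z k \<in> pauli UNIV" using pz pk pauli_mono[OF subset_UNIV] by blast
      have zzx: "turning (z m * (z k * x k))"
      proof -
        have "twist (-1) (z m * z k) (x k)"
          using twist_mult_left[OF mm twist_zx[of m k] twist_zx[of k k]] m k by simp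
        then have "turning ((z m * z k) * x k)" using turning_mult zzp pk zz single(1)[OF k(1)] by blast
        then show ?thesis using mm by (simp add: mat_norm)
      qed
      have zx: "turning (z m * x k)"
      proof -
        have "twist (-1) (z m * (z k * x k)) (z k)"
        proof -
          have "twist (-1) (z k * x k) (z k)"
            using twist_mult_left[OF mm(2,3,2) twist_self] twist_xz[of k k] k by fastforce
          then show ?thesis
            using twist_mult_left[OF mm(1) _ mm(2) twist_zz[of m k]] m k mm by fastforce
        qed
        moreover have "z m * (z k * x k) \<in> pauli UNIV" using pz pk pauli_mono[OF subset_UNIV] by blast
        ultimately have "turning ((z m * (z k * x k)) * z k)"
          using turning_mult zzx pk single(2)[OF k(1)] by blast
        moreover have "(z m * (z k * x k)) * z k = (-1) \<cdot>\<^sub>m (z m * x k)"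
        proof -
          have "x k * z k = (-1) \<cdot>\<^sub>m (z k * x k)" using twist_xz[of k k] k by (simp add: twist_def)
          moreover have "z k * (z k * x k) = x k" using z_square[OF k(2)] mm
            by (simp flip: mat_assoc add: mat_one_left)
          ultimately show ?thesis using mm by (simp add: mat_norm)
        qed
        ultimately show ?thesis using turning_smult by simp
      qed
      have Dk: "D \<in> pauli {k}" using D(3) False pk by auto
      have zD: "turning (z m * D)" using D(3) False zz zx zzx by auto
      have act: "active {2..m} (z m)"
        unfolding active_def using pz twist_zx[of m m] m by auto
      have "turning (B * D)"
        using turning_extend[OF IH Dk _ pz(1) act zD BC(1) 1]
          pauli_disjoint_commute[OF _ Dk, of _ "{2..m}"] by (simp add: k_def)
      then show ?thesis using A D(1) turning_smult by simp
    qed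
  next
    case (2 b)
    then have AC: "A = b \<cdot>\<^sub>m C" using BC BCm by (simp add: mat_norm)
    have "b \<noteq> 0"
    proof
      assume "b = 0"
      moreover obtain s where "is_sign s" "B * B = s \<cdot>\<^sub>m 1\<^sub>m d" using pauli_square BC(1) by blast
      ultimately have "s \<cdot>\<^sub>m 1\<^sub>m d = (0 :: complex) \<cdot>\<^sub>m 1\<^sub>m d" using 2 by (simp add: mat_norm)
      then have "s = 0" by (rule scalar_inject)
      then show False using \<open>is_sign s\<close> by (auto simp: is_sign_def)
    qed
    obtain E where E: "E \<in> pauli {2..Suc m}" "twist (-1) A E" using step.prems by (auto simp: active_def)
    have "twist (-1) C E"
      using twist_smult_left[of A E "-1" "1 / b"] E AC BCm \<open>b \<noteq> 0\<close> by (auto simp: smult_smult_mat)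
    then have "active {2..Suc m} C" using E by (auto simp: active_def)
    then have "turning C" using turning_single[OF k(2)] single k(1) BC(2) by blast
    then show ?thesis using AC \<open>b \<noteq> 0\<close> turning_smult by simp
  qed
qed

end

context pauli_system
begin

section \<open>Matrices normalizing the Pauli matrices\<close>

text \<open>
  Both directions are demanded so that inverses are normalizing by definition, without
  appeal to finiteness of the Pauli group.
\<close>

definition normalizing :: "complex mat \<Rightarrow> bool" where
  "normalizing U \<longleftrightarrow> U \<in> Mat \<and> (\<exists>V \<in> Mat. U * V = 1\<^sub>m d \<and> V * U = 1\<^sub>m d) \<and>
     (\<forall>P \<in> pauli {1..n}. (\<exists>Q \<in> pauli {1..n}. U * P = Q * U) \<and> (\<exists>Q \<in> pauli {1..n}. P * U = U * Q))"

lemma normalizing_closed [simp, intro]: "normalizing U \<Longrightarrow> U \<in> Mat"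
  by (simp add: normalizing_def)

lemma normalizingI:
  assumes "U \<in> Mat" "V \<in> Mat" "U * V = 1\<^sub>m d" "V * U = 1\<^sub>m d"
    and "\<And>P. P \<in> pauli {1..n} \<Longrightarrow> \<exists>Q \<in> pauli {1..n}. U * P = Q * U"
    and "\<And>P. P \<in> pauli {1..n} \<Longrightarrow> \<exists>Q \<in> pauli {1..n}. P * U = U * Q"
  shows "normalizing U"
  unfolding normalizing_def using assms by blast

lemma normalizing_invertible:
  assumes "normalizing U"
  obtains V where "V \<in> Mat" "U * V = 1\<^sub>m d" "V * U = 1\<^sub>m d"
  using assms unfolding normalizing_def by blast

lemma normalizing_image:
  assumes "normalizing U" "P \<in> pauli {1..n}"
  obtains Q where "Q \<in> pauli {1..n}" "U * P = Q * U"
  using assms unfolding normalizing_def by blast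

lemma normalizing_preimage:
  assumes "normalizing U" "P \<in> pauli {1..n}"
  obtains Q where "Q \<in> pauli {1..n}" "P * U = U * Q"
  using assms unfolding normalizing_def by blast

lemma normalizing_mult:
  assumes "normalizing U" "normalizing V"
  shows "normalizing (U * V)"
proof -
  obtain U' where U': "U' \<in> Mat" "U * U' = 1\<^sub>m d" "U' * U = 1\<^sub>m d"
    using normalizing_invertible[OF assms(1)] .
  obtain V' where V': "V' \<in> Mat" "V * V' = 1\<^sub>m d" "V' * V = 1\<^sub>m d"
    using normalizing_invertible[OF assms(2)] .
  note inv = U' V'
  have m: "U \<in> Mat" "V \<in> Mat" using assms by auto
  have "(U * V) * (V' * U') = U * ((V * V') * U')" "(V' * U') * (U * V) = V' * ((U' * U) * V)"
    using m inv(1,4) by (simp_all add: mat_assoc)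
  then have "(U * V) * (V' * U') = 1\<^sub>m d" "(V' * U') * (U * V) = 1\<^sub>m d"
    using inv m by (simp_all add: mat_norm)
  moreover have "\<exists>Q \<in> pauli {1..n}. (U * V) * P = Q * (U * V)" if P: "P \<in> pauli {1..n}" for P
  proof -
    obtain Q where Q: "Q \<in> pauli {1..n}" "V * P = Q * V"
      using normalizing_image[of V P] P assms by blast
    obtain R where R: "R \<in> pauli {1..n}" "U * Q = R * U"
      using normalizing_image[of U Q] Q assms by blast
    have "(U * V) * P = (U * Q) * V" using Q P m by (simp add: mat_norm)
    then show ?thesis using R m P by (intro bexI[of _ R]) (auto simp: mat_norm)
  qed
  moreover have "\<exists>Q \<in> pauli {1..n}. P * (U * V) = (U * V) * Q" if P: "P \<in> pauli {1..n}" for P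
  proof -
    obtain Q where Q: "Q \<in> pauli {1..n}" "P * U = U * Q"
      using normalizing_preimage[of U P] P assms by blast
    obtain R where R: "R \<in> pauli {1..n}" "Q * V = V * R"
      using normalizing_preimage[of V Q] Q assms by blast
    have "P * (U * V) = (P * U) * V" using P m by (simp add: mat_norm)
    also have "\<dots> = U * (Q * V)" using Q m by (simp add: mat_norm)
    also have "\<dots> = (U * V) * R" using R m by (simp add: mat_norm)
    finally show ?thesis using R by blast
  qed
  ultimately show ?thesis using m inv(1,4) by (intro normalizingI[of _ "V' * U'"]) auto
qed

lemma normalizing_inverse:
  assumes "normalizing U" "V \<in> Mat" "U * V = 1\<^sub>m d" "V * U = 1\<^sub>m d"
  shows "normalizing V"
proof -
  have U: "U \<in> Mat" using assms by auto
  have "\<exists>Q \<in> pauli {1..n}. V * P = Q * V" if P: "P \<in> pauli {1..n}" for P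
  proof -
    obtain Q where Q: "Q \<in> pauli {1..n}" "P * U = U * Q"
      using normalizing_preimage[of U P] P assms by blast
    have "V * P = V * (P * U) * V" using assms U P by (simp add: mat_norm)
    also have "\<dots> = (V * U) * (Q * V)" unfolding Q using assms(2) U Q by (simp add: mat_norm)
    also have "\<dots> = Q * V" using assms Q by (simp add: mat_norm)
    finally show ?thesis using Q by blast
  qed
  moreover have "\<exists>Q \<in> pauli {1..n}. P * V = V * Q" if P: "P \<in> pauli {1..n}" for P
  proof -
    obtain Q where Q: "Q \<in> pauli {1..n}" "U * P = Q * U"
      using normalizing_image[of U P] P assms by blast
    have "P * V = (V * U) * (P * V)" using assms P by (simp add: mat_norm)
    also have "\<dots> = V * (U * P) * V" using assms(2) U P by (simp add: mat_norm)
    also have "\<dots> = V * Q * (U * V)" unfolding Q using assms(2) U Q by (simp add: mat_norm)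
    also have "\<dots> = V * Q" using assms Q by (simp add: mat_norm)
    finally show ?thesis using Q by blast
  qed
  ultimately show ?thesis using assms U by (intro normalizingI[of V U]) auto
qed

lemma normalizing_smult:
  assumes "normalizing U" "c \<noteq> 0"
  shows "normalizing (c \<cdot>\<^sub>m U)"
proof -
  obtain V where V: "V \<in> Mat" "U * V = 1\<^sub>m d" "V * U = 1\<^sub>m d"
    using normalizing_invertible[OF assms(1)] .
  have U: "U \<in> Mat" using assms by auto
  have "(c \<cdot>\<^sub>m U) * ((1 / c) \<cdot>\<^sub>m V) = 1\<^sub>m d" "((1 / c) \<cdot>\<^sub>m V) * (c \<cdot>\<^sub>m U) = 1\<^sub>m d"
    using U V assms(2) by (simp_all add: mat_norm)
  moreover have "\<exists>Q \<in> pauli {1..n}. (c \<cdot>\<^sub>m U) * P = Q * (c \<cdot>\<^sub>m U)" if P: "P \<in> pauli {1..n}" for P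
  proof -
    obtain Q where Q: "Q \<in> pauli {1..n}" "U * P = Q * U"
      using normalizing_image[of U P] assms(1) P by blast
    then show ?thesis using U P by (intro bexI[of _ Q]) (auto simp: mat_norm)
  qed
  moreover have "\<exists>Q \<in> pauli {1..n}. P * (c \<cdot>\<^sub>m U) = (c \<cdot>\<^sub>m U) * Q" if P: "P \<in> pauli {1..n}" for P
  proof -
    obtain Q where Q: "Q \<in> pauli {1..n}" "P * U = U * Q"
      using normalizing_preimage[of U P] assms(1) P by blast
    then show ?thesis using U P by (intro bexI[of _ Q]) (auto simp: mat_norm)
  qed
  ultimately show ?thesis using U V by (intro normalizingI[of _ "(1 / c) \<cdot>\<^sub>m V"]) auto
qed

lemma normalizing_pauli:
  assumes "P \<in> pauli {1..n}"
  shows "normalizing P"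
proof -
  obtain s where s: "is_sign s" "P * P = s \<cdot>\<^sub>m 1\<^sub>m d" using pauli_square assms by blast
  have P: "P \<in> Mat" using assms by auto
  have "P * (s \<cdot>\<^sub>m P) = 1\<^sub>m d" "(s \<cdot>\<^sub>m P) * P = 1\<^sub>m d" using P s by (simp_all add: mat_norm)
  moreover have "\<exists>R \<in> pauli {1..n}. P * Q = R * P" "\<exists>R \<in> pauli {1..n}. Q * P = P * R"
    if Q: "Q \<in> pauli {1..n}" for Q
  proof -
    obtain t where t: "is_sign t" "twist t P Q" using pauli_twist assms Q by blast
    have PQ: "P * Q = (t \<cdot>\<^sub>m Q) * P" using t P Q by (simp add: twist_def mat_smult_left)
    have QP: "Q * P = P * (t \<cdot>\<^sub>m Q)" using twist_sym[OF t] P Q by (simp add: twist_def mat_smult_right)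
    show "\<exists>R \<in> pauli {1..n}. P * Q = R * P" using PQ pauli_sign[OF t(1) Q] by blast
    show "\<exists>R \<in> pauli {1..n}. Q * P = P * R" using QP pauli_sign[OF t(1) Q] by blast
  qed
  ultimately show ?thesis using P by (intro normalizingI[of P "s \<cdot>\<^sub>m P"]) auto
qed

lemma normalizing_quarter_turn:
  assumes "J \<in> pauli {1..n}" "J * J = (-1) \<cdot>\<^sub>m 1\<^sub>m d"
  shows "normalizing (quarter_turn J)"
proof -
  have J: "J \<in> Mat" using assms by auto
  have "\<exists>Q \<in> pauli {1..n}. quarter_turn J * P = Q * quarter_turn J"
       "\<exists>Q \<in> pauli {1..n}. P * quarter_turn J = quarter_turn J * Q" if P: "P \<in> pauli {1..n}" for P
  proof -
    have Pm: "P \<in> Mat" using P by auto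
    obtain s where s: "is_sign s" "twist s J P" using pauli_twist assms P by blast
    show "\<exists>Q \<in> pauli {1..n}. quarter_turn J * P = Q * quarter_turn J"
    proof (cases "s = 1")
      case True then show ?thesis
        using quarter_turn_commute[OF J Pm] s P by (auto simp: twist_def)
    next
      case False
      then have "s = -1" using s by (simp add: is_sign_def)
      then show ?thesis
        using quarter_turn_anticommute[OF J Pm assms(2)] s P assms(1) by blast
    qed
    show "\<exists>Q \<in> pauli {1..n}. P * quarter_turn J = quarter_turn J * Q"
    proof (cases "s = 1")
      case True then show ?thesis
        using quarter_turn_commute[OF J Pm] s P by (intro bexI[of _ P]) (auto simp: twist_def)
    next
      case False
      then have "twist (-1) J P" using s by (auto simp: is_sign_def)
      then have "J * P = (-1) \<cdot>\<^sub>m (P * J)" by (simp add: twist_def)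
      then have "J * (P * J) = (-1) \<cdot>\<^sub>m (P * (J * J))"
        using J Pm mat_assoc[of J P J] by (simp add: mat_norm)
      then have JPJ: "J * (P * J) = P" using assms(2) J Pm by (simp add: mat_norm)
      have "P * quarter_turn J = quarter_turn J * (P * J)"
        using J Pm JPJ by (simp add: quarter_turn_alt mat_expand) (intro eq_matI, auto)
      then show ?thesis using P assms(1) by blast
    qed
  qed
  then show ?thesis
    using J quarter_turn_inverse[OF J assms(2)]
    by (intro normalizingI[of _ "quarter_turn ((-1) \<cdot>\<^sub>m J)"]) auto
qed

text \<open>
  The matrix \<open>U\<close> conjugates \<open>A\<close> to \<open>B\<close> up to sign. No inverse of \<open>U\<close> has to be named.
\<close>

definition sends :: "complex mat \<Rightarrow> complex mat \<Rightarrow> complex mat \<Rightarrow> bool" where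
  "sends U A B \<longleftrightarrow> (\<exists>e. is_sign e \<and> U * A = e \<cdot>\<^sub>m (B * U))"

lemma sends_self: "sends U A A \<longleftrightarrow> (\<exists>e. is_sign e \<and> twist e U A)"
  by (simp add: sends_def twist_def)

lemma sends_compose:
  assumes "U \<in> Mat" "V \<in> Mat" "A \<in> Mat" "B \<in> Mat" "C \<in> Mat" "sends U A B" "sends V B C"
  shows "sends (V * U) A C"
proof -
  obtain e f where e: "is_sign e" "U * A = e \<cdot>\<^sub>m (B * U)" and f: "is_sign f" "V * B = f \<cdot>\<^sub>m (C * V)"
    using assms by (auto simp: sends_def)
  have "(V * U) * A = e \<cdot>\<^sub>m ((V * B) * U)" using assms(1-5) e by (simp add: mat_norm)
  also have "\<dots> = (e * f) \<cdot>\<^sub>m (C * (V * U))" unfolding f using assms(1-5) by (simp add: mat_norm)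
  finally show ?thesis using e f is_sign_mult sends_def by blast
qed

lemma sends_mult:
  assumes "U \<in> Mat" "A \<in> Mat" "B \<in> Mat" "A' \<in> Mat" "B' \<in> Mat" "sends U A A'" "sends U B B'"
  shows "sends U (A * B) (A' * B')"
proof -
  obtain e f where e: "is_sign e" "U * A = e \<cdot>\<^sub>m (A' * U)" and f: "is_sign f" "U * B = f \<cdot>\<^sub>m (B' * U)"
    using assms by (auto simp: sends_def)
  have "U * (A * B) = (U * A) * B" using assms(1-5) by (simp add: mat_norm)
  also have "\<dots> = e \<cdot>\<^sub>m (A' * (U * B))" unfolding e using assms(1-5) by (simp add: mat_norm)
  also have "\<dots> = (e * f) \<cdot>\<^sub>m ((A' * B') * U)" unfolding f using assms(1-5) by (simp add: mat_norm)
  finally show ?thesis using e f is_sign_mult sends_def by blast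
qed

lemma sends_twist:
  assumes U: "U \<in> Mat" "V \<in> Mat" "U * V = 1\<^sub>m d"
    and m: "A \<in> Mat" "B \<in> Mat" "A' \<in> Mat" "B' \<in> Mat"
    and s: "sends U A A'" "sends U B B'" and t: "twist t A B"
  shows "twist t A' B'"
proof -
  obtain e f where e: "is_sign e" "U * A = e \<cdot>\<^sub>m (A' * U)" and f: "is_sign f" "U * B = f \<cdot>\<^sub>m (B' * U)"
    using s by (auto simp: sends_def)
  have "U * (A * B) = (U * A) * B" using U m by (simp add: mat_norm)
  also have "\<dots> = e \<cdot>\<^sub>m (A' * (U * B))" unfolding e using U m by (simp add: mat_norm)
  also have "\<dots> = (e * f) \<cdot>\<^sub>m ((A' * B') * U)" unfolding f using U m by (simp add: mat_norm)
  finally have 1: "U * (A * B) = (e * f) \<cdot>\<^sub>m ((A' * B') * U)" .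
  have "U * (B * A) = (U * B) * A" using U m by (simp add: mat_norm)
  also have "\<dots> = f \<cdot>\<^sub>m (B' * (U * A))" unfolding f using U m by (simp add: mat_norm)
  also have "\<dots> = (f * e) \<cdot>\<^sub>m ((B' * A') * U)" unfolding e using U m by (simp add: mat_norm)
  finally have 2: "U * (B * A) = (f * e) \<cdot>\<^sub>m ((B' * A') * U)" .
  have ef: "(e * f) * (e * f) = 1" using e f is_sign_mult is_sign_simps(3) by blast
  have "U * (A * B) = t \<cdot>\<^sub>m (U * (B * A))" using t U m by (simp add: twist_def mat_norm)
  then have "(e * f) \<cdot>\<^sub>m ((A' * B') * U) = (t * (f * e)) \<cdot>\<^sub>m ((B' * A') * U)"
    unfolding 1 2 by (simp add: smult_smult_mat)
  then have "(e * f) \<cdot>\<^sub>m ((e * f) \<cdot>\<^sub>m ((A' * B') * U)) = (e * f) \<cdot>\<^sub>m ((t * (f * e)) \<cdot>\<^sub>m ((B' * A') * U))" by simp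
  moreover have "(e * f) * (t * (f * e)) = t" using ef by (simp add: mult_ac)
  ultimately have "(A' * B') * U = t \<cdot>\<^sub>m ((B' * A') * U)" using ef by (simp add: smult_smult_mat)
  then have "(A' * B') * U = (t \<cdot>\<^sub>m (B' * A')) * U" using m U by (simp add: mat_norm)
  then show ?thesis unfolding twist_def using mat_cancel_right[OF _ _ U] m by auto
qed

text \<open>
  The transvection in the direction \<open>A B\<close> exchanges the anticommuting \<open>A\<close> and \<open>B\<close> up
  to sign.
\<close>

lemma quarter_turn_sends:
  assumes m: "A \<in> Mat" "B \<in> Mat" and AA: "A * A = 1\<^sub>m d" and BB: "B * B = 1\<^sub>m d" and t: "twist (-1) A B"
  shows "(A * B) * (A * B) = (-1) \<cdot>\<^sub>m 1\<^sub>m d" "sends (quarter_turn (A * B)) A B"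
proof -
  show sq: "(A * B) * (A * B) = (-1) \<cdot>\<^sub>m 1\<^sub>m d"
    using square_mult[OF m t, of 1 1] AA BB by simp
  have "twist (-1) (A * B) A"
    using twist_mult_left[OF m(1,2,1) twist_self, of "-1"] twist_sym[OF _ t] by simp
  then have "quarter_turn (A * B) * A = A * B * A * quarter_turn (A * B)"
    using quarter_turn_anticommute[OF _ m(1) sq] m by auto
  moreover have "A * B * A = (-1) \<cdot>\<^sub>m B"
    using t m AA by (simp add: twist_def mat_norm)
  ultimately show "sends (quarter_turn (A * B)) A B"
    unfolding sends_def using m by (intro exI[of _ "-1"]) (auto simp: mat_norm)
qed

text \<open>
  A Pauli matrix \<open>Q\<close> that commutes with the qubits below \<open>j\<close> lies, up to a scalar, in the block of
  the qubits from \<open>j\<close> on.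
\<close>

lemma active_upper_block:
  assumes Q: "Q \<in> pauli {1..n}" "active {1..n} Q" and j: "j \<in> {1..n}"
    and comm: "\<And>P. P \<in> pauli {1..<j} \<Longrightarrow> twist 1 Q P"
  shows "active {j..n} Q"
proof -
  have "{1..n} = {1..<j} \<union> {j..n}" "{1..<j} \<inter> {j..n} = {}" using j by auto
  then obtain B C where BC: "B \<in> pauli {1..<j}" "C \<in> pauli {j..n}" "Q = B * C"
    using pauli_split Q(1) by metis
  have m: "B \<in> Mat" "C \<in> Mat" using BC by auto
  have "\<not> active {1..<j} B"
  proof
    assume "active {1..<j} B"
    then obtain P where P: "P \<in> pauli {1..<j}" "twist (-1) B P" by (auto simp: active_def)
    have "twist 1 C P" by (rule pauli_disjoint_commute[OF BC(2) P(1)]) auto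
    then have "twist (-1) Q P" using twist_mult_left[OF m _ P(2)] BC P(1) by auto
    then show False using twist_sign_unique[OF Q(1) P(1)] comm[OF P(1)] by blast
  qed
  then obtain b where b: "B = b \<cdot>\<^sub>m 1\<^sub>m d" using pauli_active_or_scalar[OF BC(1)] by blast
  have Qb: "Q = b \<cdot>\<^sub>m C" using BC b m by (simp add: mat_norm)
  from pauli_active_or_scalar[OF BC(2)] show ?thesis
  proof
    assume "active {j..n} C"
    then obtain P where P: "P \<in> pauli {j..n}" "twist (-1) C P" by (auto simp: active_def)
    then have "twist (-1) Q P" unfolding Qb using twist_smult_left m by auto
    then show ?thesis using P by (auto simp: active_def)
  next
    assume "\<exists>c. C = c \<cdot>\<^sub>m 1\<^sub>m d"
    then obtain c where "Q = (b * c) \<cdot>\<^sub>m 1\<^sub>m d" using Qb by (auto simp: smult_smult_mat)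
    then show ?thesis using scalar_not_active Q by metis
  qed
qed

lemma pauli_normalized_square:
  assumes "P \<in> pauli S"
  obtains c where "c \<cdot>\<^sub>m P \<in> pauli S" "(c \<cdot>\<^sub>m P) * (c \<cdot>\<^sub>m P) = 1\<^sub>m d"
proof -
  obtain s where s: "is_sign s" "P * P = s \<cdot>\<^sub>m 1\<^sub>m d" using pauli_square assms by blast
  show ?thesis
  proof (cases "s = 1")
    case True then show ?thesis using that[of 1] assms s by simp
  next
    case False
    then have "s = -1" using s by (simp add: is_sign_def)
    then show ?thesis using that[of \<zeta>] pauli.phase[OF assms] s(2) pauli_closed[OF assms] zeta_square
      by (simp add: mat_norm flip: mult.assoc)
  qed
qed

text \<open>
  A matrix which fixes every \<open>x\<^sub>i\<close> and \<open>z\<^sub>i\<close> up to sign is a Pauli matrix up to a scalar: a Pauli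
  matrix can be chosen to produce any prescribed signs.
\<close>

lemma correct_signs:
  assumes U: "U \<in> Mat" and up_to_sign: "\<And>i. i \<in> {1..n} \<Longrightarrow> sends U (x i) (x i)"
    "\<And>i. i \<in> {1..n} \<Longrightarrow> sends U (z i) (z i)"
  shows "m \<le> n \<Longrightarrow> \<exists>D \<in> pauli {1..m}. \<forall>i \<in> {1..m}. twist 1 (D * U) (x i) \<and> twist 1 (D * U) (z i)"
proof (induction m)
  case 0
  then show ?case using pauli.one by auto
next
  case (Suc m)
  then obtain D where D: "D \<in> pauli {1..m}"
    "\<And>i. i \<in> {1..m} \<Longrightarrow> twist 1 (D * U) (x i) \<and> twist 1 (D * U) (z i)" by auto
  define j where "j = Suc m"
  have j: "j \<in> {1..n}" using Suc by (auto simp: j_def)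
  have Dm: "D \<in> Mat" "D * U \<in> Mat" "x j \<in> Mat" "z j \<in> Mat" using D U j by auto
  obtain e f where e: "is_sign e" "twist e U (x j)" and f: "is_sign f" "twist f U (z j)"
    using up_to_sign[OF j] by (auto simp: sends_self)
  have Dj: "twist 1 D (x j)" "twist 1 D (z j)"
    using pauli_disjoint_commute[OF D(1) pauli_x[of j "{j}"]] pauli_disjoint_commute[OF D(1) pauli_z[of j "{j}"]] j
    by (auto simp: j_def)
  have DU: "twist e (D * U) (x j)" "twist f (D * U) (z j)"
    using twist_mult_left[OF Dm(1) U _ Dj(1) e(2)] twist_mult_left[OF Dm(1) U _ Dj(2) f(2)] Dm by auto
  define E where "E = (if e = 1 then 1\<^sub>m d else z j) * (if f = 1 then 1\<^sub>m d else x j)"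
  have E: "E \<in> pauli {j}" unfolding E_def using pauli_x pauli_z j pauli.one by auto
  then have Em: "E \<in> Mat" by auto
  have "twist e (if e = 1 then 1\<^sub>m d else z j) (x j)" "twist f (if f = 1 then 1\<^sub>m d else x j) (z j)"
       "twist 1 (if e = 1 then 1\<^sub>m d else z j) (z j)" "twist 1 (if f = 1 then 1\<^sub>m d else x j) (x j)"
    using e f j twist_zx[of j j] twist_xz[of j j] by (auto simp: is_sign_def twist_self)
  then have Ej: "twist e E (x j)" "twist f E (z j)"
    unfolding E_def
    using twist_mult_left[of "if e = 1 then 1\<^sub>m d else z j" "if f = 1 then 1\<^sub>m d else x j" "x j" e 1]
      twist_mult_left[of "if e = 1 then 1\<^sub>m d else z j" "if f = 1 then 1\<^sub>m d else x j" "z j" 1 f] Dm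
    by (auto split: if_splits)
  have "twist 1 (E * D * U) (x i) \<and> twist 1 (E * D * U) (z i)" if "i \<in> {1..Suc m}" for i
  proof -
    have EDU: "E * D * U = E * (D * U)" using Dm U Em by (simp add: mat_norm)
    show ?thesis
    proof (cases "i = j")
      case True
      then show ?thesis unfolding EDU
        using twist_mult_left[OF Em Dm(2,3) Ej(1) DU(1)] twist_mult_left[OF Em Dm(2,4) Ej(2) DU(2)] e f by simp
    next
      case False
      then have i: "i \<in> {1..m}" "i \<in> {1..n}" using that Suc.prems by (auto simp: j_def)
      have "twist 1 E (x i)" "twist 1 E (z i)"
        using pauli_disjoint_commute[OF E pauli_x[of i "{i}"]] pauli_disjoint_commute[OF E pauli_z[of i "{i}"]] i False
        by auto
      then show ?thesis unfolding EDU
        using twist_mult_left[OF Em Dm(2), of "x i" 1 1] twist_mult_left[OF Em Dm(2), of "z i" 1 1] D(2)[OF i(1)] i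
        by auto
    qed
  qed
  moreover have "E * D \<in> pauli {1..Suc m}"
    using pauli_mono[OF _ E] pauli_mono[OF _ D(1)] by (auto simp: j_def)
  ultimately show ?case by blast
qed

end

context quarter_turn_monoid
begin

text \<open>
  Transitivity in one step: the image \<open>Q\<close> of \<open>A\<close> under \<open>U\<close> is moved back to \<open>A\<close> by one quarter turn
  in the direction \<open>Q A\<close> if these anticommute, and otherwise by two quarter turns through a matrix
  \<open>R\<close> that anticommutes with both.
\<close>

lemma move_back:
  assumes U: "normalizing U" and S: "S \<subseteq> pauli {1..n}" "\<And>s. s \<in> S \<Longrightarrow> sends U s s"
    and A: "A \<in> pauli {1..n}" "A * A = 1\<^sub>m d" "active {1..n} A"
    and K: "\<And>J. J \<in> pauli {1..n} \<Longrightarrow> J * J = (-1) \<cdot>\<^sub>m 1\<^sub>m d \<Longrightarrow> (\<And>s. s \<in> S \<Longrightarrow> twist 1 J s) \<Longrightarrow> quarter_turn J \<in> K"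
    and R: "\<And>Q. Q \<in> pauli {1..n} \<Longrightarrow> active {1..n} Q \<Longrightarrow> twist 1 Q A \<Longrightarrow>
      (\<And>s e. s \<in> S \<Longrightarrow> twist e A s \<Longrightarrow> twist e Q s) \<Longrightarrow>
      \<exists>R \<in> pauli {1..n}. R * R = 1\<^sub>m d \<and> twist (-1) Q R \<and> twist (-1) R A \<and>
        (\<forall>s \<in> S. twist 1 (Q * R) s \<and> twist 1 (R * A) s)"
  shows "\<exists>k \<in> K. normalizing (k * U) \<and> (\<forall>s \<in> insert A S. sends (k * U) s s)"
proof -
  have step: "\<exists>k \<in> K. normalizing (k * V) \<and> sends (k * V) A B \<and> (\<forall>s \<in> S. sends (k * V) s s)"
    if V: "normalizing V" "sends V A P" "\<And>s. s \<in> S \<Longrightarrow> sends V s s"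
      and P: "P \<in> pauli {1..n}" "P * P = 1\<^sub>m d" and B: "B \<in> pauli {1..n}" "B * B = 1\<^sub>m d"
      and t: "twist (-1) P B" "\<And>s. s \<in> S \<Longrightarrow> twist 1 (P * B) s" for V P B
  proof -
    have m: "P \<in> Mat" "B \<in> Mat" "A \<in> Mat" "V \<in> Mat" using P B A V by auto
    note qs = quarter_turn_sends[OF m(1,2) P(2) B(2) t(1)]
    have q: "quarter_turn (P * B) \<in> K" using K[OF _ qs(1)] P B t(2) by blast
    have "sends (quarter_turn (P * B) * V) s s" if "s \<in> S" for s
    proof -
      have s: "s \<in> Mat" using S that by auto
      have "sends (quarter_turn (P * B)) s s"
        using quarter_turn_commute[OF _ s t(2)[OF that]] m by (auto simp: sends_self intro: exI[of _ 1])
      then show ?thesis using sends_compose[of V "quarter_turn (P * B)" s s s] m s V(3)[OF that] by auto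
    qed
    moreover have "sends (quarter_turn (P * B) * V) A B"
      using sends_compose[OF m(4) _ m(3,1,2) V(2) qs(2)] m by auto
    moreover have "normalizing (quarter_turn (P * B) * V)"
      using normalizing_mult normalizing_quarter_turn[OF _ qs(1)] V(1) P B by blast
    ultimately show ?thesis using q by blast
  qed
  obtain V where V: "V \<in> Mat" "U * V = 1\<^sub>m d" using normalizing_invertible[OF U] .
  have Um: "U \<in> Mat" "A \<in> Mat" using U A by auto
  obtain Q where Q: "Q \<in> pauli {1..n}" "U * A = Q * U"
    using normalizing_image[of U A] U A by blast
  have Qm: "Q \<in> Mat" using Q by auto
  have UAQ: "sends U A Q" unfolding sends_def using Q by (intro exI[of _ 1]) auto
  have QQ: "Q * Q = 1\<^sub>m d"
  proof (rule mat_cancel_right[OF _ _ Um(1) V])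
    have "Q * Q * U = (U * A) * A" using Q Um Qm by (simp add: mat_norm)
    then show "Q * Q * U = 1\<^sub>m d * U" using A(2) Um by (simp add: mat_norm)
  qed (use Qm in auto)
  obtain e where e: "is_sign e" "twist e Q A" using pauli_twist Q A by blast
  show ?thesis
  proof (cases "e = 1")
    case False
    then have e1: "twist (-1) Q A" using e by (auto simp: is_sign_def)
    have "twist 1 (Q * A) s" if s: "s \<in> S" for s
    proof -
      have sp: "s \<in> pauli {1..n}" using S s by auto
      obtain f where f: "is_sign f" "twist f A s" using pauli_twist A(1) sp by blast
      have "twist f Q s" using sends_twist[OF Um(1) V Um(2) _ Qm _ UAQ S(2)[OF s] f(2)] sp by auto
      then show ?thesis using twist_mult_left[OF Qm Um(2) _ _ f(2)] sp f(1) by fastforce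
    qed
    then show ?thesis using step[OF U UAQ S(2) Q(1) QQ A(1,2) e1] by auto
  next
    case True
    have act: "active {1..n} Q"
    proof -
      obtain P where P: "P \<in> pauli {1..n}" "twist (-1) A P" using A(3) by (auto simp: active_def)
      obtain P' where P': "P' \<in> pauli {1..n}" "U * P = P' * U" using normalizing_image[OF U P(1)] .
      have "sends U P P'" unfolding sends_def using P' by (intro exI[of _ 1]) auto
      then have "twist (-1) Q P'" using sends_twist[OF Um(1) V Um(2) _ Qm _ UAQ _ P(2)] P P' by auto
      then show ?thesis using P' by (auto simp: active_def)
    qed
    have "twist f Q s" if s: "s \<in> S" "twist f A s" for s f
      using sends_twist[OF Um(1) V Um(2) _ Qm _ UAQ S(2)[OF s(1)] s(2)] S(1) s(1) by auto
    then obtain R where R': "R \<in> pauli {1..n}" "R * R = 1\<^sub>m d" "twist (-1) Q R" "twist (-1) R A"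
        "\<And>s. s \<in> S \<Longrightarrow> twist 1 (Q * R) s" "\<And>s. s \<in> S \<Longrightarrow> twist 1 (R * A) s"
      using R[OF Q(1) act] e True by metis
    obtain k where k: "k \<in> K" "normalizing (k * U)" "sends (k * U) A R" "\<And>s. s \<in> S \<Longrightarrow> sends (k * U) s s"
      using step[OF U UAQ S(2) Q(1) QQ R'(1,2,3,5)] by blast
    obtain l where l: "l \<in> K" "normalizing (l * (k * U))" "sends (l * (k * U)) A A"
        "\<And>s. s \<in> S \<Longrightarrow> sends (l * (k * U)) s s"
      using step[OF k(2,3,4) R'(1,2) A(1,2) R'(4,6)] by blast
    have "l * (k * U) = l * k * U" using k l Um by (simp add: mat_norm)
    then show ?thesis using l k by (intro bexI[of _ "l * k"]) auto
  qed
qed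

lemma turning_in_K:
  assumes "A \<in> pauli S" "turning A"
  shows "A \<in> K"
proof -
  obtain c where c: "(c \<cdot>\<^sub>m A) * (c \<cdot>\<^sub>m A) = (-1) \<cdot>\<^sub>m 1\<^sub>m d" "quarter_turn (c \<cdot>\<^sub>m A) \<in> K"
    using assms(2) by (auto simp: turning_def)
  have A: "A \<in> Mat" using assms by auto
  obtain s where s: "is_sign s" "A * A = s \<cdot>\<^sub>m 1\<^sub>m d" using pauli_square assms by blast
  have cA: "c \<cdot>\<^sub>m A \<in> K"
    using quarter_turn_square[OF _ c(1)] K_mult[OF c(2,2)] A by auto
  have "(c * c * s) \<cdot>\<^sub>m (1\<^sub>m d :: complex mat) = (-1) \<cdot>\<^sub>m 1\<^sub>m d" using c(1) A s by (simp add: mat_norm mult.assoc)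
  then have ccs: "c * c * s = -1" by (rule scalar_inject)
  then have "(c * c) * (c * c) = 1" using s by (auto simp: is_sign_def)
  then have c4: "c ^ 4 = 1" by (simp add: power4_eq_xxxx mult.assoc)
  have "c ^ 8 = (c ^ 4) ^ 2" by (simp flip: power_mult)
  then have "(1 / c) ^ 8 = 1" using c4 by (simp add: power_one_over)
  moreover have "c \<noteq> 0" using c4 by auto
  ultimately show ?thesis using K_smult[of "1 / c" "c \<cdot>\<^sub>m A"] cA by (simp add: smult_smult_mat)
qed

text \<open>
  The controlled matrices \<open>control p q\<close> for \<open>q = a, b, a b\<close> multiply to \<open>1\<close>, and each of them is
  up to a scalar a product of a quarter turn in the direction \<open>p\<close> and two quarter turns in \<open>K\<close>. So
  up to a scalar \<open>K\<close> contains the cube of the quarter turn in the direction \<open>p\<close>, which is its inverse up to sign.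
\<close>

lemma quarter_turn_from_controls:
  assumes m: "p \<in> Mat" "a \<in> Mat" "b \<in> Mat"
    and sq: "p * p = 1\<^sub>m d" "a * a = 1\<^sub>m d" "b * b = 1\<^sub>m d"
    and comm: "twist 1 p a" "twist 1 p b" "twist 1 a b"
    and K: "\<And>q. q \<in> {a, b, a * b} \<Longrightarrow>
      quarter_turn (\<zeta> \<cdot>\<^sub>m (p * q)) \<in> K \<and> quarter_turn ((- \<zeta>) \<cdot>\<^sub>m q) \<in> K"
  shows "quarter_turn ((- \<zeta>) \<cdot>\<^sub>m p) \<in> K"
proof -
  define c where "c = (1 - \<zeta>) * complex_of_real (1 / sqrt 2)"
  define P where "P = quarter_turn ((- \<zeta>) \<cdot>\<^sub>m p)"
  define G where "G q = quarter_turn (\<zeta> \<cdot>\<^sub>m (p * q)) * quarter_turn ((- \<zeta>) \<cdot>\<^sub>m q)" for q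
  have P: "P \<in> Mat" using m by (auto simp: P_def)
  have "c * c = (1 - \<zeta>) * (1 - \<zeta>) * (complex_of_real (1 / sqrt 2) * complex_of_real (1 / sqrt 2))"
    by (simp add: c_def mult_ac)
  also have "\<dots> = - \<zeta>" unfolding half_root using zeta_square by (simp add: algebra_simps)
  finally have "c ^ 8 = ((- \<zeta>) ^ 2) ^ 2" by (metis mult_2 numeral_Bit0 power2_eq_square power_mult power_add)
  then have c8: "c ^ 8 = 1" using zeta_square by (simp add: power2_eq_square)
  have G: "G q \<in> K \<and> twist 1 P (G q) \<and> G q * P = c \<cdot>\<^sub>m control p q"
    if q: "q \<in> {a, b, a * b}" for q
  proof -
    have ab: "(a * b) * (a * b) = 1\<^sub>m d"
      using square_mult[OF m(2,3) comm(3), of 1 1] sq by simp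
    have qm: "q \<in> Mat" "q * q = 1\<^sub>m d" "twist 1 p q"
      using q m sq ab comm twist_mult_right[OF m comm(1,2)] by auto
    have q2: "twist 1 p (p * q)" using twist_mult_right[OF m(1,1) qm(1) twist_self qm(3)] by simp
    have tw: "twist 1 P L" if "L \<in> Mat" "twist 1 p L" for L
      unfolding P_def using quarter_turn_commute[OF _ that(1) twist_smult_left[OF m(1) that]] m by simp
    have tq: "twist 1 P (quarter_turn (e \<cdot>\<^sub>m L))" if L: "L \<in> Mat" "twist 1 p L" for e L
    proof -
      have eL: "e \<cdot>\<^sub>m L \<in> Mat" using L by simp
      have "twist 1 (e \<cdot>\<^sub>m L) P"
        using twist_sym[OF is_sign_simps(1) tw[OF eL twist_smult_right[OF m(1) L]]] .
      then show ?thesis using twist_sym[OF is_sign_simps(1) quarter_turn_commute[OF eL P]] by simp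
    qed
    have t1: "twist 1 P (quarter_turn (\<zeta> \<cdot>\<^sub>m (p * q)))" "twist 1 P (quarter_turn ((- \<zeta>) \<cdot>\<^sub>m q))"
      using tq[OF _ q2] tq[OF qm(1,3)] qm m by auto
    have "twist 1 P (G q)" unfolding G_def using twist_mult_right[OF P _ _ t1] m qm by auto
    moreover have "G q * P = c \<cdot>\<^sub>m control p q"
    proof -
      have "G q * P = quarter_turn (\<zeta> \<cdot>\<^sub>m (p * q)) * (P * quarter_turn ((- \<zeta>) \<cdot>\<^sub>m q))"
        unfolding G_def using t1(2) P m qm by (simp add: twist_def mat_assoc)
      then show ?thesis unfolding P_def c_def using control_quarter_turns[OF m(1) qm(1) sq(1) qm(2,3)] by simp
    qed
    moreover have "G q \<in> K" unfolding G_def using K[OF q] by blast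
    ultimately show ?thesis by blast
  qed
  define Ga Gb Gc where "Ga = G a" and "Gb = G b" and "Gc = G (a * b)"
  have Gs: "Ga \<in> K" "Gb \<in> K" "Gc \<in> K" "twist 1 P Gb" "twist 1 P Gc"
    "Ga * P = c \<cdot>\<^sub>m control p a" "Gb * P = c \<cdot>\<^sub>m control p b" "Gc * P = c \<cdot>\<^sub>m control p (a * b)"
    using G unfolding Ga_def Gb_def Gc_def by auto
  have Gm: "Ga \<in> Mat" "Gb \<in> Mat" "Gc \<in> Mat" using Gs by auto
  define J where "J = (- \<zeta>) \<cdot>\<^sub>m p"
  have J: "J \<in> Mat" "J * J = (-1) \<cdot>\<^sub>m 1\<^sub>m d"
    using m sq zeta_square by (auto simp: J_def mat_norm)
  have PP: "P * P = J" unfolding P_def using quarter_turn_square[OF J[unfolded J_def]] by (simp add: J_def)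
  have "(control p a * control p b) * control p (a * b) = control p ((a * b) * (a * b))"
    using control_mult[OF m sq(1) comm(1)] control_mult[OF m(1) _ _ sq(1), of "a * b" "a * b"]
      twist_mult_right[OF m comm(1,2)] m by auto
  also have "(a * b) * (a * b) = 1\<^sub>m d"
    using square_mult[OF m(2,3) comm(3), of 1 1] sq by simp
  also note control_one[OF m(1)]
  finally have one: "(control p a * control p b) * control p (a * b) = 1\<^sub>m d" .
  have "(Ga * P) * (Gb * P) * (Gc * P) = (c * c * c) \<cdot>\<^sub>m ((control p a * control p b) * control p (a * b))"
    unfolding Gs using m by (simp add: mat_norm mult.assoc)
  then have prod: "(Ga * P) * (Gb * P) * (Gc * P) = (c * c * c) \<cdot>\<^sub>m 1\<^sub>m d" unfolding one .
  have bP: "P * Gb = Gb * P" "P * Gc = Gc * P" using Gs(4,5) by (simp_all add: twist_def)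
  have "(Ga * P) * (Gb * P) * (Gc * P) = Ga * ((P * Gb) * (P * Gc) * P)"
    using Gm P by (simp add: mat_assoc)
  also have "\<dots> = Ga * (Gb * (P * (P * Gc) * P))" unfolding bP(1) using Gm P by (simp add: mat_assoc)
  also have "P * (P * Gc) * P = (P * Gc) * (P * P)"
    using Gm P arg_cong[OF bP(2), of "\<lambda>M. P * M * P"] by (simp add: mat_assoc)
  also have "Ga * (Gb * ((P * Gc) * (P * P))) = Ga * (Gb * Gc) * (P * J)" unfolding bP(2) PP using Gm P J by (simp add: mat_assoc)
  finally have GPJ: "Ga * (Gb * Gc) * (P * J) = (c * c * c) \<cdot>\<^sub>m 1\<^sub>m d" unfolding prod by (rule sym)
  have "Ga * (Gb * Gc) * (P * J) * P = (c * c * c) \<cdot>\<^sub>m P"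
    unfolding GPJ using P by (simp add: mat_smult_left mat_one_left)
  moreover have "P * J * P = (-1) \<cdot>\<^sub>m 1\<^sub>m d"
  proof -
    have "P * J * P = (P * P) * (P * P)" unfolding PP[symmetric] using P by (simp add: mat_assoc)
    then show ?thesis using PP J by simp
  qed
  then have "Ga * (Gb * Gc) * (P * J) * P = (-1) \<cdot>\<^sub>m (Ga * (Gb * Gc))"
    using Gm P J mat_assoc[of "Ga * (Gb * Gc)" "P * J" P] by (simp add: mat_norm)
  ultimately have "(c ^ 5) \<cdot>\<^sub>m ((c * c * c) \<cdot>\<^sub>m P) = (c ^ 5) \<cdot>\<^sub>m ((-1) \<cdot>\<^sub>m (Ga * (Gb * Gc)))" by simp
  moreover have "c ^ 5 * (c * c * c) = 1" using c8 by (simp add: eval_nat_numeral mult_ac)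
  ultimately have "P = (c ^ 5 * (-1)) \<cdot>\<^sub>m (Ga * (Gb * Gc))" by (simp add: smult_smult_mat)
  moreover have "(c ^ 5 * (-1)) ^ 8 = 1"
  proof -
    have "(c ^ 5 * (-1)) ^ 8 = (c ^ 8) ^ 5" by (simp add: power_mult_distrib flip: power_mult)
    then show ?thesis using c8 by simp
  qed
  ultimately show ?thesis using K_smult[of "c ^ 5 * (-1)" "Ga * (Gb * Gc)"] Gs(1-3) K_mult
    unfolding P_def[symmetric] by metis
qed

end

section \<open>The stabilizer of one Pauli matrix\<close>

text \<open>
  The generators of \<open>IN\<^sub>n\<close>, translated into quarter turns: \<open>single_x\<close>, \<open>single_z\<close> and \<open>pair\<close> come from
  \<open>h\<^sub>i\<close>, \<open>s\<^sub>i\<close> and \<open>\<Lambda>\<^sub>i\<close> with \<open>i \<ge> 2\<close>, \<open>link\<close> comes from \<open>M\<close>, and \<open>hadamard\<close> is \<open>h\<^sub>1\<close>.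
\<close>

locale stabilizer_monoid = quarter_turn_monoid +
  assumes two_qubits: "2 \<le> n"
    and single_x: "i \<in> {2..n} \<Longrightarrow> turning (x i)"
    and single_z: "i \<in> {2..n} \<Longrightarrow> turning (z i)"
    and pair: "i \<in> {2..<n} \<Longrightarrow> turning (z i * z (i + 1))"
    and link: "turning (x 2 * (z 1 * x 1))"
    and hadamard: "x 1 * quarter_turn (x 1 * z 1) \<in> K"
    and x1_two_qubits: "n = 2 \<Longrightarrow> x 1 \<in> K"
begin

definition y :: "complex mat" where
  "y = z 1 * x 1"

lemma first_qubit: "1 \<in> {1..n}"
  using two_qubits by auto

lemma y_pauli: "y \<in> pauli {1}"
  unfolding y_def using pauli_x[of 1 "{1}"] pauli_z[of 1 "{1}"] first_qubit by auto

lemma y_closed [simp]: "y \<in> Mat"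
  using y_pauli by auto

lemma y_square: "y * y = (-1) \<cdot>\<^sub>m 1\<^sub>m d"
  using square_mult[of "z 1" "x 1" "-1" 1 1] twist_zx[of 1 1] x_square[of 1] z_square[of 1] first_qubit
  by (auto simp: y_def)

lemma xz_y: "x 1 * z 1 = (-1) \<cdot>\<^sub>m y"
  using twist_xz[of 1 1] first_qubit by (simp add: y_def twist_def)

lemma twist_xy: "twist (-1) (x 1) y"
  using twist_mult_right[of "x 1" "z 1" "x 1" "-1" 1] twist_xz[of 1 1] twist_self first_qubit
  by (simp add: y_def)

lemma twist_zy: "twist (-1) (z 1) y"
  using twist_mult_right[of "z 1" "z 1" "x 1" 1 "-1"] twist_zx[of 1 1] twist_self first_qubit
  by (simp add: y_def)

lemma block_y: "A \<in> pauli {2..n} \<Longrightarrow> twist 1 A y"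
  using pauli_disjoint_commute[OF _ y_pauli] by auto

lemma turning_upper: "A \<in> pauli {2..n} \<Longrightarrow> active {2..n} A \<Longrightarrow> turning A"
  using turning_block[of n A] single_x single_z pair two_qubits by auto

lemma active_upper: "i \<in> {2..n} \<Longrightarrow> active {2..n} (x i)" "i \<in> {2..n} \<Longrightarrow> active {2..n} (z i)"
  unfolding active_def
  using twist_xz[of i i] twist_zx[of i i] pauli_x[of i "{2..n}"] pauli_z[of i "{2..n}"] by fastforce+

lemma turning_upper_y:
  assumes "A \<in> pauli {2..n}" "active {2..n} A"
  shows "turning (A * y)"
  using turning_extend[OF turning_upper y_pauli block_y _ active_upper(1) _ assms, of 2]
    link two_qubits pauli_x[of 2 "{2..n}"] by (auto simp: y_def)

text \<open>
  A product of two anticommuting directions anticommutes with both. All directions at hand commute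
  with \<open>y\<close>, so \<open>turning_mult\<close> never yields \<open>y\<close> itself. For three or more qubits there are
  commuting independent \<open>a = z\<^sub>2\<close> and \<open>b = z\<^sub>3\<close>, and the relation between controlled matrices
  applies.
\<close>

lemma turning_y: "turning y"
proof (cases "n = 2")
  case True
  have m: "x 1 \<in> Mat" "z 1 \<in> Mat" using first_qubit by auto
  have "x 1 * (x 1 * quarter_turn (x 1 * z 1)) \<in> K" using x1_two_qubits[OF True] hadamard by blast
  moreover have "x 1 * (x 1 * quarter_turn (x 1 * z 1)) = quarter_turn (x 1 * z 1)"
    using m x_square[OF first_qubit] mat_assoc[of "x 1" "x 1"] by (simp add: mat_one_left)
  ultimately show ?thesis
    unfolding turning_def xz_y using y_square by (intro exI[of _ "-1"]) (simp add: mat_norm)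
next
  case False
  then have i: "2 \<in> {2..n}" "3 \<in> {2..n}" "2 \<in> {1..n}" "3 \<in> {1..n}" using two_qubits by auto
  \<comment> \<open>The control \<open>p\<close> has square \<open>1\<close>, and \<open>- \<zeta> p = y\<close>.\<close>
  define a b p where "a = z 2" and "b = z 3" and "p = \<zeta> \<cdot>\<^sub>m y"
  have zp: "z 2 \<in> pauli {2..n}" "z 3 \<in> pauli {2..n}" using pauli_z i by auto
  have m: "p \<in> Mat" "a \<in> Mat" "b \<in> Mat" using i by (auto simp: a_def b_def p_def)
  have sq: "p * p = 1\<^sub>m d" "a * a = 1\<^sub>m d" "b * b = 1\<^sub>m d"
    using y_square zeta_square z_square i by (auto simp: a_def b_def p_def mat_norm simp flip: mult.assoc)
  have ya: "twist 1 q y" "twist 1 p q" if "q \<in> pauli {2..n}" for q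
    using block_y[OF that] twist_smult_left[OF _ _ twist_sym[OF is_sign_simps(1) block_y[OF that]], of \<zeta>] that
    by (auto simp: p_def)
  have comm: "twist 1 p a" "twist 1 p b" "twist 1 a b"
    using ya(2) zp twist_zz[of 2 3] i by (auto simp: a_def b_def)
  have "twist (-1) (a * b) (x 2)"
    using twist_mult_left[of a b "x 2" "-1" 1] twist_zx[of 2 2] twist_zx[of 3 2] i by (auto simp: a_def b_def)
  then have act_ab: "active {2..n} (a * b)" using pauli_x[of 2 "{2..n}"] i by (auto simp: active_def)
  have qp: "q \<in> pauli {2..n}" "active {2..n} q" "q * q = 1\<^sub>m d" if "q \<in> {a, b, a * b}" for q
    using that zp active_upper(2)[OF i(1)] active_upper(2)[OF i(2)] act_ab sq
      square_mult[OF m(2,3) comm(3), of 1 1] by (auto simp: a_def b_def)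
  have "quarter_turn ((- \<zeta>) \<cdot>\<^sub>m p) \<in> K"
  proof (rule quarter_turn_from_controls[OF m sq comm])
    fix q assume "q \<in> {a, b, a * b}"
    note q = qp[OF this]
    have qm: "q \<in> Mat" using q by auto
    have y_q: "y * q = q * y" using ya(1)[OF q(1)] by (simp add: twist_def)
    have "(q * y) * (q * y) = (-1) \<cdot>\<^sub>m 1\<^sub>m d"
      using square_mult[OF qm y_closed ya(1)[OF q(1)], of 1 "-1"] q(3) y_square by simp
    then have "((-1) \<cdot>\<^sub>m (q * y)) * ((-1) \<cdot>\<^sub>m (q * y)) = (-1) \<cdot>\<^sub>m 1\<^sub>m d" using qm by (simp add: mat_smult_left mat_smult_right smult_smult_mat)
    moreover have "q * y \<in> pauli UNIV" using q(1) y_pauli pauli_mono[OF subset_UNIV] by blast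
    ultimately have "quarter_turn ((-1) \<cdot>\<^sub>m (q * y)) \<in> K"
      using turning_quarter_turn turning_upper_y[OF q(1,2)] by blast
    moreover have "\<zeta> \<cdot>\<^sub>m (p * q) = (-1) \<cdot>\<^sub>m (q * y)"
      unfolding p_def using qm zeta_square by (simp add: mat_norm y_q)
    moreover have "quarter_turn ((- \<zeta>) \<cdot>\<^sub>m q) \<in> K"
      using turning_quarter_turn[OF q(1) turning_upper[OF q(1,2)]] qm q(3) zeta_square by (simp add: mat_norm)
    ultimately show "quarter_turn (\<zeta> \<cdot>\<^sub>m (p * q)) \<in> K \<and> quarter_turn ((- \<zeta>) \<cdot>\<^sub>m q) \<in> K" by simp
  qed
  then have "quarter_turn y \<in> K" using zeta_square by (simp add: p_def smult_smult_mat)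
  then show ?thesis unfolding turning_def using y_square by (intro exI[of _ 1]) auto
qed

text \<open>
  This provides a Pauli matrix in \<open>K\<close> that anticommutes with \<open>y\<close>; quarter turns
  in directions commuting with \<open>y\<close> only ever yield Pauli matrices commuting with \<open>y\<close>.
\<close>

lemma x1_in_K: "x 1 \<in> K"
proof -
  have m: "x 1 \<in> Mat" using first_qubit by auto
  have "quarter_turn y \<in> K" using turning_quarter_turn[OF y_pauli turning_y, of 1] y_square by simp
  moreover have "quarter_turn ((-1) \<cdot>\<^sub>m y) * quarter_turn y = 1\<^sub>m d"
    using quarter_turn_inverse(2)[OF y_closed y_square] .
  then have "(x 1 * quarter_turn (x 1 * z 1)) * quarter_turn y = x 1"
    unfolding xz_y using m by (simp add: mat_norm)
  ultimately show ?thesis using K_mult[OF hadamard] by metis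
qed

lemma pauli_in_K: "P \<in> pauli {1..n} \<Longrightarrow> P \<in> K"
proof (induction rule: pauli.induct)
  case one
  then show ?case using K_phase[of 1] by simp
next
  case (phase P)
  have "\<zeta> ^ 8 = (\<zeta> * \<zeta>) ^ 4" by (simp add: power2_eq_square[symmetric] flip: power_mult)
  then show ?case using phase K_smult[of \<zeta> P] zeta_square by simp
next
  case (generator i G P)
  have "G \<in> K"
  proof (cases "i = 1")
    case True
    have m: "x 1 \<in> Mat" "z 1 \<in> Mat" using first_qubit by auto
    have "y * x 1 = z 1" unfolding y_def using m x_square[OF first_qubit] by (simp add: mat_norm)
    then have "z 1 \<in> K" using turning_in_K[OF y_pauli turning_y] x1_in_K K_mult by metis
    then show ?thesis using x1_in_K True generator(2) by auto
  next
    case False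
    then have "turning G" using generator single_x single_z by auto
    then show ?thesis using turning_in_K pauli_generator[of i "{i}" G] generator by blast
  qed
  then show ?case using generator by blast
qed

text \<open>
  The part of \<open>A\<close> on the first qubit commutes with \<open>y\<close>, so it is \<open>1\<close> or \<open>y\<close> up to a scalar.
\<close>

lemma commuting_quarter_turn:
  assumes A: "A \<in> pauli {1..n}" "A * A = (-1) \<cdot>\<^sub>m 1\<^sub>m d" "twist 1 A y"
  shows "quarter_turn A \<in> K"
proof -
  have scalar: "quarter_turn A \<in> K" if "A = c \<cdot>\<^sub>m 1\<^sub>m d" for c
  proof -
    have "(c * c) \<cdot>\<^sub>m (1\<^sub>m d :: complex mat) = (-1) \<cdot>\<^sub>m 1\<^sub>m d" using A(2) that by (simp add: mat_norm)
    then have cc: "c * c = -1" by (rule scalar_inject)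
    define r where "r = complex_of_real (1 / sqrt 2)"
    have "((1 + c) * r) * ((1 + c) * r) = (1 + c) * (1 + c) * (r * r)" by (simp add: mult_ac)
    also have "\<dots> = c" unfolding r_def half_root using cc by (simp add: algebra_simps)
    finally have "((1 + c) * r) ^ 8 = (c ^ 2) ^ 2" by (metis mult_2 numeral_Bit0 power2_eq_square power_mult power_add)
    then have "((1 + c) * r) ^ 8 = 1" using cc by (simp add: power2_eq_square)
    moreover have "quarter_turn A = ((1 + c) * r) \<cdot>\<^sub>m 1\<^sub>m d"
      unfolding that r_def by (simp add: quarter_turn_alt) (intro eq_matI, auto)
    ultimately show ?thesis using K_phase by simp
  qed
  have turn: "quarter_turn A \<in> K" if "turning A"
    using turning_quarter_turn[OF A(1) that, of 1] A(2) by simp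
  have "{1..n} = {1} \<union> {2..n}" "{1::nat} \<inter> {2..n} = {}" using two_qubits by auto
  then obtain B C where BC: "B \<in> pauli {1}" "C \<in> pauli {2..n}" "A = B * C"
    using pauli_split A(1) by metis
  obtain c D where D: "c \<noteq> 0" "B = c \<cdot>\<^sub>m D" "D \<in> {1\<^sub>m d, x 1, z 1, y}"
    using pauli_single[OF BC(1) first_qubit] unfolding y_def by blast
  have m: "C \<in> Mat" "D \<in> Mat" using BC D first_qubit by auto
  have AD: "A = c \<cdot>\<^sub>m (D * C)" using BC D m by (simp add: mat_norm)
  have "\<not> twist (-1) D y"
  proof
    assume "twist (-1) D y"
    then have "twist (-1) A y"
      unfolding AD using twist_smult_left twist_mult_left[OF m(2,1) y_closed _ block_y[OF BC(2)]] m by auto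
    then show False using twist_sign_unique[OF A(1) y_pauli] A(3) by blast
  qed
  then have "D \<in> {1\<^sub>m d, y}" using D(3) twist_xy twist_zy by auto
  moreover have yC: "y * C = C * y" using block_y[OF BC(2)] by (simp add: twist_def)
  ultimately have A_cases: "A = c \<cdot>\<^sub>m C \<or> A = c \<cdot>\<^sub>m (C * y)" using AD m by (auto simp: mat_norm)
  from pauli_active_or_scalar[OF BC(2)] show ?thesis
  proof
    assume act: "active {2..n} C"
    then have "turning A"
      using A_cases turning_smult[OF D(1)] turning_upper[OF BC(2) act] turning_upper_y[OF BC(2) act] by auto
    then show ?thesis by (rule turn)
  next
    assume "\<exists>e. C = e \<cdot>\<^sub>m 1\<^sub>m d"
    then obtain e where e: "C = e \<cdot>\<^sub>m 1\<^sub>m d" by blast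
    from A_cases show ?thesis
    proof
      assume "A = c \<cdot>\<^sub>m C"
      then show ?thesis using scalar[of "c * e"] e by (simp add: smult_smult_mat)
    next
      assume "A = c \<cdot>\<^sub>m (C * y)"
      then have Ay: "A = (c * e) \<cdot>\<^sub>m y" using e by (simp add: mat_norm)
      have "c * e \<noteq> 0"
      proof -
        have "(c * e * (c * e) * (-1)) \<cdot>\<^sub>m (1\<^sub>m d :: complex mat) = (-1) \<cdot>\<^sub>m 1\<^sub>m d"
          using A(2) y_square unfolding Ay by (simp add: mat_smult_left mat_smult_right smult_smult_mat mult.assoc)
        then have "c * e * (c * e) * (-1) = -1" by (rule scalar_inject)
        then show ?thesis by auto
      qed
      then show ?thesis using turn turning_smult turning_y Ay by simp
    qed
  qed
qed

text \<open>
  The symplectic basis is restored qubit by qubit. On the first qubit \<open>y\<close> is fixed already, and \<open>z\<^sub>1\<close>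
  serves as intermediate element for \<open>x\<^sub>1\<close>. On qubit \<open>j\<close>, the image of \<open>z\<^sub>j\<close> lies in the block of
  the qubits from \<open>j\<close> on, where nondegeneracy gives an intermediate element; for the image of
  \<open>x\<^sub>j\<close> the intermediate element \<open>z\<^sub>j x\<^sub>j\<close> also keeps \<open>z\<^sub>j\<close> fixed.
\<close>

lemma fix_prefix:
  assumes U: "normalizing U" "sends U y y"
  shows "1 \<le> m \<Longrightarrow> m \<le> n \<Longrightarrow> \<exists>k \<in> K. normalizing (k * U) \<and>
    (\<forall>s \<in> {y} \<union> x ` {1..m} \<union> z ` {1..m}. sends (k * U) s s)"
proof (induction m rule: dec_induct)
  case base
  note i = first_qubit
  have yp: "y \<in> pauli {1..n}" using pauli_mono[OF _ y_pauli] i by auto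
  have xp: "x 1 \<in> pauli {1..n}" and zp: "z 1 \<in> pauli {1..n}" using pauli_x pauli_z i by auto
  have m: "x 1 \<in> Mat" "z 1 \<in> Mat" using i by auto
  have "\<exists>k \<in> K. normalizing (k * U) \<and> (\<forall>s \<in> insert (x 1) {y}. sends (k * U) s s)"
  proof (rule move_back)
    fix Q assume Q: "Q \<in> pauli {1..n}" "twist 1 Q (x 1)" "\<And>s e. s \<in> {y} \<Longrightarrow> twist e (x 1) s \<Longrightarrow> twist e Q s"
    have Qm: "Q \<in> Mat" using Q by auto
    have Qy: "twist (-1) Q y" using Q(3) twist_xy by auto
    have "y * x 1 = z 1" unfolding y_def using m x_square[OF i] by (simp add: mat_norm)
    then have "twist (-1) Q (z 1)" using twist_mult_right[OF Qm y_closed m(1) Qy Q(2)] by simp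
    moreover have "twist 1 (Q * z 1) y" using twist_mult_left[OF Qm m(2) y_closed Qy twist_zy] by simp
    ultimately show "\<exists>R \<in> pauli {1..n}. R * R = 1\<^sub>m d \<and> twist (-1) Q R \<and> twist (-1) R (x 1) \<and>
        (\<forall>s \<in> {y}. twist 1 (Q * R) s \<and> twist 1 (R * x 1) s)"
      using zp z_square[OF i] twist_zx[OF i i] twist_self[of y] by (intro bexI[of _ "z 1"]) (auto simp: y_def)
  next
    show "active {1..n} (x 1)" unfolding active_def using zp twist_xz[OF i i] by auto
  qed (use U yp xp x_square[OF i] commuting_quarter_turn in auto)
  then obtain k where k: "k \<in> K" "normalizing (k * U)" "sends (k * U) (x 1) (x 1)" "sends (k * U) y y" by auto
  have "y * x 1 = z 1" unfolding y_def using m x_square[OF i] by (simp add: mat_norm)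
  then have "sends (k * U) (z 1) (z 1)"
    using sends_mult[OF _ y_closed m(1) y_closed m(1) k(4,3)] k(2) by auto
  then show ?case using k by auto
next
  case (step m)
  then obtain k where k: "k \<in> K" "normalizing (k * U)"
    "\<And>s. s \<in> {y} \<union> x ` {1..m} \<union> z ` {1..m} \<Longrightarrow> sends (k * U) s s" by auto
  define V where "V = k * U"
  define S where "S = {y} \<union> x ` {1..m} \<union> z ` {1..m}"
  define j where "j = Suc m"
  have V: "normalizing V" "\<And>s. s \<in> S \<Longrightarrow> sends V s s" using k by (auto simp: V_def S_def)
  have j: "j \<in> {1..n}" "j \<in> {j..n}" using step by (auto simp: j_def)
  have m: "x j \<in> Mat" "z j \<in> Mat" using j by auto
  have S_low: "S \<subseteq> pauli {1..m}"
    using pauli_mono[OF _ y_pauli, of "{1..m}"] pauli_x[of _ "{1..m}"] pauli_z[of _ "{1..m}"] step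
    by (auto simp: S_def)
  have S_all: "S \<subseteq> pauli {1..n}"
    using S_low pauli_mono[of "{1..m}" "{1..n}"] step by auto
  have disj: "twist 1 P s" if "P \<in> pauli {j..n}" "s \<in> S" for P s
    using pauli_disjoint_commute[OF that(1), of s "{1..m}"] S_low that(2) by (auto simp: j_def)
  have xz: "x j \<in> pauli {j..n}" "z j \<in> pauli {j..n}" "x j \<in> pauli {1..n}" "z j \<in> pauli {1..n}"
    using pauli_x pauli_z j by auto
  have upper: "P \<in> pauli {1..n}" if "P \<in> pauli {j..n}" for P
    using pauli_mono[OF _ that, of "{1..n}"] j by auto
  have "\<exists>l \<in> K. normalizing (l * V) \<and> (\<forall>s \<in> insert (z j) S. sends (l * V) s s)"
  proof (rule move_back)
    fix Q assume Q: "Q \<in> pauli {1..n}" "active {1..n} Q" "twist 1 Q (z j)"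
      and Q_rel: "\<And>s e. s \<in> S \<Longrightarrow> twist e (z j) s \<Longrightarrow> twist e Q s"
    have Qm: "Q \<in> Mat" using Q by auto
    have Q_S: "twist 1 Q s" if "s \<in> S" for s
      using Q_rel[OF that] disj[OF xz(2) that] by auto
    have "twist 1 Q P" if "P \<in> pauli {1..<j}" for P
      using that
    proof (induction rule: pauli.induct)
      case one then show ?case using Qm by simp
    next
      case (phase P) then show ?case using Qm twist_smult_right by blast
    next
      case (generator i G P)
      then have "G \<in> S" "G \<in> Mat" by (auto simp: S_def j_def)
      then show ?case using twist_mult_right[OF Qm _ _ Q_S, of G P 1] generator by auto
    qed
    then have "active {j..n} Q" using active_upper_block Q j by blast
    moreover have "active {j..n} (z j)" unfolding active_def using xz twist_zx[of j j] j by auto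
    ultimately obtain R0 where R0: "R0 \<in> pauli {j..n}" "twist (-1) Q R0" "twist (-1) (z j) R0"
      using common_anticommuting Q(1) xz(4) by blast
    obtain c where c: "c \<cdot>\<^sub>m R0 \<in> pauli {j..n}" "(c \<cdot>\<^sub>m R0) * (c \<cdot>\<^sub>m R0) = 1\<^sub>m d"
      using pauli_normalized_square R0(1) by blast
    define R where "R = c \<cdot>\<^sub>m R0"
    have R: "R \<in> pauli {j..n}" "R * R = 1\<^sub>m d" "twist (-1) Q R" "twist (-1) (z j) R"
      using c R0 twist_smult_right Qm m by (auto simp: R_def)
    have "twist 1 (Q * R) s" if "s \<in> S" for s
      using twist_mult_left[OF Qm _ _ Q_S[OF that] disj[OF R(1) that]] R S_all that by auto
    moreover have "twist 1 (R * z j) s" if "s \<in> S" for s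
      using disj[OF pauli_mult[OF R(1) xz(2)] that] .
    ultimately show "\<exists>R \<in> pauli {1..n}. R * R = 1\<^sub>m d \<and> twist (-1) Q R \<and> twist (-1) R (z j) \<and>
        (\<forall>s \<in> S. twist 1 (Q * R) s \<and> twist 1 (R * z j) s)"
      using R upper twist_sym[OF _ R(4)] by auto
  next
    show "active {1..n} (z j)" unfolding active_def using xz twist_zx[of j j] j by auto
    show "quarter_turn J \<in> K" if "J \<in> pauli {1..n}" "J * J = (-1) \<cdot>\<^sub>m 1\<^sub>m d" "\<And>s. s \<in> S \<Longrightarrow> twist 1 J s" for J
      using commuting_quarter_turn that by (auto simp: S_def)
  qed (use V S_all xz z_square[OF j(1)] in auto)
  then obtain l where l: "l \<in> K" "normalizing (l * V)" "\<And>s. s \<in> insert (z j) S \<Longrightarrow> sends (l * V) s s" by blast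
  have "\<exists>l' \<in> K. normalizing (l' * (l * V)) \<and> (\<forall>s \<in> insert (x j) (insert (z j) S). sends (l' * (l * V)) s s)"
  proof (rule move_back)
    fix Q assume Q: "Q \<in> pauli {1..n}" "active {1..n} Q" "twist 1 Q (x j)"
      and Q_rel: "\<And>s e. s \<in> insert (z j) S \<Longrightarrow> twist e (x j) s \<Longrightarrow> twist e Q s"
    have Qm: "Q \<in> Mat" using Q by auto
    define R where "R = \<zeta> \<cdot>\<^sub>m (z j * x j)"
    have Rp: "R \<in> pauli {j..n}" unfolding R_def using xz pauli.phase by blast
    have Rm: "R \<in> Mat" using Rp by auto
    have "(z j * x j) * (z j * x j) = (-1) \<cdot>\<^sub>m 1\<^sub>m d"
      using square_mult[OF m(2,1), of "-1" 1 1] twist_zx[of j j] j x_square z_square by simp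
    then have RR: "R * R = 1\<^sub>m d" unfolding R_def using m zeta_square
      by (simp add: mat_smult_left mat_smult_right smult_smult_mat)
    have Qz: "twist (-1) Q (z j)" using Q_rel[of "z j" "-1"] twist_xz[of j j] j by auto
    have QR: "twist (-1) Q R" unfolding R_def
      using twist_smult_right[OF Qm] twist_mult_right[OF Qm m(2,1) Qz Q(3)] m by auto
    have Rx: "twist (-1) R (x j)" unfolding R_def
      using twist_smult_left[OF _ m(1)] twist_mult_left[OF m(2,1,1) _ twist_self, of "-1"] twist_zx[of j j] j m by auto
    have Rz: "twist (-1) R (z j)" unfolding R_def
      using twist_smult_left[OF _ m(2)] twist_mult_left[OF m(2,1,2) twist_self, of "-1"] twist_xz[of j j] j m by auto
    have "twist 1 (Q * R) s" if s: "s \<in> insert (z j) S" for s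
    proof (cases "s = z j")
      case True then show ?thesis using twist_mult_left[OF Qm Rm m(2) Qz Rz] by simp
    next
      case False
      then have "s \<in> S" "s \<in> Mat" using s S_all by auto
      then show ?thesis
        using twist_mult_left[OF Qm Rm _ Q_rel disj[OF Rp], of s 1] disj[OF xz(1)] by auto
    qed
    moreover have "twist 1 (R * x j) s" if s: "s \<in> insert (z j) S" for s
    proof (cases "s = z j")
      case True then show ?thesis using twist_mult_left[OF Rm m(1,2) Rz, of "-1"] twist_xz[of j j] j by simp
    next
      case False
      then show ?thesis using disj[OF pauli_mult[OF Rp xz(1)]] s by auto
    qed
    ultimately show "\<exists>R \<in> pauli {1..n}. R * R = 1\<^sub>m d \<and> twist (-1) Q R \<and> twist (-1) R (x j) \<and>
        (\<forall>s \<in> insert (z j) S. twist 1 (Q * R) s \<and> twist 1 (R * x j) s)"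
      using QR Rx RR upper[OF Rp] by blast
  next
    show "active {1..n} (x j)" unfolding active_def using xz twist_xz[of j j] j by auto
    show "quarter_turn J \<in> K" if "J \<in> pauli {1..n}" "J * J = (-1) \<cdot>\<^sub>m 1\<^sub>m d"
        "\<And>s. s \<in> insert (z j) S \<Longrightarrow> twist 1 J s" for J
      using commuting_quarter_turn that by (auto simp: S_def)
  qed (use l S_all xz x_square[OF j(1)] in auto)
  then obtain l' where l': "l' \<in> K" "normalizing (l' * (l * V))"
    "\<And>s. s \<in> insert (x j) (insert (z j) S) \<Longrightarrow> sends (l' * (l * V)) s s" by blast
  have "l' * (l * V) = (l' * l * k) * U" using l' l k U by (simp add: V_def mat_assoc)
  moreover have "{y} \<union> x ` {1..Suc m} \<union> z ` {1..Suc m} = insert (x j) (insert (z j) S)"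
    by (auto simp: S_def j_def atLeastAtMostSuc_conv)
  ultimately show ?case using l' l(1) k(1) by (intro bexI[of _ "l' * l * k"]) auto
qed

text \<open>
  Once every \<open>x\<^sub>i\<close> and \<open>z\<^sub>i\<close> is fixed up to sign, a Pauli matrix removes the signs, and
  irreducibility leaves only a scalar.
\<close>

lemma stabilizer_in_K:
  assumes "normalizing U" "sends U y y"
  obtains k c where "k \<in> K" "k * U = c \<cdot>\<^sub>m 1\<^sub>m d"
proof -
  obtain k where k: "k \<in> K" "normalizing (k * U)"
    "\<And>s. s \<in> {y} \<union> x ` {1..n} \<union> z ` {1..n} \<Longrightarrow> sends (k * U) s s"
    using fix_prefix[OF assms, of n] two_qubits by auto
  obtain D where D: "D \<in> pauli {1..n}"
    "\<And>i. i \<in> {1..n} \<Longrightarrow> twist 1 (D * (k * U)) (x i) \<and> twist 1 (D * (k * U)) (z i)"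
    using correct_signs[of "k * U" n] k by auto
  have DkU: "D * (k * U) \<in> Mat" using D(1) k(2) by auto
  then obtain c where "D * (k * U) = c \<cdot>\<^sub>m 1\<^sub>m d" using commutant[OF DkU] D(2) by blast
  then have "(D * k) * U = c \<cdot>\<^sub>m 1\<^sub>m d" using D(1) k(1) assms(1) by (simp add: mat_assoc)
  then show ?thesis using that pauli_in_K[OF D(1)] k(1) by blast
qed

end

section \<open>Tensor products\<close>

lemma kron_closed [simp, intro]:
  "A \<in> carrier_mat a b \<Longrightarrow> B \<in> carrier_mat c e \<Longrightarrow> kron A B \<in> carrier_mat (a * c) (b * e)"
  by (auto simp: kron_def)

lemma kron_dim [simp]: "dim_row (kron A B) = dim_row A * dim_row B" "dim_col (kron A B) = dim_col A * dim_col B"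
  by (auto simp: kron_def)

lemma kron_index:
  "i < dim_row A * dim_row B \<Longrightarrow> j < dim_col A * dim_col B \<Longrightarrow>
   kron A B $$ (i, j) = A $$ (i div dim_row B, j div dim_col B) * B $$ (i mod dim_row B, j mod dim_col B)"
  by (simp add: kron_def)

lemma div_lt: "(i :: nat) < a * b \<Longrightarrow> i div b < a"
  by (simp add: less_mult_imp_div_less)

lemma mod_lt: "(i :: nat) < a * b \<Longrightarrow> i mod b < b"
  by (cases "b = 0") auto

lemma pair_lt: "(p :: nat) < b \<Longrightarrow> q < e \<Longrightarrow> p * e + q < b * e"
  using mult_le_mono1[of "Suc p" b e] by simp

lemma sum_div_mod:
  "(\<Sum>k = 0..<b * e. f (k div e) * g (k mod e)) = (\<Sum>k = 0..<b. f k) * (\<Sum>k = 0..<e. g k :: complex)"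
  for f g :: "nat \<Rightarrow> complex"
proof -
  have "(\<Sum>k = 0..<b. f k) * (\<Sum>k = 0..<e. g k) = (\<Sum>(p, q) \<in> {0..<b} \<times> {0..<e}. f p * g q)"
    by (simp add: sum_product sum.cartesian_product)
  also have "\<dots> = (\<Sum>k = 0..<b * e. f (k div e) * g (k mod e))"
    by (rule sum.reindex_bij_witness[of _ "\<lambda>k. (k div e, k mod e)" "\<lambda>(p, q). p * e + q"])
      (auto simp: div_lt mod_lt pair_lt)
  finally show ?thesis by simp
qed

lemma kron_mult:
  assumes "A \<in> carrier_mat a b" "C \<in> carrier_mat b c" "B \<in> carrier_mat e f" "D \<in> carrier_mat f g"
  shows "kron A B * kron C D = kron (A * C) (B * D)"
proof (rule eq_matI)
  fix i j assume "i < dim_row (kron (A * C) (B * D))" "j < dim_col (kron (A * C) (B * D))"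
  then have i: "i < a * e" "j < c * g" using assms by auto
  note d = div_lt[OF i(1)] div_lt[OF i(2)] mod_lt[OF i(1)] mod_lt[OF i(2)]
  have "(kron A B * kron C D) $$ (i, j) = (\<Sum>k = 0..<b * f. kron A B $$ (i, k) * kron C D $$ (k, j))"
    using assms i by (simp add: scalar_prod_def)
  also have "\<dots> = (\<Sum>k = 0..<b * f. (A $$ (i div e, k div f) * C $$ (k div f, j div g))
      * (B $$ (i mod e, k mod f) * D $$ (k mod f, j mod g)))"
    using assms i by (intro sum.cong) (auto simp: kron_index)
  also have "\<dots> = (\<Sum>k = 0..<b. A $$ (i div e, k) * C $$ (k, j div g))
      * (\<Sum>k = 0..<f. B $$ (i mod e, k) * D $$ (k, j mod g))"
    by (rule sum_div_mod)
  also have "\<dots> = kron (A * C) (B * D) $$ (i, j)"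
    using assms i d by (simp add: kron_index scalar_prod_def)
  finally show "(kron A B * kron C D) $$ (i, j) = kron (A * C) (B * D) $$ (i, j)" .
qed (use assms in auto)

lemma kron_assoc: "kron (kron A B) C = kron A (kron B C)"
proof (rule eq_matI)
  fix i j assume "i < dim_row (kron A (kron B C))" "j < dim_col (kron A (kron B C))"
  then have i: "i < dim_row A * dim_row B * dim_row C" "j < dim_col A * dim_col B * dim_col C"
    by (auto simp: mult.assoc)
  have eq: "k div p div q = k div (q * p)" "(k mod (q * p)) div p = k div p mod q" "(k mod (q * p)) mod p = k mod p"
    for k p q :: nat
    by (cases "p = 0"; simp add: div_mult2_eq mult.commute[of q p] mod_mult2_eq)+
  have "i mod (dim_row B * dim_row C) < dim_row B * dim_row C" "j mod (dim_col B * dim_col C) < dim_col B * dim_col C"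
    using i by (metis mod_lt mult.assoc)+
  then show "kron (kron A B) C $$ (i, j) = kron A (kron B C) $$ (i, j)"
    using i div_lt[OF i(1)] div_lt[OF i(2)] by (simp add: kron_index eq mult.assoc)
qed (auto simp: mult.assoc)

lemma kron_one: "kron (1\<^sub>m a) (1\<^sub>m b) = 1\<^sub>m (a * b)"
proof (rule eq_matI)
  fix i j assume "i < dim_row (1\<^sub>m (a * b) :: complex mat)" "j < dim_col (1\<^sub>m (a * b) :: complex mat)"
  then have i: "i < a * b" "j < a * b" by auto
  have "i = j \<longleftrightarrow> i div b = j div b \<and> i mod b = j mod b" by (metis div_mult_mod_eq)
  then show "kron (1\<^sub>m a) (1\<^sub>m b) $$ (i, j) = 1\<^sub>m (a * b) $$ (i, j)"
    using i div_lt[OF i(1)] div_lt[OF i(2)] mod_lt[OF i(1)] mod_lt[OF i(2)] by (auto simp: kron_index)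
qed auto

lemma kron_smult: "kron (c \<cdot>\<^sub>m A) B = c \<cdot>\<^sub>m kron A B" "kron A (c \<cdot>\<^sub>m B) = c \<cdot>\<^sub>m kron A B"
  by (rule eq_matI; auto simp: kron_index div_lt mod_lt)+

lemma kron_add:
  "A \<in> carrier_mat a b \<Longrightarrow> A' \<in> carrier_mat a b \<Longrightarrow> kron (A + A') B = kron A B + kron A' B"
  "B \<in> carrier_mat a b \<Longrightarrow> B' \<in> carrier_mat a b \<Longrightarrow> kron A (B + B') = kron A B + kron A B'"
  by (rule eq_matI; auto simp: kron_index div_lt mod_lt algebra_simps)+

lemma mat_adjoint_dim [simp]: "dim_row (mat_adjoint A) = dim_col A" "dim_col (mat_adjoint A) = dim_row A"
  by (auto simp: mat_adjoint_def)

lemma mat_adjoint_index [simp]: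
  "i < dim_col A \<Longrightarrow> j < dim_row A \<Longrightarrow> mat_adjoint A $$ (i, j) = cnj (A $$ (j, i))" for A :: "complex mat"
  by (simp add: mat_adjoint_def mat_of_rows_def)

lemma mat_adjoint_closed [simp]: "A \<in> carrier_mat a b \<Longrightarrow> mat_adjoint A \<in> carrier_mat b a"
  by auto

lemma mat_adjoint_kron: "mat_adjoint (kron A B) = kron (mat_adjoint A) (mat_adjoint B)"
  by (rule eq_matI) (auto simp: kron_index div_lt mod_lt)

lemma mat_adjoint_one: "mat_adjoint (1\<^sub>m a) = (1\<^sub>m a :: complex mat)"
  by (rule eq_matI) auto

lemma mat_adjoint_mult:
  "A \<in> carrier_mat a b \<Longrightarrow> B \<in> carrier_mat b c \<Longrightarrow> mat_adjoint (A * B) = mat_adjoint B * mat_adjoint A"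
  for A B :: "complex mat"
  by (rule eq_matI) (auto simp: scalar_prod_def mult.commute intro!: sum.cong)

section \<open>Operators on single qubits\<close>

definition X_mat :: "complex mat" where
  "X_mat = mat_of_rows_list 2 [[0, 1], [1, 0]]"

definition Z_mat :: "complex mat" where
  "Z_mat = mat_of_rows_list 2 [[1, 0], [0, -1]]"

lemma eq_mat_2:
  assumes "A \<in> carrier_mat 2 2" "B \<in> carrier_mat 2 2"
    "A $$ (0, 0) = B $$ (0, 0)" "A $$ (0, 1) = B $$ (0, 1)" "A $$ (1, 0) = B $$ (1, 0)" "A $$ (1, 1) = B $$ (1, 1)"
  shows "A = B"
proof (rule eq_matI)
  fix i j assume "i < dim_row B" "j < dim_col B"
  then have "i = 0 \<or> i = 1" "j = 0 \<or> j = 1" using assms(2) by auto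
  then show "A $$ (i, j) = B $$ (i, j)" using assms by auto
qed (use assms in auto)

lemma XZ_closed [simp]: "X_mat \<in> carrier_mat 2 2" "Z_mat \<in> carrier_mat 2 2"
  by (auto simp: X_mat_def Z_mat_def mat_of_rows_list_def)

lemma gates_closed [simp]: "H_mat \<in> carrier_mat 2 2" "S_mat \<omega> \<in> carrier_mat 2 2" "CZ_mat \<in> carrier_mat 4 4"
  by (auto simp: H_mat_def S_mat_def CZ_mat_def mat_of_rows_list_def)

lemma XZ_relations:
  "X_mat * X_mat = 1\<^sub>m 2" "Z_mat * Z_mat = 1\<^sub>m 2" "X_mat * Z_mat = (-1) \<cdot>\<^sub>m (Z_mat * X_mat)"
proof -
  note entries = X_mat_def Z_mat_def mat_of_rows_list_def scalar_prod_def numeral_2_eq_2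
  show "X_mat * X_mat = 1\<^sub>m 2" "Z_mat * Z_mat = 1\<^sub>m 2"
    by (rule eq_mat_2[OF mult_carrier_mat[OF XZ_closed(1,1)] one_carrier_mat]
        eq_mat_2[OF mult_carrier_mat[OF XZ_closed(2,2)] one_carrier_mat]; simp add: entries)+
  show "X_mat * Z_mat = (-1) \<cdot>\<^sub>m (Z_mat * X_mat)"
    by (rule eq_mat_2[OF mult_carrier_mat[OF XZ_closed(1,2)] smult_carrier_mat[OF mult_carrier_mat[OF XZ_closed(2,1)]]];
        simp add: entries)
qed

lemma H_XZ: "H_mat = complex_of_real (1 / sqrt 2) \<cdot>\<^sub>m (X_mat + Z_mat)"
  by (rule eq_mat_2; simp add: H_mat_def X_mat_def Z_mat_def mat_of_rows_list_def numeral_2_eq_2)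

lemma S_Z: "S_mat \<omega> = (1 / 2) \<cdot>\<^sub>m ((1 + \<omega>\<^sup>2) \<cdot>\<^sub>m 1\<^sub>m 2 + (1 - \<omega>\<^sup>2) \<cdot>\<^sub>m Z_mat)"
  by (rule eq_mat_2; simp add: S_mat_def Z_mat_def mat_of_rows_list_def numeral_2_eq_2)

lemma eq_mat_4:
  assumes "A \<in> carrier_mat 4 4" "B \<in> carrier_mat 4 4"
    "\<And>i j. i \<in> {0, 1, 2, 3} \<Longrightarrow> j \<in> {0, 1, 2, 3} \<Longrightarrow> A $$ (i, j) = B $$ (i, j)"
  shows "A = B"
proof (rule eq_matI)
  fix i j assume "i < dim_row B" "j < dim_col B"
  then have "i \<in> {0, 1, 2, 3}" "j \<in> {0, 1, 2, 3}" using assms(2) by auto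
  then show "A $$ (i, j) = B $$ (i, j)" using assms(3) by blast
qed (use assms in auto)

lemma kron_2_closed [simp]:
  "A \<in> carrier_mat 2 2 \<Longrightarrow> B \<in> carrier_mat 2 2 \<Longrightarrow> kron A B \<in> carrier_mat 4 4"
  using kron_closed[of A 2 2 B 2 2] by simp

lemma CZ_Z: "CZ_mat = (1 / 2) \<cdot>\<^sub>m (kron (1\<^sub>m 2) (1\<^sub>m 2) + kron Z_mat (1\<^sub>m 2) + kron (1\<^sub>m 2) Z_mat + (-1) \<cdot>\<^sub>m kron Z_mat Z_mat)"
  (is "_ = ?R")
proof (rule eq_mat_4)
  have d: "dim_row Z_mat = 2" "dim_col Z_mat = 2" by (auto simp: Z_mat_def mat_of_rows_list_def)
  have z: "Z_mat $$ (0, 0) = 1" "Z_mat $$ (0, 1) = 0" "Z_mat $$ (1, 0) = 0" "Z_mat $$ (1, 1) = -1"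
    "Z_mat $$ (0, Suc 0) = 0" "Z_mat $$ (Suc 0, 0) = 0" "Z_mat $$ (Suc 0, Suc 0) = -1"
    by (auto simp: Z_mat_def mat_of_rows_list_def)
  have m: "(2 :: nat) mod 2 = 0" "(3 :: nat) mod 2 = 1" "(2 :: nat) div 2 = 1" "(3 :: nat) div 2 = 1" by auto
  show "CZ_mat $$ (i, j) = ?R $$ (i, j)" if "i \<in> {0, 1, 2, 3}" "j \<in> {0, 1, 2, 3}" for i j
    using that by (elim insertE emptyE; simp add: kron_index d z m CZ_mat_def mat_of_rows_list_def)
qed auto

lemma qubit_dim: "i \<in> {1..n} \<Longrightarrow> 2 ^ (i - 1) * 2 * 2 ^ (n - i) = (2 :: nat) ^ n"
proof -
  assume "i \<in> {1..n}"
  then have "n = (i - 1) + 1 + (n - i)" by auto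
  then have "(2 :: nat) ^ n = 2 ^ ((i - 1) + 1 + (n - i))" by simp
  then show ?thesis by (simp only: power_add power_one_right)
qed

lemma on_qubit_closed [simp, intro]:
  assumes "U \<in> carrier_mat 2 2" "i \<in> {1..n}"
  shows "on_qubit n i U \<in> carrier_mat (2 ^ n) (2 ^ n)"
proof -
  note qubit_dim[OF assms(2)]
  then show ?thesis using kron_closed[OF kron_closed[OF one_carrier_mat assms(1)] one_carrier_mat]
    unfolding on_qubit_def by metis
qed

lemma on_qubit_mult:
  assumes "U \<in> carrier_mat 2 2" "V \<in> carrier_mat 2 2"
  shows "on_qubit n i U * on_qubit n i V = on_qubit n i (U * V)"
proof -
  note k = kron_closed[OF one_carrier_mat[of "2 ^ (i - 1)"] assms(1)] kron_closed[OF one_carrier_mat[of "2 ^ (i - 1)"] assms(2)]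
  show ?thesis unfolding on_qubit_def
    using kron_mult[OF k one_carrier_mat one_carrier_mat] kron_mult[OF one_carrier_mat one_carrier_mat assms]
    by simp
qed

lemma on_qubit_one:
  assumes "i \<in> {1..n}"
  shows "on_qubit n i (1\<^sub>m 2) = 1\<^sub>m (2 ^ n)"
proof -
  note qubit_dim[OF assms]
  then show ?thesis unfolding on_qubit_def by (simp only: kron_one)
qed

lemma on_qubit_smult: "on_qubit n i (c \<cdot>\<^sub>m U) = c \<cdot>\<^sub>m on_qubit n i U"
  by (simp add: on_qubit_def kron_smult)

lemma on_qubit_add:
  assumes "U \<in> carrier_mat 2 2" "V \<in> carrier_mat 2 2"
  shows "on_qubit n i (U + V) = on_qubit n i U + on_qubit n i V"
  unfolding on_qubit_def kron_add(2)[OF assms]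
  by (rule kron_add(1)) (use assms in auto)

lemma on_qubit_adjoint: "mat_adjoint (on_qubit n i U) = on_qubit n i (mat_adjoint U)"
  by (simp add: on_qubit_def mat_adjoint_kron mat_adjoint_one)

lemma on_qubit_left:
  assumes "1 \<le> i" "i < j" "j \<le> n"
  shows "on_qubit n i U = kron (kron (on_qubit (j - 1) i U) (1\<^sub>m 2)) (1\<^sub>m (2 ^ (n - j)))"
proof -
  have "(2 :: nat) ^ (j - 1 - i) * (2 * 2 ^ (n - j)) = 2 ^ (n - i)"
  proof -
    have "n - i = (j - 1 - i) + (1 + (n - j))" using assms by auto
    then have "(2 :: nat) ^ (n - i) = 2 ^ ((j - 1 - i) + (1 + (n - j)))" by simp
    then show ?thesis by (simp only: power_add power_one_right)
  qed
  then show ?thesis unfolding on_qubit_def by (simp add: kron_assoc kron_one mult.assoc)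
qed

lemma on_qubit_commute_less:
  assumes "U \<in> carrier_mat 2 2" "V \<in> carrier_mat 2 2" "1 \<le> i" "i < j" "j \<le> n"
  shows "on_qubit n i U * on_qubit n j V = on_qubit n j V * on_qubit n i U"
proof -
  define A C where "A = on_qubit (j - 1) i U" and "C = (1\<^sub>m (2 ^ (n - j)) :: complex mat)"
  have A: "A \<in> carrier_mat (2 ^ (j - 1)) (2 ^ (j - 1))" unfolding A_def
    using assms by (intro on_qubit_closed) auto
  have C: "C \<in> carrier_mat (2 ^ (n - j)) (2 ^ (n - j))" by (simp add: C_def)
  have U: "on_qubit n i U = kron (kron A (1\<^sub>m 2)) C"
    unfolding A_def C_def using assms by (intro on_qubit_left) auto
  have V: "on_qubit n j V = kron (kron (1\<^sub>m (2 ^ (j - 1))) V) C"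
    by (simp add: on_qubit_def C_def)
  note k = kron_closed[OF A one_carrier_mat[of 2]] kron_closed[OF one_carrier_mat[of "2 ^ (j - 1)"] assms(2)]
  have "on_qubit n i U * on_qubit n j V = kron (kron A V) C"
    unfolding U V kron_mult[OF k C C] kron_mult[OF A one_carrier_mat one_carrier_mat assms(2)]
    using A assms(2) by (simp add: C_def)
  moreover have "on_qubit n j V * on_qubit n i U = kron (kron A V) C"
    unfolding U V kron_mult[OF k(2,1) C C] kron_mult[OF one_carrier_mat A assms(2) one_carrier_mat]
    using A assms(2) by (simp add: C_def)
  ultimately show ?thesis by simp
qed

lemma on_qubit_commute:
  assumes "U \<in> carrier_mat 2 2" "V \<in> carrier_mat 2 2" "i \<in> {1..n}" "j \<in> {1..n}" "i \<noteq> j"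
  shows "on_qubit n i U * on_qubit n j V = on_qubit n j V * on_qubit n i U"
  using on_qubit_commute_less[OF assms(1,2), of i j n] on_qubit_commute_less[OF assms(2,1), of j i n] assms(3-5)
  by (cases "i < j") auto

lemma on_adjacent_kron:
  assumes "A \<in> carrier_mat 2 2" "B \<in> carrier_mat 2 2" "1 \<le> i" "i < n"
  shows "on_adjacent_qubits n i (kron A B) = on_qubit n i A * on_qubit n (i + 1) B"
proof -
  define C where "C = (1\<^sub>m (2 ^ (n - i - 1)) :: complex mat)"
  define E where "E = (1\<^sub>m (2 ^ (i - 1)) :: complex mat)"
  have C: "C \<in> carrier_mat (2 ^ (n - i - 1)) (2 ^ (n - i - 1))" by (simp add: C_def)
  have E: "E \<in> carrier_mat (2 ^ (i - 1)) (2 ^ (i - 1))" by (simp add: E_def)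
  have "n - i = Suc (n - i - 1)" "i = Suc (i - 1)" using assms by auto
  then have p: "2 * 2 ^ (n - i - 1) = (2 :: nat) ^ (n - i)" "2 ^ (i - 1) * 2 = (2 :: nat) ^ i"
    by (metis power_Suc power_Suc2)+
  have "kron (1\<^sub>m 2) C = 1\<^sub>m (2 ^ (n - i))" by (simp only: C_def kron_one p)
  then have A: "on_qubit n i A = kron (kron E (kron A (1\<^sub>m 2))) C"
    unfolding on_qubit_def E_def[symmetric] by (simp add: kron_assoc)
  have "kron E (1\<^sub>m 2) = 1\<^sub>m (2 ^ i)" by (simp only: E_def kron_one p)
  then have B: "on_qubit n (i + 1) B = kron (kron E (kron (1\<^sub>m 2) B)) C"
    unfolding on_qubit_def C_def by (simp flip: kron_assoc)
  note k = kron_closed[OF assms(1) one_carrier_mat[of 2]] kron_closed[OF one_carrier_mat[of 2] assms(2)]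
  show ?thesis
    unfolding A B kron_mult[OF kron_closed[OF E k(1)] kron_closed[OF E k(2)] C C] kron_mult[OF E E k]
      kron_mult[OF assms(1) one_carrier_mat one_carrier_mat assms(2)]
    using assms(1,2) by (simp add: on_adjacent_qubits_def C_def E_def)
qed

lemma on_adjacent_add:
  assumes "U \<in> carrier_mat 4 4" "V \<in> carrier_mat 4 4"
  shows "on_adjacent_qubits n i (U + V) = on_adjacent_qubits n i U + on_adjacent_qubits n i V"
  unfolding on_adjacent_qubits_def kron_add(2)[OF assms]
  by (rule kron_add(1)) (use assms in auto)

lemma on_adjacent_smult: "on_adjacent_qubits n i (c \<cdot>\<^sub>m U) = c \<cdot>\<^sub>m on_adjacent_qubits n i U"
  by (simp add: on_adjacent_qubits_def kron_smult)

text \<open>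
  Bit \<open>n - i\<close> of an index belongs to qubit \<open>i\<close>: the operator acts on that bit, and all
  other bits of row and column must agree.
\<close>

lemma on_qubit_index:
  assumes "U \<in> carrier_mat 2 2" "i \<in> {1..n}" "r < 2 ^ n" "c < 2 ^ n" "m = 2 ^ (n - i)"
  shows "on_qubit n i U $$ (r, c) =
    (if r div m div 2 = c div m div 2 \<and> r mod m = c mod m then U $$ (r div m mod 2, c div m mod 2) else 0)"
proof -
  have n: "2 ^ (i - 1) * 2 * m = (2 :: nat) ^ n"
    using qubit_dim[OF assms(2)] assms(5) by simp
  have b: "r < 2 ^ (i - 1) * 2 * m" "c < 2 ^ (i - 1) * 2 * m" using assms n by auto
  note d = div_lt[OF b(1)] div_lt[OF b(2)]
  show ?thesis
    using assms(1) b d div_lt[OF d(1)] div_lt[OF d(2)] mod_lt[OF b(1)] mod_lt[OF b(2)]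
    unfolding on_qubit_def assms(5)[symmetric] by (auto simp: kron_index)
qed

lemma differing_bit:
  assumes "r \<noteq> c" "r < 2 ^ n" "c < (2 :: nat) ^ n"
  obtains p where "p < n" "r div 2 ^ p mod 2 \<noteq> c div 2 ^ p mod 2"
proof -
  obtain p where p: "bit r p \<noteq> bit c p" using assms(1) bit_eq_iff by blast
  have "p < n"
  proof (rule ccontr)
    assume "\<not> p < n"
    then have "(2 :: nat) ^ n \<le> 2 ^ p" by simp
    then have "r < 2 ^ p" "c < 2 ^ p" using assms(2,3) by linarith+
    then have "r div 2 ^ p = 0" "c div 2 ^ p = 0" by auto
    then show False using p by (simp add: bit_iff_odd)
  qed
  moreover have "r div 2 ^ p mod 2 \<noteq> c div 2 ^ p mod 2" using p by (auto simp: bit_iff_odd odd_iff_mod_2_eq_one)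
  ultimately show ?thesis using that by blast
qed

lemma XZ_index:
  "Z_mat $$ (0, 0) = 1" "Z_mat $$ (0, Suc 0) = 0" "Z_mat $$ (Suc 0, 0) = 0" "Z_mat $$ (Suc 0, Suc 0) = -1"
  "X_mat $$ (0, 0) = 0" "X_mat $$ (0, Suc 0) = 1" "X_mat $$ (Suc 0, 0) = 1" "X_mat $$ (Suc 0, Suc 0) = 0"
  by (auto simp: X_mat_def Z_mat_def mat_of_rows_list_def)

text \<open>
  Commuting with the diagonal matrices \<open>Z\<^sub>i\<close> kills every entry whose row and column differ in some bit.
  Commuting with \<open>X\<^sub>i\<close>, which flips a bit, equates diagonal entries; clearing the bits of an index
  one by one leads to the index \<open>0\<close>.
\<close>

lemma commutant_scalar:
  assumes A: "A \<in> carrier_mat (2 ^ n) (2 ^ n)"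
    and X: "\<And>i. i \<in> {1..n} \<Longrightarrow> A * on_qubit n i X_mat = on_qubit n i X_mat * A"
    and Z: "\<And>i. i \<in> {1..n} \<Longrightarrow> A * on_qubit n i Z_mat = on_qubit n i Z_mat * A"
  shows "A = (A $$ (0, 0)) \<cdot>\<^sub>m 1\<^sub>m (2 ^ n)"
proof -
  have bit_cases: "(k :: nat) mod 2 = 0 \<or> k mod 2 = Suc 0" for k by auto
  have mult_index: "(B * C) $$ (r, c) = (\<Sum>k = 0..<2 ^ n. B $$ (r, k) * C $$ (k, c))"
    if "B \<in> carrier_mat (2 ^ n) (2 ^ n)" "C \<in> carrier_mat (2 ^ n) (2 ^ n)" "r < 2 ^ n" "c < 2 ^ n" for B C and r c :: nat
    using that by (simp add: scalar_prod_def)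
  have off: "A $$ (r, c) = 0" if rc: "r < 2 ^ n" "c < 2 ^ n" "r \<noteq> c" for r c
  proof -
    obtain p where p: "p < n" "r div 2 ^ p mod 2 \<noteq> c div 2 ^ p mod 2" using differing_bit rc by blast
    define i m where "i = n - p" and "m = (2 :: nat) ^ p"
    have i: "i \<in> {1..n}" "m = 2 ^ (n - i)" using p by (auto simp: i_def m_def)
    have Zc: "on_qubit n i Z_mat \<in> carrier_mat (2 ^ n) (2 ^ n)" using i by auto
    define s where "s k = (if k div m mod 2 = 0 then 1 else -1 :: complex)" for k
    have Zi: "on_qubit n i Z_mat $$ (k, l) = (if k = l then s k else 0)" if "k < 2 ^ n" "l < 2 ^ n" for k l
    proof -
      have "k = l" if "k div m div 2 = l div m div 2" "k mod m = l mod m" "k div m mod 2 = l div m mod 2"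
        using that by (metis div_mult_mod_eq)
      then show ?thesis
        using on_qubit_index[OF XZ_closed(2) i(1) that i(2)] bit_cases[of "k div m"] bit_cases[of "l div m"]
        by (auto simp: XZ_index s_def)
    qed
    have "A $$ (r, c) * s c = (A * on_qubit n i Z_mat) $$ (r, c)"
      using mult_index[OF A Zc rc(1,2)] rc by (simp add: Zi if_distrib sum.delta cong: if_cong)
    also have "\<dots> = (on_qubit n i Z_mat * A) $$ (r, c)" using Z[OF i(1)] by simp
    also have "\<dots> = s r * A $$ (r, c)"
      using mult_index[OF Zc A rc(1,2)] rc by (simp add: Zi if_distrib if_distribR sum.delta' cong: if_cong)
    finally show ?thesis using p by (auto simp: s_def m_def split: if_splits)
  qed
  have diag: "A $$ (r, r) = A $$ (0, 0)" if "r < 2 ^ n" for r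
    using that
  proof (induction r rule: less_induct)
    case (less r)
    show ?case
    proof (cases "r = 0")
      case False
      obtain p where p: "p < n" "r div 2 ^ p mod 2 \<noteq> 0 div 2 ^ p mod 2"
        using differing_bit[OF False less.prems] by auto
      define i m where "i = n - p" and "m = (2 :: nat) ^ p"
      have i: "i \<in> {1..n}" "m = 2 ^ (n - i)" using p by (auto simp: i_def m_def)
      have m: "m > 0" by (simp add: m_def)
      have Xc: "on_qubit n i X_mat \<in> carrier_mat (2 ^ n) (2 ^ n)" using i by auto
      have rbit: "r div m mod 2 = Suc 0" using p(2) bit_cases[of "r div m"] by (auto simp: m_def)
      define c where "c = r - m"
      have "m \<le> r" using rbit by (metis div_less mod_less not_le_imp_less numeral_2_eq_2 old.nat.distinct(1) zero_less_Suc)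
      then have r: "r = c + m" by (simp add: c_def)
      have c: "c < 2 ^ n" "c < r" "r div m = Suc (c div m)" "c mod m = r mod m"
        using less.prems r m by auto
      then have cbit: "c div m mod 2 = 0" using rbit by (auto simp: mod_Suc split: if_splits)
      have half: "r div m div 2 = c div m div 2" using cbit rbit unfolding c(3) by (simp add: div_Suc)
      have col: "on_qubit n i X_mat $$ (k, c) = (if k = r then 1 else 0)" if k: "k < 2 ^ n" for k
      proof -
        have "k = r" if "k div m div 2 = c div m div 2" "k mod m = c mod m" "k div m mod 2 = Suc 0"
          using that half rbit c(4) by (metis div_mult_mod_eq)
        then show ?thesis
          using on_qubit_index[OF XZ_closed(1) i(1) k c(1) i(2)] bit_cases[of "k div m"] cbit half rbit c(4)
          by (auto simp: XZ_index)
      qed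
      have row: "on_qubit n i X_mat $$ (r, k) = (if k = c then 1 else 0)" if k: "k < 2 ^ n" for k
      proof -
        have "k = c" if "r div m div 2 = k div m div 2" "r mod m = k mod m" "k div m mod 2 = 0"
          using that half cbit c(4) by (metis div_mult_mod_eq)
        then show ?thesis
          using on_qubit_index[OF XZ_closed(1) i(1) less.prems k i(2)] bit_cases[of "k div m"] cbit half rbit c(4)
          by (auto simp: XZ_index)
      qed
      have "A $$ (r, r) = (A * on_qubit n i X_mat) $$ (r, c)"
        using mult_index[OF A Xc less.prems c(1)] less.prems by (simp add: col if_distrib sum.delta cong: if_cong)
      also have "\<dots> = (on_qubit n i X_mat * A) $$ (r, c)" using X[OF i(1)] by simp
      also have "\<dots> = A $$ (c, c)"
        using mult_index[OF Xc A less.prems c(1)] c(1) by (simp add: row if_distrib if_distribR sum.delta cong: if_cong)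
      finally show ?thesis using less.IH[OF c(2,1)] by simp
    qed simp
  qed
  show ?thesis
  proof (rule eq_matI)
    fix r c assume "r < dim_row ((A $$ (0, 0)) \<cdot>\<^sub>m (1\<^sub>m (2 ^ n) :: complex mat))"
      "c < dim_col ((A $$ (0, 0)) \<cdot>\<^sub>m (1\<^sub>m (2 ^ n) :: complex mat))"
    then have rc: "r < 2 ^ n" "c < 2 ^ n" by auto
    show "A $$ (r, c) = ((A $$ (0, 0)) \<cdot>\<^sub>m 1\<^sub>m (2 ^ n)) $$ (r, c)"
      using off[OF rc] diag[OF rc(1)] rc by (cases "r = c") simp_all
  qed (use A in auto)
qed

lemma qubit_pauli_system:
  assumes "\<zeta> * \<zeta> = -1"
  shows "pauli_system (2 ^ n) n \<zeta> (\<lambda>i. on_qubit n i X_mat) (\<lambda>i. on_qubit n i Z_mat)"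
proof
  show "twist (if i = j then -1 else 1) (on_qubit n i X_mat) (on_qubit n j Z_mat)"
    if "i \<in> {1..n}" "j \<in> {1..n}" for i j
    using that on_qubit_commute[OF XZ_closed that] on_qubit_mult[of X_mat Z_mat n i] on_qubit_mult[of Z_mat X_mat n i]
    by (auto simp: twist_def XZ_relations on_qubit_smult)
  show "twist 1 (on_qubit n i X_mat) (on_qubit n j X_mat)" if "i \<in> {1..n}" "j \<in> {1..n}" for i j
    using on_qubit_commute[OF XZ_closed(1,1) that] by (cases "i = j") (auto simp: twist_def)
  show "twist 1 (on_qubit n i Z_mat) (on_qubit n j Z_mat)" if "i \<in> {1..n}" "j \<in> {1..n}" for i j
    using on_qubit_commute[OF XZ_closed(2,2) that] by (cases "i = j") (auto simp: twist_def)
  show "\<exists>c. A = c \<cdot>\<^sub>m 1\<^sub>m (2 ^ n)"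
    if "A \<in> carrier_mat (2 ^ n) (2 ^ n)" "\<And>i. i \<in> {1..n} \<Longrightarrow> twist 1 A (on_qubit n i X_mat)"
      "\<And>i. i \<in> {1..n} \<Longrightarrow> twist 1 A (on_qubit n i Z_mat)" for A
    using commutant_scalar[OF that(1)] that(2,3) by (auto simp: twist_def)
qed (use assms in \<open>auto simp: on_qubit_mult XZ_relations on_qubit_one\<close>)

section \<open>Scalars in the Clifford group\<close>

text \<open>
  Irrationality of \<open>sqrt 2\<close>, by descent.
\<close>

lemma square_eq_double_square: "s * s = 2 * (t * t) \<Longrightarrow> t = 0" for s t :: int
proof (induction "nat \<bar>t\<bar>" arbitrary: s t rule: less_induct)
  case less
  show ?case
  proof (rule ccontr)
    assume t: "t \<noteq> 0"
    have "even (s * s)" using less.prems by simp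
    then obtain u where u: "s = 2 * u" by (auto elim: evenE)
    then have tt: "t * t = 2 * (u * u)" using less.prems by simp
    then have "even (t * t)" by simp
    then obtain v where v: "t = 2 * v" by (auto elim: evenE)
    then have "u * u = 2 * (v * v)" using tt by simp
    moreover have "nat \<bar>v\<bar> < nat \<bar>t\<bar>" using v t by auto
    ultimately have "v = 0" using less.hyps by blast
    then show False using v t by simp
  qed
qed

locale eighth_root =
  fixes \<omega> :: complex
  assumes primitive: "primitive_root_of_unity 8 \<omega>"
begin

lemma omega_4: "\<omega> ^ 4 = -1"
proof -
  have "\<omega> ^ 8 = 1" "\<omega> ^ 4 \<noteq> 1" using primitive by (auto simp: primitive_root_of_unity_def)
  moreover have "\<omega> ^ 8 = \<omega> ^ 4 * \<omega> ^ 4" by (simp flip: power_add)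
  ultimately show ?thesis using square_eq_1_iff by metis
qed

lemma omega_powers: "\<omega> ^ 5 = - \<omega>" "\<omega> ^ 6 = - (\<omega> ^ 2)" "\<omega> ^ 7 = - (\<omega> ^ 3)" "\<omega> ^ 9 = \<omega>"
proof -
  have "\<omega> ^ 5 = \<omega> ^ 4 * \<omega>" "\<omega> ^ 6 = \<omega> ^ 4 * \<omega> ^ 2" "\<omega> ^ 7 = \<omega> ^ 4 * \<omega> ^ 3" "\<omega> ^ 9 = \<omega> ^ 4 * \<omega> ^ 4 * \<omega>"
    by (simp_all flip: power_add power_Suc2)
  then show "\<omega> ^ 5 = - \<omega>" "\<omega> ^ 6 = - (\<omega> ^ 2)" "\<omega> ^ 7 = - (\<omega> ^ 3)" "\<omega> ^ 9 = \<omega>"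
    by (simp_all add: omega_4)
qed

text \<open>
  Identities modulo the cyclotomic polynomial are proved by exhibiting the cofactor \<open>Q\<close>, so that the
  premise is a polynomial identity.
\<close>

lemma modulo_cyclotomic: "A = B + (\<omega> ^ 4 + 1) * Q \<Longrightarrow> A = B"
  by (simp add: omega_4)

lemmas power_unfold = power2_eq_square power3_eq_cube power4_eq_xxxx

lemma omega_8: "\<omega> ^ 8 = 1"
  using primitive by (simp add: primitive_root_of_unity_def)

lemma omega_nonzero [simp]: "\<omega> \<noteq> 0"
  using omega_4 by auto

lemma omega_norm: "\<omega> * cnj \<omega> = 1"
proof -
  have "norm \<omega> ^ 8 = 1" using omega_8 by (metis norm_one norm_power)
  then have "norm \<omega> = 1" using power_eq_1_iff[of "norm \<omega>" 8] by simp
  then show ?thesis using complex_norm_square[of \<omega>] by simp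
qed

lemma cnj_omega: "cnj \<omega> = - (\<omega> ^ 3)"
proof -
  have "\<omega> * cnj \<omega> = \<omega> * (- (\<omega> ^ 3))"
    using omega_norm omega_4 by (simp add: power4_eq_xxxx power3_eq_cube mult.assoc)
  then show ?thesis using omega_nonzero mult_left_cancel by blast
qed

text \<open>Up to sign, \<open>\<theta>\<close> is the square root of \<open>2\<close>.\<close>

definition \<theta> :: complex where
  "\<theta> = \<omega> - \<omega> ^ 3"

lemma theta_square: "\<theta> * \<theta> = 2"
  unfolding \<theta>_def
  by (rule modulo_cyclotomic[of _ _ "\<omega> ^ 2 - 2"]) (simp add: algebra_simps power_unfold)

lemma cnj_theta: "cnj \<theta> = \<theta>"
proof -
  have "(\<omega> ^ 3) ^ 3 = \<omega>" using omega_powers(4) by (simp flip: power_mult)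
  then show ?thesis by (simp add: \<theta>_def cnj_omega)
qed

lemma half_root_theta: "complex_of_real (1 / sqrt 2) = \<theta> / 2 \<or> complex_of_real (1 / sqrt 2) = - \<theta> / 2"
proof -
  have "(complex_of_real (1 / sqrt 2)) ^ 2 = (\<theta> / 2) ^ 2"
    using half_root theta_square by (simp add: power2_eq_square)
  then show ?thesis by (auto simp: power2_eq_iff)
qed

definition cyc :: "int \<Rightarrow> int \<Rightarrow> int \<Rightarrow> int \<Rightarrow> complex" where
  "cyc a b c e = of_int a + of_int b * \<omega> + of_int c * \<omega> ^ 2 + of_int e * \<omega> ^ 3"

lemma cyc_add: "cyc a b c e + cyc a' b' c' e' = cyc (a + a') (b + b') (c + c') (e + e')"
  by (simp add: cyc_def algebra_simps)

lemma cyc_mult: "cyc a b c e * cyc a' b' c' e' =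
  cyc (a * a' - b * e' - c * c' - e * b') (a * b' + b * a' - c * e' - e * c')
      (a * c' + b * b' + c * a' - e * e') (a * e' + b * c' + c * b' + e * a')"
  unfolding cyc_def
  by (rule modulo_cyclotomic[of _ _ "of_int b * of_int e' + of_int c * of_int c' + of_int e * of_int b'
      + (of_int c * of_int e' + of_int e * of_int c') * \<omega> + of_int e * of_int e' * \<omega> ^ 2"])
    (simp add: algebra_simps power_unfold)

lemma cnj_cyc: "cnj (cyc a b c e) = cyc a (- e) (- c) (- b)"
proof -
  have "(\<omega> ^ 3) ^ 2 = - (\<omega> ^ 2)" "(\<omega> ^ 3) ^ 3 = \<omega>"
    using omega_powers(2,4) by (simp_all flip: power_mult)
  then show ?thesis by (simp add: cyc_def cnj_omega)
qed

lemma cyc_norm: "cyc a b c e * cnj (cyc a b c e) =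
  of_int (a * a + b * b + c * c + e * e) + \<theta> * of_int (a * b + b * c + c * e - a * e)"
  unfolding cnj_cyc cyc_mult by (simp add: cyc_def \<theta>_def algebra_simps)

lemma cyc_theta: "\<theta> * cyc a b c e = cyc (b - e) (a + c) (b + e) (c - a)"
  unfolding cyc_def \<theta>_def
  by (rule modulo_cyclotomic[of _ _ "of_int (e - b) - of_int c * \<omega> - of_int e * \<omega> ^ 2"])
    (simp add: algebra_simps power_unfold)

lemma theta_independent:
  assumes "of_int p + \<theta> * of_int q = (of_int s :: complex)"
  shows "q = 0" "p = s"
proof -
  have "\<theta> * of_int q = of_int (s - p)" using assms by (simp add: algebra_simps)
  then have "(\<theta> * \<theta>) * (of_int q * of_int q) = of_int (s - p) * (of_int (s - p) :: complex)"
    by (metis mult.assoc mult.commute)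
  then have "(of_int ((s - p) * (s - p)) :: complex) = of_int (2 * (q * q))"
    unfolding theta_square by simp
  then show "q = 0" using square_eq_double_square of_int_eq_iff by blast
  then show "p = s" using assms by simp
qed

text \<open>
  The prime \<open>2\<close> is totally ramified in the eighth cyclotomic field. Here this is the parity
  argument that a cyclotomic integer of even norm is divisible by \<open>\<theta>\<close>.
\<close>

lemma cyc_power_of_two:
  "cyc a b c e * cnj (cyc a b c e) = 2 ^ m \<Longrightarrow> \<exists>j. cyc a b c e = \<omega> ^ j * \<theta> ^ m"
proof (induction m arbitrary: a b c e)
  case 0
  then have "of_int (a * a + b * b + c * c + e * e) + \<theta> * of_int (a * b + b * c + c * e - a * e) = (of_int 1 :: complex)"
    by (simp add: cyc_norm)
  then have sq: "a * a + b * b + c * c + e * e = 1" by (rule theta_independent)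
  have bound: "x * x \<le> 1 \<Longrightarrow> x \<in> {-1, 0, 1}" for x :: int
  proof -
    assume "x * x \<le> 1"
    then have "\<bar>x\<bar> * \<bar>x\<bar> \<le> 1" by (simp add: abs_mult_self_eq)
    then have "\<bar>x\<bar> \<le> 1" using mult_mono[of 2 "\<bar>x\<bar>" 2 "\<bar>x\<bar>"] by fastforce
    then show ?thesis by auto
  qed
  have "a * a \<le> 1" "b * b \<le> 1" "c * c \<le> 1" "e * e \<le> 1"
    using sq zero_le_square[of a] zero_le_square[of b] zero_le_square[of c] zero_le_square[of e] by linarith+
  then have "a \<in> {-1, 0, 1}" "b \<in> {-1, 0, 1}" "c \<in> {-1, 0, 1}" "e \<in> {-1, 0, 1}" using bound by blast+
  then have "cyc a b c e \<in> {1, \<omega>, \<omega> ^ 2, \<omega> ^ 3, -1, - \<omega>, - (\<omega> ^ 2), - (\<omega> ^ 3)}"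
    using sq by (elim insertE emptyE) (simp_all add: cyc_def)
  moreover have "-1 = \<omega> ^ 4" "- \<omega> = \<omega> ^ 5" "- (\<omega> ^ 2) = \<omega> ^ 6" "- (\<omega> ^ 3) = \<omega> ^ 7"
    using omega_4 omega_powers by simp_all
  ultimately have "cyc a b c e \<in> {\<omega> ^ 0, \<omega> ^ 1, \<omega> ^ 2, \<omega> ^ 3, \<omega> ^ 4, \<omega> ^ 5, \<omega> ^ 6, \<omega> ^ 7}" by simp
  then have "\<exists>j. cyc a b c e = \<omega> ^ j" by blast
  then show ?case by simp
next
  case (Suc m)
  have "of_int (a * a + b * b + c * c + e * e) + \<theta> * of_int (a * b + b * c + c * e - a * e) = (of_int (2 ^ Suc m) :: complex)"
    using Suc.prems by (simp add: cyc_norm)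
  note norm = theta_independent[OF this]
  have "even (a * a + b * b + c * c + e * e)" unfolding norm(2) by simp
  then have "even (a + c) \<longleftrightarrow> even (b + e)" by simp blast
  moreover have "even (a * b + b * c + c * e - a * e)" unfolding norm(1) by simp
  then have "even (a + c) \<or> even (b + e)" by simp argo
  ultimately have "even (a + c)" "even (b + e)" by auto
  then obtain p q where pq: "a + c = 2 * p" "b + e = 2 * q" by (meson evenE)
  define r s where "r = b - q" and "s = c - p"
  have "p - s = a" "r + q = b" "p + s = c" "q - r = e" using pq by (auto simp: r_def s_def)
  then have div: "cyc a b c e = \<theta> * cyc r p q s" by (simp only: cyc_theta)
  have "cyc a b c e * cnj (cyc a b c e) = (\<theta> * \<theta>) * (cyc r p q s * cnj (cyc r p q s))"
    unfolding div by (simp add: cnj_theta)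
  then have "cyc r p q s * cnj (cyc r p q s) = 2 ^ m" using Suc.prems theta_square by simp
  then obtain j where "cyc r p q s = \<omega> ^ j * \<theta> ^ m" using Suc.IH by blast
  then show ?case using div by (intro exI[of _ j]) simp
qed

text \<open>Entries of Clifford matrices: cyclotomic integers divided by powers of \<open>2\<close>.\<close>

definition dyadic :: "complex set" where
  "dyadic = {z. \<exists>k a b c e. z * 2 ^ k = cyc a b c e}"

lemma cyc_dyadic: "cyc a b c e \<in> dyadic"
proof -
  have "cyc a b c e * 2 ^ 0 = cyc a b c e" by simp
  then show ?thesis unfolding dyadic_def by blast
qed

lemma dyadic_constants: "0 \<in> dyadic" "1 \<in> dyadic" "\<omega> \<in> dyadic" "- 1 \<in> dyadic" "\<omega> ^ 2 \<in> dyadic"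
  using cyc_dyadic[of 0 0 0 0] cyc_dyadic[of 1 0 0 0] cyc_dyadic[of 0 1 0 0] cyc_dyadic[of "-1" 0 0 0]
    cyc_dyadic[of 0 0 1 0] by (auto simp: cyc_def)

lemma dyadic_mult: "z \<in> dyadic \<Longrightarrow> w \<in> dyadic \<Longrightarrow> z * w \<in> dyadic"
proof -
  assume "z \<in> dyadic" "w \<in> dyadic"
  then obtain k a b c e k' a' b' c' e' where "z * 2 ^ k = cyc a b c e" "w * 2 ^ k' = cyc a' b' c' e'"
    by (auto simp: dyadic_def)
  then have "(z * w) * 2 ^ (k + k') = cyc a b c e * cyc a' b' c' e'" by (metis mult.commute mult.left_commute power_add)
  then show ?thesis unfolding cyc_mult dyadic_def by blast
qed

lemma dyadic_add: "z \<in> dyadic \<Longrightarrow> w \<in> dyadic \<Longrightarrow> z + w \<in> dyadic"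
proof -
  assume "z \<in> dyadic" "w \<in> dyadic"
  then obtain k a b c e k' a' b' c' e' where zw: "z * 2 ^ k = cyc a b c e" "w * 2 ^ k' = cyc a' b' c' e'"
    by (auto simp: dyadic_def)
  have pow: "cyc (2 ^ l) 0 0 0 = 2 ^ l" for l by (simp add: cyc_def)
  have "(z + w) * 2 ^ (k + k') = (z * 2 ^ k) * 2 ^ k' + (w * 2 ^ k') * 2 ^ k"
    by (simp add: power_add algebra_simps)
  also have "\<dots> = cyc a b c e * cyc (2 ^ k') 0 0 0 + cyc a' b' c' e' * cyc (2 ^ k) 0 0 0"
    unfolding zw pow ..
  finally show ?thesis unfolding cyc_mult cyc_add dyadic_def by blast
qed

lemma dyadic_sum: "(\<And>k. k \<in> A \<Longrightarrow> f k \<in> dyadic) \<Longrightarrow> sum f A \<in> dyadic"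
  by (induction A rule: infinite_finite_induct) (auto intro: dyadic_add dyadic_constants)

lemma dyadic_cnj: "z \<in> dyadic \<Longrightarrow> cnj z \<in> dyadic"
proof -
  assume "z \<in> dyadic"
  then obtain k a b c e where "z * 2 ^ k = cyc a b c e" by (auto simp: dyadic_def)
  then have "cnj z * 2 ^ k = cnj (cyc a b c e)" by (metis complex_cnj_mult complex_cnj_numeral complex_cnj_power)
  then show ?thesis unfolding cnj_cyc dyadic_def by blast
qed

lemma dyadic_half_root: "complex_of_real (1 / sqrt 2) \<in> dyadic"
proof -
  have "\<theta> = cyc 0 1 0 (-1)" "- \<theta> = cyc 0 (-1) 0 1" by (simp_all add: cyc_def \<theta>_def)
  then have "\<theta> / 2 * 2 ^ 1 = cyc 0 1 0 (-1)" "- \<theta> / 2 * 2 ^ 1 = cyc 0 (-1) 0 1" by simp_all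
  then have "\<theta> / 2 \<in> dyadic" "- \<theta> / 2 \<in> dyadic" unfolding dyadic_def by blast+
  then show ?thesis using half_root_theta by metis
qed

text \<open>
  After clearing denominators, \<open>c\<close> becomes a cyclotomic integer whose norm is a power of \<open>2\<close>, hence a
  power of \<open>\<omega>\<close> times a power of \<open>\<theta>\<close>; comparing with the denominator cancels \<open>\<theta>\<close>.
\<close>

lemma dyadic_unit:
  assumes "c \<in> dyadic" "c * cnj c = 1"
  obtains j where "c = \<omega> ^ j"
proof -
  obtain k a b d e where k: "c * 2 ^ k = cyc a b d e" using assms by (auto simp: dyadic_def)
  have "cyc a b d e * cnj (cyc a b d e) = (c * cnj c) * (2 ^ k * 2 ^ k)" unfolding k[symmetric] by (simp add: mult_ac)
  then have "cyc a b d e * cnj (cyc a b d e) = 2 ^ (2 * k)" using assms(2) by (simp add: mult_2 power_add)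
  then obtain j where "cyc a b d e = \<omega> ^ j * \<theta> ^ (2 * k)" using cyc_power_of_two by blast
  also have "\<theta> ^ (2 * k) = 2 ^ k" using theta_square by (simp add: power_mult power2_eq_square)
  finally have "c = \<omega> ^ j" using k by simp
  then show ?thesis by (rule that)
qed

lemma eighth_roots:
  assumes "c ^ 8 = 1"
  obtains j where "c = \<omega> ^ j"
proof -
  have sq: "(c ^ 4) ^ 2 = c ^ 8" "(c ^ 2) ^ 2 = c ^ 4" "(\<omega> ^ 2) ^ 2 = \<omega> ^ 4" "(\<omega> ^ 3) ^ 2 = \<omega> ^ 6"
    by (simp_all flip: power_mult)
  have "c ^ 4 = 1 \<or> c ^ 4 = -1" using sq(1) assms power2_eq_iff[of "c ^ 4" 1] by simp
  then have "(c ^ 2) ^ 2 = 1 ^ 2 \<or> (c ^ 2) ^ 2 = (\<omega> ^ 2) ^ 2" unfolding sq omega_4 by simp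
  then have "c ^ 2 = 1 \<or> c ^ 2 = -1 \<or> c ^ 2 = \<omega> ^ 2 \<or> c ^ 2 = - (\<omega> ^ 2)"
    unfolding power2_eq_iff[of "c ^ 2"] by blast
  then consider "c ^ 2 = 1 ^ 2" | "c ^ 2 = (\<omega> ^ 2) ^ 2" | "c ^ 2 = \<omega> ^ 2" | "c ^ 2 = (\<omega> ^ 3) ^ 2"
    unfolding sq omega_4 omega_powers by fastforce
  then have "c \<in> {\<omega> ^ 0, \<omega> ^ 4, \<omega> ^ 2, \<omega> ^ 6, \<omega> ^ 1, \<omega> ^ 5, \<omega> ^ 3, \<omega> ^ 7}"
    unfolding power2_eq_iff[of c] using omega_4 omega_powers by cases auto
  then show ?thesis using that by blast
qed

definition dyadic_mat :: "complex mat \<Rightarrow> bool" where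
  "dyadic_mat A \<longleftrightarrow> (\<forall>i < dim_row A. \<forall>j < dim_col A. A $$ (i, j) \<in> dyadic)"

lemma dyadic_mat_mult: "dyadic_mat A \<Longrightarrow> dyadic_mat B \<Longrightarrow> dim_col A = dim_row B \<Longrightarrow> dyadic_mat (A * B)"
  by (auto simp: dyadic_mat_def scalar_prod_def intro!: dyadic_sum dyadic_mult)

lemma dyadic_mat_kron: "dyadic_mat A \<Longrightarrow> dyadic_mat B \<Longrightarrow> dyadic_mat (kron A B)"
  by (auto simp: dyadic_mat_def kron_index div_lt mod_lt intro!: dyadic_mult)

lemma dyadic_mat_adjoint: "dyadic_mat A \<Longrightarrow> dyadic_mat (mat_adjoint A)"
  by (auto simp: dyadic_mat_def intro: dyadic_cnj)

lemma dyadic_mat_smult: "c \<in> dyadic \<Longrightarrow> dyadic_mat A \<Longrightarrow> dyadic_mat (c \<cdot>\<^sub>m A)"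
  by (auto simp: dyadic_mat_def intro: dyadic_mult)

lemma dyadic_mat_one: "dyadic_mat (1\<^sub>m k)"
  by (auto simp: dyadic_mat_def dyadic_constants)

lemma dyadic_mat_of_rows_list:
  assumes "\<And>r c. r \<in> set rs \<Longrightarrow> c \<in> set r \<Longrightarrow> c \<in> dyadic" "\<And>r. r \<in> set rs \<Longrightarrow> length r = k"
  shows "dyadic_mat (mat_of_rows_list k rs)"
  unfolding dyadic_mat_def mat_of_rows_list_def
  by (auto intro!: assms(1)[OF nth_mem nth_mem] simp: assms(2))

lemma dyadic_mat_gates: "dyadic_mat H_mat" "dyadic_mat (S_mat \<omega>)" "dyadic_mat CZ_mat"
  unfolding H_mat_def S_mat_def CZ_mat_def
  using dyadic_constants dyadic_half_root
  by (auto intro!: dyadic_mat_smult dyadic_mat_of_rows_list simp del: of_real_divide)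

end

section \<open>The unitary group and the Clifford group\<close>

lemma group_unitary: "Group.group (unitary_group k)"
proof (rule groupI)
  interpret square_matrices k .
  fix A B assume "A \<in> carrier (unitary_group k)" "B \<in> carrier (unitary_group k)"
  then have AB: "A \<in> carrier_mat k k" "B \<in> carrier_mat k k" "mat_adjoint A * A = 1\<^sub>m k" "mat_adjoint B * B = 1\<^sub>m k"
    by (auto simp: unitary_group_def)
  have "mat_adjoint A \<in> carrier_mat k k" "mat_adjoint B \<in> carrier_mat k k" using AB by auto
  then have "mat_adjoint (B * A) * (B * A) = mat_adjoint A * ((mat_adjoint B * B) * A)"
    unfolding mat_adjoint_mult[OF AB(2,1)] using AB(1,2) by (simp add: mat_assoc)
  then show "A \<otimes>\<^bsub>unitary_group k\<^esub> B \<in> carrier (unitary_group k)"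
    using AB by (simp add: unitary_group_def mat_one_left)
next
  fix A assume "A \<in> carrier (unitary_group k)"
  then have A: "A \<in> carrier_mat k k" "mat_adjoint A * A = 1\<^sub>m k" by (auto simp: unitary_group_def)
  have AA: "A * mat_adjoint A = 1\<^sub>m k" using mat_mult_left_right_inverse[OF _ A(1) A(2)] A(1) by simp
  have "mat_adjoint (mat_adjoint A) = A" using A(1) by (intro eq_matI) auto
  then show "\<exists>B \<in> carrier (unitary_group k). B \<otimes>\<^bsub>unitary_group k\<^esub> A = \<one>\<^bsub>unitary_group k\<^esub>"
    using A AA by (intro bexI[of _ "mat_adjoint A"]) (auto simp: unitary_group_def)
qed (auto simp: unitary_group_def mat_adjoint_one assoc_mult_mat[of _ k k _ k _ k])

lemma unitary_inverse:
  assumes "A \<in> carrier (unitary_group k)"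
  shows "inv\<^bsub>unitary_group k\<^esub> A = mat_adjoint A" "A * mat_adjoint A = 1\<^sub>m k"
    "mat_adjoint A \<in> carrier (unitary_group k)"
proof -
  interpret Group.group "unitary_group k" by (rule group_unitary)
  have A: "A \<in> carrier_mat k k" "mat_adjoint A * A = 1\<^sub>m k" using assms by (auto simp: unitary_group_def)
  show AA: "A * mat_adjoint A = 1\<^sub>m k" using mat_mult_left_right_inverse[OF _ A(1) A(2)] A(1) by simp
  have "mat_adjoint (mat_adjoint A) = A" using A(1) by (intro eq_matI) auto
  then show "mat_adjoint A \<in> carrier (unitary_group k)" using A AA by (auto simp: unitary_group_def)
  then show "inv\<^bsub>unitary_group k\<^esub> A = mat_adjoint A"
    using assms AA by (intro inv_equality) (auto simp: unitary_group_def)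
qed

locale clifford_context = eighth_root \<omega> for \<omega> :: complex +
  fixes n :: nat
  assumes two_le_n: "2 \<le> n"
begin

abbreviation C :: "complex mat monoid" where
  "C \<equiv> clifford \<omega> n"

abbreviation xq :: "nat \<Rightarrow> complex mat" where
  "xq i \<equiv> on_qubit n i X_mat"

abbreviation zq :: "nat \<Rightarrow> complex mat" where
  "zq i \<equiv> on_qubit n i Z_mat"

abbreviation hq :: "nat \<Rightarrow> complex mat" where
  "hq i \<equiv> on_qubit n i H_mat"

abbreviation sq :: "nat \<Rightarrow> complex mat" where
  "sq i \<equiv> on_qubit n i (S_mat \<omega>)"

abbreviation czq :: "nat \<Rightarrow> complex mat" where
  "czq i \<equiv> on_adjacent_qubits n i CZ_mat"

definition half :: complex where
  "half = complex_of_real (1 / sqrt 2)"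

lemma half_half: "half * half = 1 / 2" "half * (half * t) = t / 2"
proof -
  show "half * half = 1 / 2" unfolding half_def by (rule half_root)
  then show "half * (half * t) = t / 2" by (simp flip: mult.assoc)
qed

lemma zeta_zeta: "\<omega>\<^sup>2 * \<omega>\<^sup>2 = -1"
  using omega_4 by (simp flip: power_add)

sublocale P: pauli_system "2 ^ n" n "\<omega>\<^sup>2" xq zq
  by (rule qubit_pauli_system) (rule zeta_zeta)

lemma qubits_closed [simp]:
  "i \<in> {1..n} \<Longrightarrow> hq i \<in> P.Mat" "i \<in> {1..n} \<Longrightarrow> sq i \<in> P.Mat"
  by auto

lemma hq_sum: "i \<in> {1..n} \<Longrightarrow> hq i = half \<cdot>\<^sub>m (xq i + zq i)"
  unfolding H_XZ half_def by (simp only: on_qubit_smult on_qubit_add[OF XZ_closed])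

lemma zx_sign: "i \<in> {1..n} \<Longrightarrow> xq i * zq i = (-1) \<cdot>\<^sub>m (zq i * xq i)"
  using P.twist_xz[of i i] by (simp add: twist_def)

lemma hq_square: "i \<in> {1..n} \<Longrightarrow> hq i * hq i = 1\<^sub>m (2 ^ n)"
proof -
  assume i: "i \<in> {1..n}"
  have m: "xq i \<in> P.Mat" "zq i \<in> P.Mat" using i by auto
  show ?thesis unfolding hq_sum[OF i] using m
    by (simp add: P.mat_expand P.x_square[OF i] P.z_square[OF i] zx_sign[OF i] half_half)
      (intro eq_matI, auto)
qed

lemma hq_quarter_turn: "i \<in> {1..n} \<Longrightarrow> hq i = xq i * quarter_turn (xq i * zq i)"
proof -
  assume i: "i \<in> {1..n}"
  have m: "xq i \<in> P.Mat" "zq i \<in> P.Mat" using i by auto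
  have "xq i * (xq i * zq i) = zq i"
    using m P.x_square[OF i] P.mat_assoc[of "xq i" "xq i" "zq i"] by (simp add: P.mat_one_left)
  then show ?thesis unfolding hq_sum[OF i] using m
    by (simp add: P.quarter_turn_alt half_def P.mat_expand)
qed

lemma hq_zq: "i \<in> {1..n} \<Longrightarrow> hq i * zq i = xq i * hq i"
proof -
  assume i: "i \<in> {1..n}"
  have m: "xq i \<in> P.Mat" "zq i \<in> P.Mat" using i by auto
  show ?thesis unfolding hq_sum[OF i] using m
    by (simp add: P.mat_expand P.x_square[OF i] P.z_square[OF i] comm_add_mat[of _ "2 ^ n" "2 ^ n"])
qed

lemma sq_quarter_turn:
  assumes i: "i \<in> {1..n}"
  shows "sq i = ((1 + \<omega>\<^sup>2) * half) \<cdot>\<^sub>m quarter_turn ((- (\<omega>\<^sup>2)) \<cdot>\<^sub>m zq i)"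
proof -
  have m: "zq i \<in> P.Mat" using i by auto
  have "sq i = (1 / 2) \<cdot>\<^sub>m ((1 + \<omega>\<^sup>2) \<cdot>\<^sub>m 1\<^sub>m (2 ^ n) + (1 - \<omega>\<^sup>2) \<cdot>\<^sub>m zq i)"
    unfolding S_Z using on_qubit_one[OF i] by (simp add: on_qubit_smult on_qubit_add)
  also have "\<dots> = ((1 + \<omega>\<^sup>2) * half * half) \<cdot>\<^sub>m (1\<^sub>m (2 ^ n) + (- (\<omega>\<^sup>2)) \<cdot>\<^sub>m zq i)"
    using m zeta_zeta by (intro eq_matI) (auto simp: half_half mult.assoc algebra_simps)
  finally show ?thesis using m by (simp add: P.quarter_turn_alt half_def P.mat_expand)
qed

lemma sq_square: "sq i * sq i = zq i"
proof -
  have "S_mat \<omega> * S_mat \<omega> = Z_mat"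
    using zeta_zeta
    by (intro eq_mat_2[OF mult_carrier_mat[OF gates_closed(2,2)] XZ_closed(2)])
      (simp_all add: S_mat_def Z_mat_def mat_of_rows_list_def scalar_prod_def numeral_2_eq_2)
  then show ?thesis by (simp add: on_qubit_mult)
qed

lemma czq_control:
  assumes i: "i \<in> {1..<n}"
  shows "czq i = P.control (zq i) (zq (i + 1))"
proof -
  have "i \<in> {1..n}" "i + 1 \<in> {1..n}" using i by auto
  then have m: "zq i \<in> P.Mat" "zq (i + 1) \<in> P.Mat" by auto
  have "on_adjacent_qubits n i (kron A B) = on_qubit n i A * on_qubit n (i + 1) B"
    if "A \<in> carrier_mat 2 2" "B \<in> carrier_mat 2 2" for A B
    using on_adjacent_kron[OF that] i by auto
  then show ?thesis
    unfolding CZ_Z P.control_def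
    using \<open>i \<in> {1..n}\<close> \<open>i + 1 \<in> {1..n}\<close> m on_qubit_one[OF \<open>i \<in> {1..n}\<close>] on_qubit_one[OF \<open>i + 1 \<in> {1..n}\<close>]
    by (simp add: on_adjacent_smult on_adjacent_add P.mat_one_left P.mat_one_right)
qed

lemma scalar_roots:
  "((1 + \<omega>\<^sup>2) * half) ^ 8 = 1" "((1 - \<omega>\<^sup>2) * half) ^ 8 = 1"
proof -
  have 8: "c ^ 8 = ((c * c) * (c * c)) * ((c * c) * (c * c))" for c :: complex
    by (simp add: eval_nat_numeral mult_ac)
  have "((1 + \<omega>\<^sup>2) * half) * ((1 + \<omega>\<^sup>2) * half) = (1 + \<omega>\<^sup>2) * (1 + \<omega>\<^sup>2) * (half * half)"
    "((1 - \<omega>\<^sup>2) * half) * ((1 - \<omega>\<^sup>2) * half) = (1 - \<omega>\<^sup>2) * (1 - \<omega>\<^sup>2) * (half * half)" by (simp_all add: mult_ac)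
  then have sq: "((1 + \<omega>\<^sup>2) * half) * ((1 + \<omega>\<^sup>2) * half) = \<omega>\<^sup>2" "((1 - \<omega>\<^sup>2) * half) * ((1 - \<omega>\<^sup>2) * half) = - (\<omega>\<^sup>2)"
    using zeta_zeta by (simp_all add: half_half algebra_simps)
  show "((1 + \<omega>\<^sup>2) * half) ^ 8 = 1" "((1 - \<omega>\<^sup>2) * half) ^ 8 = 1"
    unfolding 8 sq using zeta_zeta by (simp_all only: minus_mult_minus mult_1 square_eq_1_iff)
qed

subsection \<open>Unitarity of the generators\<close>

definition generators :: "complex mat set" where
  "generators = {\<omega> \<cdot>\<^sub>m 1\<^sub>m (2 ^ n)} \<union> hq ` {1..n} \<union> sq ` {1..n} \<union> czq ` {1..n - 1}"

lemma generator_cases: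
  assumes "A \<in> generators"
  obtains (scalar) "A = \<omega> \<cdot>\<^sub>m 1\<^sub>m (2 ^ n)" | (hadamard) i where "i \<in> {1..n}" "A = hq i"
    | (phase) i where "i \<in> {1..n}" "A = sq i" | (controlled) i where "i \<in> {1..<n}" "A = czq i"
proof -
  have "{1..n - 1} = {1..<n}" using two_le_n by auto
  then show ?thesis using assms that unfolding generators_def by blast
qed

lemma czq_square: "i \<in> {1..<n} \<Longrightarrow> czq i * czq i = 1\<^sub>m (2 ^ n)"
proof -
  assume i: "i \<in> {1..<n}"
  then have i': "i \<in> {1..n}" "i + 1 \<in> {1..n}" by auto
  have m: "zq i \<in> P.Mat" "zq (i + 1) \<in> P.Mat" using i' by auto
  show ?thesis
    unfolding czq_control[OF i]
    by (rule P.control_square[OF m P.z_square[OF i'(1)] P.z_square[OF i'(2)] P.twist_zz[OF i']])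
qed

lemma adjoint_H: "mat_adjoint H_mat = H_mat"
  by (rule eq_mat_2[OF mat_adjoint_closed[OF gates_closed(1)] gates_closed(1)])
    (simp_all add: H_mat_def mat_of_rows_list_def)

lemma adjoint_CZ: "mat_adjoint CZ_mat = CZ_mat"
proof (rule eq_mat_4)
  show "mat_adjoint CZ_mat $$ (i, j) = CZ_mat $$ (i, j)" if "i \<in> {0, 1, 2, 3}" "j \<in> {0, 1, 2, 3}" for i j
    using that by (elim insertE emptyE; simp add: CZ_mat_def mat_of_rows_list_def)
qed auto

lemma adjoint_S: "mat_adjoint (S_mat \<omega>) * S_mat \<omega> = 1\<^sub>m 2"
proof -
  have "cnj (\<omega>\<^sup>2) * \<omega>\<^sup>2 = (\<omega> * cnj \<omega>) * (\<omega> * cnj \<omega>)" by (simp add: power2_eq_square mult_ac)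
  then have "cnj (\<omega>\<^sup>2) * \<omega>\<^sup>2 = 1" by (simp add: omega_norm)
  then show ?thesis
    by (intro eq_mat_2[OF mult_carrier_mat[OF mat_adjoint_closed[OF gates_closed(2)] gates_closed(2)] one_carrier_mat])
      (simp_all add: S_mat_def mat_of_rows_list_def scalar_prod_def numeral_2_eq_2)
qed

lemma generators_unitary: "generators \<subseteq> carrier (unitary_group (2 ^ n))"
proof
  fix A assume "A \<in> generators"
  then show "A \<in> carrier (unitary_group (2 ^ n))"
  proof (cases rule: generator_cases)
    case scalar
    have "mat_adjoint (\<omega> \<cdot>\<^sub>m 1\<^sub>m (2 ^ n)) = cnj \<omega> \<cdot>\<^sub>m (1\<^sub>m (2 ^ n) :: complex mat)"
      by (rule eq_matI) auto
    then show ?thesis using scalar omega_norm by (simp add: unitary_group_def P.mat_norm mult.commute)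
  next
    case (hadamard i)
    then show ?thesis using hq_square by (auto simp: unitary_group_def on_qubit_adjoint adjoint_H)
  next
    case (phase i)
    then show ?thesis
      by (auto simp: unitary_group_def on_qubit_adjoint on_qubit_mult[OF mat_adjoint_closed[OF gates_closed(2)] gates_closed(2)] adjoint_S on_qubit_one)
  next
    case (controlled i)
    have "i \<in> {1..n}" "i + 1 \<in> {1..n}" using controlled by auto
    then have "czq i \<in> P.Mat" unfolding czq_control[OF controlled(1)] by auto
    moreover have "mat_adjoint (czq i) = czq i"
      by (simp add: on_adjacent_qubits_def mat_adjoint_kron mat_adjoint_one adjoint_CZ)
    ultimately show ?thesis using controlled czq_square by (auto simp: unitary_group_def)
  qed
qed

lemma clifford_generators: "C = subgroup_generated (unitary_group (2 ^ n)) generators"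
  by (simp add: clifford_def generators_def)

lemma clifford_carrier: "carrier C = generate (unitary_group (2 ^ n)) generators"
  unfolding clifford_generators carrier_subgroup_generated using generators_unitary by (simp add: Int_absorb1)

lemma clifford_mult [simp]: "A \<otimes>\<^bsub>C\<^esub> B = B * A"
  by (simp add: clifford_generators unitary_group_def)

lemma clifford_one [simp]: "\<one>\<^bsub>C\<^esub> = 1\<^sub>m (2 ^ n)"
  by (simp add: clifford_generators unitary_group_def)

sublocale C: Group.group C
  unfolding clifford_generators by (rule group.group_subgroup_generated[OF group_unitary])

lemma clifford_unitary: "A \<in> carrier C \<Longrightarrow> A \<in> carrier (unitary_group (2 ^ n))"
  unfolding clifford_carrier
  using group.generate_in_carrier[OF group_unitary generators_unitary] by blast

lemma clifford_closed [simp, intro]: "A \<in> carrier C \<Longrightarrow> A \<in> P.Mat"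
  using clifford_unitary by (auto simp: unitary_group_def)

lemma clifford_mult_closed: "A \<in> carrier C \<Longrightarrow> B \<in> carrier C \<Longrightarrow> A * B \<in> carrier C"
  using C.m_closed[of B A] by simp

lemma generator_in_clifford: "A \<in> generators \<Longrightarrow> A \<in> carrier C"
  unfolding clifford_carrier by (rule generate.incl)

lemma clifford_induct [consumes 1, case_names one generator adjoint mult]:
  assumes "A \<in> carrier C" and "Q (1\<^sub>m (2 ^ n))"
    and gen: "\<And>A. A \<in> generators \<Longrightarrow> Q A"
    and adj: "\<And>A. A \<in> generators \<Longrightarrow> Q A \<Longrightarrow> Q (mat_adjoint A)"
    and mult: "\<And>A B. A \<in> carrier C \<Longrightarrow> B \<in> carrier C \<Longrightarrow> Q A \<Longrightarrow> Q B \<Longrightarrow> Q (A * B)"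
  shows "Q A"
  using assms(1) unfolding clifford_carrier
proof (induction rule: generate.induct)
  case one
  then show ?case using assms(2) by (simp add: unitary_group_def)
next
  case (incl h)
  then show ?case by (rule gen)
next
  case (inv h)
  then show ?case using adj gen unitary_inverse(1) generators_unitary by (metis subsetD)
next
  case (eng h1 h2)
  then show ?case using mult[of h2 h1] by (simp add: clifford_carrier unitary_group_def)
qed

lemma czq_quarter_turns:
  assumes i: "i \<in> {1..<n}"
  shows "quarter_turn (\<omega>\<^sup>2 \<cdot>\<^sub>m (zq i * zq (i + 1))) *
    (quarter_turn ((- (\<omega>\<^sup>2)) \<cdot>\<^sub>m zq i) * quarter_turn ((- (\<omega>\<^sup>2)) \<cdot>\<^sub>m zq (i + 1)))
    = ((1 - \<omega>\<^sup>2) * half) \<cdot>\<^sub>m czq i"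
proof -
  have i': "i \<in> {1..n}" "i + 1 \<in> {1..n}" using i by auto
  have m: "zq i \<in> P.Mat" "zq (i + 1) \<in> P.Mat" using i' by auto
  show ?thesis unfolding czq_control[OF i] half_def
    by (rule P.control_quarter_turns[OF m P.z_square[OF i'(1)] P.z_square[OF i'(2)] P.twist_zz[OF i']])
qed

lemma scalar_square:
  "A \<in> P.Mat \<Longrightarrow> A * A = 1\<^sub>m (2 ^ n) \<Longrightarrow> (\<omega>\<^sup>2 \<cdot>\<^sub>m A) * (\<omega>\<^sup>2 \<cdot>\<^sub>m A) = (-1) \<cdot>\<^sub>m 1\<^sub>m (2 ^ n)"
  "A \<in> P.Mat \<Longrightarrow> A * A = 1\<^sub>m (2 ^ n) \<Longrightarrow> ((- (\<omega>\<^sup>2)) \<cdot>\<^sub>m A) * ((- (\<omega>\<^sup>2)) \<cdot>\<^sub>m A) = (-1) \<cdot>\<^sub>m 1\<^sub>m (2 ^ n)"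
  using zeta_zeta by (simp_all add: P.mat_norm)

text \<open>
  Up to phases all generators are products of Pauli matrices and quarter turns.
\<close>

lemma clifford_normalizing: "A \<in> carrier C \<Longrightarrow> P.normalizing A"
proof (induction rule: clifford_induct)
  case one
  then show ?case by (rule P.normalizing_pauli[OF P.pauli.one])
next
  case (generator A)
  have zeta: "\<omega>\<^sup>2 \<cdot>\<^sub>m B \<in> P.pauli {1..n}" "(- (\<omega>\<^sup>2)) \<cdot>\<^sub>m B \<in> P.pauli {1..n}" if "B \<in> P.pauli {1..n}" for B
    using P.pauli.phase[OF that] P.pauli_uminus[OF P.pauli.phase[OF that]] by (simp_all add: smult_smult_mat)
  from generator show ?case
  proof (cases rule: generator_cases)
    case scalar
    then show ?thesis using P.normalizing_smult[OF P.normalizing_pauli[OF P.pauli.one]] by simp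
  next
    case (hadamard i)
    have p: "xq i \<in> P.pauli {1..n}" "zq i \<in> P.pauli {1..n}" using P.pauli_x P.pauli_z hadamard by auto
    have "(xq i * zq i) * (xq i * zq i) = (-1) \<cdot>\<^sub>m 1\<^sub>m (2 ^ n)"
      using P.square_mult[of "xq i" "zq i" "-1" 1 1] P.twist_xz[of i i] P.x_square P.z_square hadamard by auto
    then show ?thesis unfolding hadamard hq_quarter_turn[OF hadamard(1)]
      using P.normalizing_mult P.normalizing_pauli P.normalizing_quarter_turn p P.pauli_mult by blast
  next
    case (phase i)
    have p: "zq i \<in> P.pauli {1..n}" using P.pauli_z phase by auto
    have "(1 + \<omega>\<^sup>2) * half \<noteq> 0" using scalar_roots(1) by auto
    then show ?thesis unfolding phase sq_quarter_turn[OF phase(1)]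
      using P.normalizing_smult P.normalizing_quarter_turn[OF zeta(2)[OF p] scalar_square(2)] P.z_square[OF phase(1)] p
      by auto
  next
    case (controlled i)
    have i: "i \<in> {1..n}" "i + 1 \<in> {1..n}" using controlled by auto
    have p: "zq i \<in> P.pauli {1..n}" "zq (i + 1) \<in> P.pauli {1..n}" using P.pauli_z i by auto
    have m: "zq i \<in> P.Mat" "zq (i + 1) \<in> P.Mat" using p by auto
    define c where "c = (1 - \<omega>\<^sup>2) * half"
    have c: "c \<noteq> 0" using scalar_roots(2) by (auto simp: c_def)
    have "(zq i * zq (i + 1)) * (zq i * zq (i + 1)) = 1\<^sub>m (2 ^ n)"
      using P.square_mult[OF m P.twist_zz[OF i], of 1 1] P.z_square i by auto
    then have "P.normalizing (c \<cdot>\<^sub>m czq i)" unfolding c_def czq_quarter_turns[OF controlled(1), symmetric]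
      using m p P.z_square[OF i(1)] P.z_square[OF i(2)]
      by (intro P.normalizing_mult P.normalizing_quarter_turn zeta scalar_square P.pauli_mult) auto
    then have "P.normalizing ((1 / c) \<cdot>\<^sub>m (c \<cdot>\<^sub>m czq i))" 
      using P.normalizing_smult[of "c \<cdot>\<^sub>m czq i" "1 / c"] c by simp
    then show ?thesis using controlled c by (simp add: smult_smult_mat)
  qed
next
  case (adjoint A)
  have "A \<in> carrier (unitary_group (2 ^ n))" using adjoint(1) generators_unitary by auto
  note u = unitary_inverse[OF this]
  have "mat_adjoint A * A = 1\<^sub>m (2 ^ n)" using \<open>A \<in> carrier (unitary_group (2 ^ n))\<close> by (simp add: unitary_group_def)
  then show ?case using P.normalizing_inverse[OF adjoint(2) _ u(2)] adjoint(2) by auto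
next
  case (mult A B)
  then show ?case using P.normalizing_mult by blast
qed

lemma clifford_dyadic: "A \<in> carrier C \<Longrightarrow> dyadic_mat A"
proof (induction rule: clifford_induct)
  case one
  then show ?case by (rule dyadic_mat_one)
next
  case (generator A)
  then show ?case
    using dyadic_mat_gates dyadic_mat_one dyadic_constants
    by (auto simp: generators_def on_qubit_def on_adjacent_qubits_def intro!: dyadic_mat_kron dyadic_mat_smult)
next
  case (adjoint A)
  then show ?case by (simp add: dyadic_mat_adjoint)
next
  case (mult A B)
  then show ?case using dyadic_mat_mult[of A B] clifford_closed[OF mult(1)] clifford_closed[OF mult(2)] by auto
qed

text \<open>
  The scalar is an entry of a unitary Clifford matrix, so it is dyadic and of modulus \<open>1\<close>.
\<close>

lemma clifford_scalar:
  assumes "c \<cdot>\<^sub>m 1\<^sub>m (2 ^ n) \<in> carrier C"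
  obtains j where "c = \<omega> ^ j"
proof -
  have "\<forall>i < (2 :: nat) ^ n. \<forall>j < (2 :: nat) ^ n. c * (if i = j then 1 else 0) \<in> dyadic"
    using clifford_dyadic[OF assms] unfolding dyadic_mat_def by auto
  from this[rule_format, of 0 0] have c: "c \<in> dyadic" by simp
  have "mat_adjoint (c \<cdot>\<^sub>m 1\<^sub>m (2 ^ n)) * (c \<cdot>\<^sub>m 1\<^sub>m (2 ^ n)) = 1\<^sub>m (2 ^ n)"
    using clifford_unitary[OF assms] by (simp add: unitary_group_def)
  moreover have "mat_adjoint (c \<cdot>\<^sub>m 1\<^sub>m (2 ^ n)) = cnj c \<cdot>\<^sub>m (1\<^sub>m (2 ^ n) :: complex mat)"
    by (rule eq_matI) auto
  ultimately have "(cnj c * c) \<cdot>\<^sub>m 1\<^sub>m (2 ^ n) = 1 \<cdot>\<^sub>m (1\<^sub>m (2 ^ n) :: complex mat)"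
    by (simp add: P.mat_norm mult.commute)
  then have "cnj c * c = 1" by (rule P.scalar_inject)
  then have "c * cnj c = 1" by (simp add: mult.commute)
  then show ?thesis using dyadic_unit c that by blast
qed

end

lemma (in Group.group) conjugate_centralizer:
  assumes g: "g \<in> carrier G" and u: "u \<in> carrier G"
  shows "g <# centralizer G u #> inv g = centralizer G (g \<otimes> u \<otimes> inv g)"
proof -
  have c: "inv g \<otimes> (g \<otimes> x) = x" "g \<otimes> (inv g \<otimes> x) = x" if "x \<in> carrier G" for x
    using g that by (simp_all flip: m_assoc)
  have "g \<otimes> h \<otimes> inv g \<in> centralizer G (g \<otimes> u \<otimes> inv g)" if h: "h \<in> centralizer G u" for h
  proof -
    have h': "h \<in> carrier G" "u \<otimes> h = h \<otimes> u" using h by (auto simp: centralizer_def)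
    have "g \<otimes> u \<otimes> inv g \<otimes> (g \<otimes> h \<otimes> inv g) = g \<otimes> (u \<otimes> h) \<otimes> inv g"
      using g u h'(1) by (simp add: m_assoc c)
    also have "\<dots> = g \<otimes> h \<otimes> inv g \<otimes> (g \<otimes> u \<otimes> inv g)"
      unfolding h'(2) using g u h'(1) by (simp add: m_assoc c)
    finally show ?thesis using g h'(1) by (simp add: centralizer_def)
  qed
  moreover have "\<exists>h \<in> centralizer G u. k = g \<otimes> h \<otimes> inv g" if k: "k \<in> centralizer G (g \<otimes> u \<otimes> inv g)" for k
  proof -
    have k': "k \<in> carrier G" "(g \<otimes> u \<otimes> inv g) \<otimes> k = k \<otimes> (g \<otimes> u \<otimes> inv g)"
      using k by (auto simp: centralizer_def)
    have "u \<otimes> (inv g \<otimes> k \<otimes> g) = inv g \<otimes> ((g \<otimes> u \<otimes> inv g) \<otimes> k) \<otimes> g"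
      using g u k'(1) by (simp add: m_assoc c)
    also have "\<dots> = (inv g \<otimes> k \<otimes> g) \<otimes> u"
      unfolding k'(2) using g u k'(1) by (simp add: m_assoc)
    finally have "inv g \<otimes> k \<otimes> g \<in> centralizer G u" using g k'(1) by (simp add: centralizer_def)
    moreover have "k = g \<otimes> (inv g \<otimes> k \<otimes> g) \<otimes> inv g" using g k'(1) by (simp add: m_assoc c)
    ultimately show ?thesis by blast
  qed
  ultimately show ?thesis unfolding l_coset_def r_coset_def by blast
qed

lemma (in Group.group) subgroup_centralizer:
  assumes u: "u \<in> carrier G"
  shows "subgroup (centralizer G u) G"
proof (rule subgroupI)
  show "centralizer G u \<noteq> {}" using u by (auto simp: centralizer_def)
next
  fix a assume "a \<in> centralizer G u"
  then have a: "a \<in> carrier G" "u \<otimes> a = a \<otimes> u" by (auto simp: centralizer_def)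
  have "inv a \<otimes> u = inv a \<otimes> (u \<otimes> a) \<otimes> inv a" using a(1) u by (simp add: m_assoc)
  also have "\<dots> = u \<otimes> inv a" unfolding a(2) using a(1) u by (simp flip: m_assoc)
  finally have "inv a \<otimes> u = u \<otimes> inv a" .
  then show "inv a \<in> centralizer G u" using a by (simp add: centralizer_def)
next
  fix a b assume "a \<in> centralizer G u" "b \<in> centralizer G u"
  then have ab: "a \<in> carrier G" "u \<otimes> a = a \<otimes> u" "b \<in> carrier G" "u \<otimes> b = b \<otimes> u" by (auto simp: centralizer_def)
  then have "u \<otimes> (a \<otimes> b) = (a \<otimes> b) \<otimes> u" using u by (metis m_assoc)
  then show "a \<otimes> b \<in> centralizer G u" using ab by (simp add: centralizer_def)
qed (auto simp: centralizer_def)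

context clifford_context
begin

section \<open>The projective Clifford group\<close>

abbreviation PC :: "complex mat set monoid" where
  "PC \<equiv> proj_clifford \<omega> n"

abbreviation cl :: "complex mat \<Rightarrow> complex mat set" where
  "cl \<equiv> proj_class \<omega> n"

lemma gates_in_clifford [simp]:
  "i \<in> {1..n} \<Longrightarrow> hq i \<in> carrier C" "i \<in> {1..n} \<Longrightarrow> sq i \<in> carrier C" "i \<in> {1..<n} \<Longrightarrow> czq i \<in> carrier C"
  "\<omega> \<cdot>\<^sub>m 1\<^sub>m (2 ^ n) \<in> carrier C"
  using generator_in_clifford by (auto simp: generators_def)

lemma clifford_one_closed [simp]: "1\<^sub>m (2 ^ n) \<in> carrier C"
  using C.one_closed by simp

lemma scalar_in_clifford [simp]: "\<omega> ^ k \<cdot>\<^sub>m 1\<^sub>m (2 ^ n) \<in> carrier C"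
proof (induction k)
  case (Suc k)
  have "(\<omega> \<cdot>\<^sub>m 1\<^sub>m (2 ^ n)) * (\<omega> ^ k \<cdot>\<^sub>m 1\<^sub>m (2 ^ n)) = \<omega> ^ Suc k \<cdot>\<^sub>m (1\<^sub>m (2 ^ n) :: complex mat)"
    by (simp add: P.mat_norm mult.commute)
  then show ?case using clifford_mult_closed[OF gates_in_clifford(4) Suc] by simp
qed simp

lemma smult_in_clifford: "A \<in> carrier C \<Longrightarrow> \<omega> ^ k \<cdot>\<^sub>m A \<in> carrier C"
  using clifford_mult_closed[OF scalar_in_clifford, of A k] by (auto simp: P.mat_norm)

lemma phases_eq: "phases \<omega> n = range (\<lambda>k. \<omega> ^ k \<cdot>\<^sub>m 1\<^sub>m (2 ^ n))"
proof
  show "phases \<omega> n \<subseteq> range (\<lambda>k. \<omega> ^ k \<cdot>\<^sub>m 1\<^sub>m (2 ^ n))"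
  proof
    fix A assume "A \<in> phases \<omega> n"
    then have "A \<in> generate C {\<omega> \<cdot>\<^sub>m 1\<^sub>m (2 ^ n)}" by (simp add: phases_def)
    then show "A \<in> range (\<lambda>k. \<omega> ^ k \<cdot>\<^sub>m 1\<^sub>m (2 ^ n))"
    proof (induction rule: generate.induct)
      case one
      have "1\<^sub>m (2 ^ n) = \<omega> ^ 0 \<cdot>\<^sub>m (1\<^sub>m (2 ^ n) :: complex mat)" by simp
      then show ?case unfolding clifford_one by blast
    next
      case (incl h)
      have "h = \<omega> ^ 1 \<cdot>\<^sub>m (1\<^sub>m (2 ^ n) :: complex mat)" using incl by simp
      then show ?case by blast
    next
      case (inv h)
      have "inv\<^bsub>C\<^esub> h = \<omega> ^ 7 \<cdot>\<^sub>m 1\<^sub>m (2 ^ n)"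
      proof (rule C.inv_equality)
        have "\<omega> * \<omega> ^ 7 = \<omega> ^ 8" by (simp flip: power_Suc)
        then show "\<omega> ^ 7 \<cdot>\<^sub>m 1\<^sub>m (2 ^ n) \<otimes>\<^bsub>C\<^esub> h = \<one>\<^bsub>C\<^esub>"
          using inv omega_8 by (simp add: P.mat_norm mult.commute)
      qed (use inv in auto)
      then show ?case by blast
    next
      case (eng h1 h2)
      then obtain k l where "h1 = \<omega> ^ k \<cdot>\<^sub>m 1\<^sub>m (2 ^ n)" "h2 = \<omega> ^ l \<cdot>\<^sub>m 1\<^sub>m (2 ^ n)" by auto
      then have "h1 \<otimes>\<^bsub>C\<^esub> h2 = \<omega> ^ (k + l) \<cdot>\<^sub>m 1\<^sub>m (2 ^ n)" by (simp add: P.mat_norm power_add)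
      then show ?case by blast
    qed
  qed
  have "\<omega> ^ k \<cdot>\<^sub>m 1\<^sub>m (2 ^ n) \<in> phases \<omega> n" for k
  proof (induction k)
    case 0
    show ?case unfolding phases_def using generate.one[of C] by simp
  next
    case (Suc k)
    have "(\<omega> ^ k \<cdot>\<^sub>m 1\<^sub>m (2 ^ n)) \<otimes>\<^bsub>C\<^esub> (\<omega> \<cdot>\<^sub>m 1\<^sub>m (2 ^ n)) = \<omega> ^ Suc k \<cdot>\<^sub>m 1\<^sub>m (2 ^ n)"
      by (simp add: P.mat_norm mult.commute)
    then show ?case using Suc generate.eng[of _ C] generate.incl[of "\<omega> \<cdot>\<^sub>m 1\<^sub>m (2 ^ n)"]
      unfolding phases_def by (metis singletonI)
  qed
  then show "range (\<lambda>k. \<omega> ^ k \<cdot>\<^sub>m 1\<^sub>m (2 ^ n)) \<subseteq> phases \<omega> n" by blast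
qed

lemma phases_normal: "phases \<omega> n \<lhd> C"
  unfolding C.normal_inv_iff
proof (intro conjI ballI)
  show "subgroup (phases \<omega> n) C"
    unfolding phases_def by (rule C.generate_is_subgroup) simp
  fix A h assume A: "A \<in> carrier C" and h: "h \<in> phases \<omega> n"
  then obtain k where k: "h = \<omega> ^ k \<cdot>\<^sub>m 1\<^sub>m (2 ^ n)" by (auto simp: phases_eq)
  have hC: "h \<in> carrier C" by (simp add: k)
  have "A \<otimes>\<^bsub>C\<^esub> h = h \<otimes>\<^bsub>C\<^esub> A" using clifford_closed[OF A] by (simp add: k P.mat_norm)
  then have "A \<otimes>\<^bsub>C\<^esub> h \<otimes>\<^bsub>C\<^esub> inv\<^bsub>C\<^esub> A = h \<otimes>\<^bsub>C\<^esub> (A \<otimes>\<^bsub>C\<^esub> inv\<^bsub>C\<^esub> A)"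
    using C.m_assoc[OF hC A C.inv_closed[OF A]] by (simp only:)
  also have "\<dots> = h" unfolding C.r_inv[OF A] by (rule C.r_one[OF hC])
  finally show "A \<otimes>\<^bsub>C\<^esub> h \<otimes>\<^bsub>C\<^esub> inv\<^bsub>C\<^esub> A \<in> phases \<omega> n" using h by (simp only:)
qed

sublocale PC: Group.group PC
  unfolding proj_clifford_def by (rule normal.factorgroup_is_group[OF phases_normal])

lemma class_carrier: "carrier PC = cl ` carrier C"
  by (auto simp: proj_clifford_def FactGroup_def RCOSETS_def proj_class_def)

lemma class_closed [simp]: "A \<in> carrier C \<Longrightarrow> cl A \<in> carrier PC"
  by (auto simp: class_carrier)

lemma class_mult: "A \<in> carrier C \<Longrightarrow> B \<in> carrier C \<Longrightarrow> cl A \<otimes>\<^bsub>PC\<^esub> cl B = cl (B * A)"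
  using normal.rcos_sum[OF phases_normal] by (simp add: proj_clifford_def FactGroup_def proj_class_def)

lemma class_square: "A \<in> carrier C \<Longrightarrow> cl A [^]\<^bsub>PC\<^esub> (2 :: nat) = cl (A * A)"
  by (simp add: numeral_2_eq_2 class_mult)

lemma class_eq:
  assumes "A \<in> carrier C" "B \<in> carrier C"
  shows "cl A = cl B \<longleftrightarrow> (\<exists>k. A = \<omega> ^ k \<cdot>\<^sub>m B)"
proof
  have sub: "subgroup (phases \<omega> n) C" using phases_normal normal_imp_subgroup by blast
  have B: "B \<in> P.Mat" using assms by auto
  have mem: "A \<in> cl B \<longleftrightarrow> (\<exists>k. A = \<omega> ^ k \<cdot>\<^sub>m B)"
    using B by (auto simp: proj_class_def r_coset_def phases_eq P.mat_norm)
  show "\<exists>k. A = \<omega> ^ k \<cdot>\<^sub>m B" if "cl A = cl B"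
    using C.rcos_self[OF assms(1) sub] that mem by (simp add: proj_class_def)
  show "cl A = cl B" if "\<exists>k. A = \<omega> ^ k \<cdot>\<^sub>m B"
    using C.repr_independence[OF _ assms(2) sub, of A] that mem by (simp add: proj_class_def)
qed

lemma class_one: "\<one>\<^bsub>PC\<^esub> = cl (1\<^sub>m (2 ^ n))"
proof -
  have "cl (1\<^sub>m (2 ^ n)) \<otimes>\<^bsub>PC\<^esub> cl (1\<^sub>m (2 ^ n)) = cl (1\<^sub>m (2 ^ n))" by (simp add: class_mult)
  then show ?thesis using PC.l_cancel_one[of "cl (1\<^sub>m (2 ^ n))" "cl (1\<^sub>m (2 ^ n))"] by simp
qed

lemma class_sign: "A \<in> carrier C \<Longrightarrow> B \<in> carrier C \<Longrightarrow> is_sign e \<Longrightarrow> A = e \<cdot>\<^sub>m B \<Longrightarrow> cl A = cl B"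
  using omega_4 by (auto simp: class_eq is_sign_def intro: exI[of _ 0] exI[of _ 4])

section \<open>The conjugate centralizer\<close>

lemma first_two [simp]: "1 \<in> {1..n}" "2 \<in> {1..n}" "1 \<in> {1..<n}"
proof -
  have "1 \<le> n" "1 < n" using two_le_n by linarith+
  then show "1 \<in> {1..n}" "2 \<in> {1..n}" "1 \<in> {1..<n}" using two_le_n by simp_all
qed

lemma n_bounds [simp]: "2 \<le> n" "Suc 0 \<le> n" "Suc 0 < n" "1 \<le> n" "1 < n"
  using two_le_n by linarith+

definition yq :: "complex mat" where
  "yq = zq 1 * xq 1"

lemma zq_in_clifford: "i \<in> {1..n} \<Longrightarrow> zq i \<in> carrier C"
  using clifford_mult_closed[of "sq i" "sq i"] by (simp add: sq_square)

lemma hq_conjugate: "i \<in> {1..n} \<Longrightarrow> hq i * (zq i * hq i) = xq i"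
proof -
  assume i: "i \<in> {1..n}"
  have m: "hq i \<in> P.Mat" "zq i \<in> P.Mat" "xq i \<in> P.Mat" using i by auto
  have "hq i * (zq i * hq i) = (hq i * zq i) * hq i" using m by (simp add: P.mat_assoc)
  then show ?thesis unfolding hq_zq[OF i] using m hq_square[OF i] by (simp add: P.mat_norm)
qed

lemma hq_xq: "i \<in> {1..n} \<Longrightarrow> hq i * xq i = zq i * hq i"
proof -
  assume i: "i \<in> {1..n}"
  have m: "hq i \<in> P.Mat" "zq i \<in> P.Mat" "xq i \<in> P.Mat" using i by auto
  have "hq i * (hq i * (zq i * hq i)) = zq i * hq i"
    using m hq_square[OF i] P.mat_assoc[of "hq i" "hq i" "zq i * hq i"] by (simp add: P.mat_one_left)
  then show ?thesis unfolding hq_conjugate[OF i] .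
qed

lemma xq_in_clifford: "i \<in> {1..n} \<Longrightarrow> xq i \<in> carrier C"
  using clifford_mult_closed[of "hq i" "zq i * hq i"] clifford_mult_closed[of "zq i" "hq i"] zq_in_clifford[of i]
  by (simp add: hq_conjugate)

lemma yq_in_clifford [simp]: "yq \<in> carrier C"
  unfolding yq_def by (intro clifford_mult_closed zq_in_clifford xq_in_clifford) auto

definition m_mat :: "complex mat" where
  "m_mat = quarter_turn (zq 1 * (xq 1 * xq 2)) * xq 2"

text \<open>
  The factors appear in matrix order, so the circuit is read from right to left. With the controlled
  not \<open>N = H\<^sub>2 CZ H\<^sub>2\<close> the product is \<open>N (Z\<^sub>1 H\<^sub>1) X\<^sub>2 N\<close>, where \<open>Z\<^sub>1 H\<^sub>1\<close> is the quarter
  turn in the direction \<open>Z\<^sub>1 X\<^sub>1\<close>, and \<open>N\<close> conjugates \<open>X\<^sub>1\<close> to \<open>X\<^sub>1 X\<^sub>2\<close>.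
\<close>

lemma m_mat_product:
  "hq 2 * (czq 1 * (hq 2 * (zq 1 * (hq 1 * (hq 2 * (zq 2 * (czq 1 * hq 2))))))) = m_mat"
proof -
  define N where "N = P.control (zq 1) (xq 2)"
  define T where "T = quarter_turn (zq 1 * xq 1)"
  have m: "zq 1 \<in> P.Mat" "xq 1 \<in> P.Mat" "zq 2 \<in> P.Mat" "xq 2 \<in> P.Mat" "hq 1 \<in> P.Mat" "hq 2 \<in> P.Mat" by auto
  have Nm: "N \<in> P.Mat" "T \<in> P.Mat" unfolding N_def T_def using m by auto
  have cz: "czq 1 = P.control (zq 1) (zq 2)" using czq_control[of 1] by (simp add: numeral_2_eq_2)
  have czm: "czq 1 \<in> P.Mat" unfolding cz using m by auto
  have h2z1: "hq 2 * zq 1 = zq 1 * hq 2"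
    using on_qubit_commute[OF gates_closed(1) XZ_closed(2), of 2 n 1] by auto
  have hz: "hq 2 * zq 2 = xq 2 * hq 2" by (rule hq_zq) simp
  have hzz: "hq 2 * (zq 1 * zq 2) = zq 1 * (xq 2 * hq 2)"
    using m P.mat_assoc[of "hq 2" "zq 1" "zq 2"] P.mat_assoc[of "zq 1" "hq 2" "zq 2"] h2z1 hz by simp
  have hcz: "hq 2 * czq 1 = N * hq 2"
    unfolding cz N_def P.control_def using m
    by (simp add: P.mat_distrib_left P.mat_distrib_right P.mat_norm h2z1 hz hzz del: One_nat_def)
  have hh: "hq 2 * (hq 2 * A) = A" if "A \<in> P.Mat" for A
    using hq_square[of 2] P.mat_assoc[of "hq 2" "hq 2" A] m that by (simp add: P.mat_one_left)
  have czh: "czq 1 * hq 2 = hq 2 * N"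
  proof -
    have "hq 2 * N = hq 2 * (N * (hq 2 * hq 2))" using hq_square[of 2] Nm by (simp add: P.mat_norm)
    also have "\<dots> = hq 2 * ((hq 2 * czq 1) * hq 2)" unfolding hcz using m Nm by (simp add: P.mat_assoc)
    also have "\<dots> = czq 1 * hq 2" using m czm by (simp add: P.mat_assoc hh)
    finally show ?thesis by simp
  qed
  have hzh: "hq 2 * (zq 2 * (hq 2 * N)) = xq 2 * N"
    using m Nm P.mat_assoc[of "hq 2" "zq 2" "hq 2 * N"] by (simp add: hz P.mat_assoc hh)
  have zh: "zq 1 * hq 1 = T"
    unfolding hq_sum[OF first_two(1)] T_def using m P.z_square[OF first_two(1)]
    by (simp add: P.quarter_turn_alt half_def P.mat_expand comm_add_mat[of _ "2 ^ n" "2 ^ n"])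
  have tz: "twist 1 (zq 1) (xq 2)" "twist (-1) (zq 1) (xq 1)" "twist 1 (xq 2) (xq 1)"
    using P.twist_zx[OF first_two(1,2)] P.twist_zx[OF first_two(1,1)] P.twist_xx[OF first_two(2,1)] by simp_all
  have xN: "xq 2 * N = N * xq 2"
    using P.control_commute[OF m(1,4,4) tz(1) P.twist_self] by (simp add: N_def twist_def)
  have zN: "N * zq 1 = zq 1 * N"
    using P.control_commute[OF m(1,4,1) P.twist_self P.twist_sym[OF _ tz(1)]] by (simp add: N_def twist_def)
  have Nx: "N * xq 1 = xq 1 * xq 2 * N"
    unfolding N_def by (rule P.control_anticommute[OF m(1,4,2) P.x_square[OF first_two(2)] tz])
  have NN: "N * N = 1\<^sub>m (2 ^ n)"
    unfolding N_def by (rule P.control_square[OF m(1,4) P.z_square[OF first_two(1)] P.x_square[OF first_two(2)] tz(1)])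
  have NT: "N * T = quarter_turn (zq 1 * (xq 1 * xq 2)) * N"
  proof -
    have "N * (zq 1 * xq 1) = (zq 1 * N) * xq 1"
      unfolding zN[symmetric] using m Nm by (simp add: P.mat_assoc)
    also have "\<dots> = zq 1 * (xq 1 * xq 2) * N" using m Nm by (simp add: P.mat_assoc Nx del: One_nat_def)
    finally show ?thesis unfolding T_def using m Nm
      by (simp add: P.quarter_turn_alt P.mat_distrib_left P.mat_distrib_right P.mat_smult_left P.mat_smult_right
          P.mat_one_left P.mat_one_right)
  qed
  \<comment> \<open>What follows \<open>H\<^sub>2 CZ H\<^sub>2\<close> is \<open>T X\<^sub>2 N\<close>; the two copies of \<open>N\<close> then meet and cancel.\<close>
  define R where "R = zq 1 * (hq 1 * (hq 2 * (zq 2 * (czq 1 * hq 2))))"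
  have Rm: "R \<in> P.Mat" unfolding R_def using m czm by auto
  have R: "R = T * (xq 2 * N)"
    unfolding R_def czh hzh using m Nm P.mat_assoc[of "zq 1" "hq 1" "xq 2 * N"] by (simp add: zh del: One_nat_def)
  have "hq 2 * (czq 1 * (hq 2 * R)) = (hq 2 * czq 1) * (hq 2 * R)" using m czm Rm by (simp add: P.mat_assoc)
  also have "\<dots> = N * R" unfolding hcz using m Nm Rm by (simp add: P.mat_assoc hh)
  also have "\<dots> = (N * T) * (N * xq 2)" unfolding R xN using m Nm by (simp add: P.mat_assoc)
  also have "\<dots> = quarter_turn (zq 1 * (xq 1 * xq 2)) * ((N * N) * xq 2)"
    unfolding NT using m Nm by (simp add: P.mat_assoc)
  also have "\<dots> = m_mat" unfolding NN m_mat_def using m by (simp add: P.mat_one_left)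
  finally show ?thesis unfolding R_def .
qed

lemma m_mat_in_clifford [simp]: "m_mat \<in> carrier C"
  unfolding m_mat_product[symmetric]
  by (intro clifford_mult_closed zq_in_clifford gates_in_clifford first_two)

text \<open>
  For two qubits, \<open>X\<^sub>1 = H\<^sub>1 Z\<^sub>1 H\<^sub>1\<close> represents the additional generator \<open>h\<^sub>1 s\<^sub>1\<^sup>2 h\<^sub>1\<close>.
\<close>

definition in_matrices :: "complex mat set" where
  "in_matrices = hq ` {1..n} \<union> sq ` {2..n} \<union> czq ` {2..n - 1} \<union> {m_mat} \<union> (if n \<le> 2 then {xq 1} else {})"

lemma in_matrices_clifford: "in_matrices \<subseteq> carrier C"
proof -
  have "{2..n - 1} \<subseteq> {1..<n}" using two_le_n by auto
  then show ?thesis unfolding in_matrices_def by (auto simp: xq_in_clifford[simplified])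
qed

lemma M_elt_class: "M_elt \<omega> n = cl m_mat"
  unfolding M_elt_def Let_def h_gate_def s_gate_def cz_gate_def m_mat_product[symmetric]
  by (simp add: class_square class_mult clifford_mult_closed sq_square zq_in_clifford del: One_nat_def)

lemma IN_group_generated: "IN_group \<omega> n = generate PC (cl ` in_matrices)"
proof (cases "n = 2")
  case True
  have "h_gate \<omega> n 1 \<otimes>\<^bsub>PC\<^esub> s_gate \<omega> n 1 [^]\<^bsub>PC\<^esub> (2 :: nat) \<otimes>\<^bsub>PC\<^esub> h_gate \<omega> n 1 = cl (xq 1)"
    unfolding h_gate_def s_gate_def
    by (simp add: class_square class_mult clifford_mult_closed sq_square zq_in_clifford hq_conjugate del: One_nat_def)
  note first_gate = this
  have "{1..n} = {1, 2}" "{2..n} = {2}" "{2..n - 1} = {}" "n \<le> 2" using True by auto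
  then have "in_matrices = {hq 1, hq 2, sq 2, xq 1, m_mat}"
    unfolding in_matrices_def by (simp only: if_True image_insert image_empty) blast
  then show ?thesis
    unfolding IN_group_def Let_def M_elt_class first_gate if_P[OF True]
    by (simp only: image_insert image_empty h_gate_def s_gate_def)
next
  case False
  then have "\<not> n \<le> 2" using two_le_n by linarith
  with False show ?thesis
    unfolding IN_group_def Let_def M_elt_class
    by (simp add: in_matrices_def h_gate_def s_gate_def cz_gate_def image_Un image_image Un_ac del: One_nat_def)
qed

lemma subgroup_IN: "subgroup (IN_group \<omega> n) PC"
  unfolding IN_group_generated using in_matrices_clifford by (intro PC.generate_is_subgroup) auto

text \<open>
  Full preimage in the Clifford group, so that phases need not be tracked.
\<close>

definition IN_lift :: "complex mat set" where
  "IN_lift = {A \<in> carrier C. cl A \<in> IN_group \<omega> n}"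

lemma in_matrices_IN_lift: "A \<in> in_matrices \<Longrightarrow> A \<in> IN_lift"
  using in_matrices_clifford unfolding IN_lift_def IN_group_generated by (auto intro: generate.incl)

sublocale K: quarter_turn_monoid "2 ^ n" n "\<omega>\<^sup>2" xq zq IN_lift
proof
  show "A \<in> P.Mat" if "A \<in> IN_lift" for A using that by (auto simp: IN_lift_def)
  show "A * B \<in> IN_lift" if "A \<in> IN_lift" "B \<in> IN_lift" for A B
  proof -
    have AB: "A \<in> carrier C" "B \<in> carrier C" "cl A \<in> IN_group \<omega> n" "cl B \<in> IN_group \<omega> n"
      using that by (auto simp: IN_lift_def)
    then have "cl B \<otimes>\<^bsub>PC\<^esub> cl A \<in> IN_group \<omega> n" using subgroup.m_closed[OF subgroup_IN] by blast
    then show ?thesis using AB by (simp add: IN_lift_def class_mult clifford_mult_closed)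
  qed
  show "c \<cdot>\<^sub>m 1\<^sub>m (2 ^ n) \<in> IN_lift" if c: "c ^ 8 = 1" for c
  proof -
    obtain j where j: "c = \<omega> ^ j" using eighth_roots[OF c] .
    then have "cl (c \<cdot>\<^sub>m 1\<^sub>m (2 ^ n)) = cl (1\<^sub>m (2 ^ n))" by (auto simp: class_eq)
    then show ?thesis using subgroup.one_closed[OF subgroup_IN] j by (simp add: IN_lift_def class_one)
  qed
qed

lemma lift_gates:
  "i \<in> {1..n} \<Longrightarrow> hq i \<in> IN_lift" "i \<in> {2..n} \<Longrightarrow> sq i \<in> IN_lift" "i \<in> {2..<n} \<Longrightarrow> czq i \<in> IN_lift" "m_mat \<in> IN_lift"
  "n \<le> 2 \<Longrightarrow> xq 1 \<in> IN_lift"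
proof -
  have "{2..n - 1} = {2..<n}" using two_le_n by auto
  then show "i \<in> {1..n} \<Longrightarrow> hq i \<in> IN_lift" "i \<in> {2..n} \<Longrightarrow> sq i \<in> IN_lift" "i \<in> {2..<n} \<Longrightarrow> czq i \<in> IN_lift"
    "m_mat \<in> IN_lift" "n \<le> 2 \<Longrightarrow> xq 1 \<in> IN_lift"
    by (intro in_matrices_IN_lift; simp add: in_matrices_def)+
qed

lemma lift_quarter_z:
  assumes i: "i \<in> {2..n}"
  shows "quarter_turn ((- (\<omega>\<^sup>2)) \<cdot>\<^sub>m zq i) \<in> IN_lift" "quarter_turn (\<omega>\<^sup>2 \<cdot>\<^sub>m zq i) \<in> IN_lift"
proof -
  define c where "c = (1 + \<omega>\<^sup>2) * half"
  have i': "i \<in> {1..n}" using i by auto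
  have m: "zq i \<in> P.Mat" using i' by auto
  have c8: "c ^ 8 = 1" using scalar_roots(1) by (simp add: c_def)
  then have "(1 / c) ^ 8 = 1" "c \<noteq> 0" by (auto simp: power_one_over)
  then show q: "quarter_turn ((- (\<omega>\<^sup>2)) \<cdot>\<^sub>m zq i) \<in> IN_lift"
    using K.K_smult[OF _ lift_gates(2)[OF i], of "1 / c"] sq_quarter_turn[OF i']
    by (simp add: smult_smult_mat flip: c_def)
  have "quarter_turn ((-1) \<cdot>\<^sub>m ((- (\<omega>\<^sup>2)) \<cdot>\<^sub>m zq i)) \<in> IN_lift"
    using K.quarter_turn_uminus_in_K[OF _ scalar_square(2)[OF m P.z_square[OF i']] q] m by simp
  then show "quarter_turn (\<omega>\<^sup>2 \<cdot>\<^sub>m zq i) \<in> IN_lift" by (simp add: smult_smult_mat)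
qed

sublocale S: stabilizer_monoid "2 ^ n" n "\<omega>\<^sup>2" xq zq IN_lift
proof
  show "2 \<le> n" by (rule two_le_n)
  show z: "K.turning (zq i)" if i: "i \<in> {2..n}" for i
    unfolding K.turning_def
    using lift_quarter_z(2)[OF i] scalar_square(1)[of "zq i"] P.z_square[of i] i by (intro exI[of _ "\<omega>\<^sup>2"]) auto
  show x: "K.turning (xq i)" if i: "i \<in> {2..n}" for i
  proof -
    have i': "i \<in> {1..n}" using i by auto
    have m: "hq i \<in> P.Mat" "zq i \<in> P.Mat" "xq i \<in> P.Mat" using i' by auto
    have "hq i * (quarter_turn (\<omega>\<^sup>2 \<cdot>\<^sub>m zq i) * hq i) = quarter_turn (\<omega>\<^sup>2 \<cdot>\<^sub>m xq i)"
      using m hq_square[OF i'] hq_conjugate[OF i']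
      by (simp add: P.quarter_turn_alt P.mat_expand)
    moreover have "hq i * (quarter_turn (\<omega>\<^sup>2 \<cdot>\<^sub>m zq i) * hq i) \<in> IN_lift"
      using lift_quarter_z(2)[OF i] lift_gates(1)[OF i'] by (intro K.K_mult)
    ultimately show ?thesis
      unfolding K.turning_def using scalar_square(1)[OF m(3) P.x_square[OF i']] by (intro exI[of _ "\<omega>\<^sup>2"]) simp
  qed
  show "K.turning (zq i * zq (i + 1))" if i: "i \<in> {2..<n}" for i
  proof -
    have i1: "i \<in> {1..<n}" "i \<in> {1..n}" "i + 1 \<in> {1..n}" "i \<in> {2..n}" "i + 1 \<in> {2..n}" using i by auto
    have m: "zq i \<in> P.Mat" "zq (i + 1) \<in> P.Mat" using i1 by auto
    define F where "F = quarter_turn (\<omega>\<^sup>2 \<cdot>\<^sub>m (zq i * zq (i + 1)))"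
    define A B where "A = quarter_turn ((- (\<omega>\<^sup>2)) \<cdot>\<^sub>m zq i)" and "B = quarter_turn ((- (\<omega>\<^sup>2)) \<cdot>\<^sub>m zq (i + 1))"
    define A' B' where "A' = quarter_turn (\<omega>\<^sup>2 \<cdot>\<^sub>m zq i)" and "B' = quarter_turn (\<omega>\<^sup>2 \<cdot>\<^sub>m zq (i + 1))"
    have fm: "F \<in> P.Mat" "A \<in> P.Mat" "B \<in> P.Mat" "A' \<in> P.Mat" "B' \<in> P.Mat"
      unfolding F_def A_def B_def A'_def B'_def using m by auto
    have inv: "A * A' = 1\<^sub>m (2 ^ n)" "B * B' = 1\<^sub>m (2 ^ n)"
      using P.quarter_turn_inverse(1)[OF _ scalar_square(2)[OF m(1) P.z_square[OF i1(2)]]]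
        P.quarter_turn_inverse(1)[OF _ scalar_square(2)[OF m(2) P.z_square[OF i1(3)]]] m
      unfolding A_def B_def A'_def B'_def by (simp_all add: smult_smult_mat)
    have "F * (A * B) * (B' * A') = F * (A * ((B * B') * A'))" using fm by (simp add: P.mat_assoc)
    also have "\<dots> = F" unfolding inv(2) using fm inv(1) by (simp add: P.mat_one_left P.mat_one_right)
    finally have "F = (((1 - \<omega>\<^sup>2) * half) \<cdot>\<^sub>m czq i) * (B' * A')"
      using czq_quarter_turns[OF i1(1)] unfolding F_def A_def B_def by simp
    moreover have "(((1 - \<omega>\<^sup>2) * half) \<cdot>\<^sub>m czq i) * (B' * A') \<in> IN_lift"
      unfolding A'_def B'_def
      by (intro K.K_mult K.K_smult scalar_roots lift_gates(3)[OF i] lift_quarter_z(2) i1)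
    ultimately have "F \<in> IN_lift" by simp
    moreover have "(zq i * zq (i + 1)) * (zq i * zq (i + 1)) = 1\<^sub>m (2 ^ n)"
      using P.square_mult[OF m P.twist_zz[OF i1(2,3)], of 1 1] P.z_square[OF i1(2)] P.z_square[OF i1(3)] by simp
    ultimately show ?thesis unfolding K.turning_def F_def
      using scalar_square(1)[of "zq i * zq (i + 1)"] m by (intro exI[of _ "\<omega>\<^sup>2"]) auto
  qed
  have m: "zq 1 \<in> P.Mat" "xq 1 \<in> P.Mat" "xq 2 \<in> P.Mat" by auto
  have x2: "xq 2 \<in> IN_lift" using K.turning_in_K[OF P.pauli_x[of 2 "{2}"] x[of 2]] two_le_n by auto
  show "K.turning (xq 2 * (zq 1 * xq 1))"
  proof -
    have "m_mat * xq 2 = quarter_turn (zq 1 * (xq 1 * xq 2))"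
      unfolding m_mat_def using m P.x_square[OF first_two(2)] by (simp add: P.mat_norm)
    then have q: "quarter_turn (zq 1 * (xq 1 * xq 2)) \<in> IN_lift" using K.K_mult[OF lift_gates(4) x2] by simp
    have t: "twist 1 (zq 1 * xq 1) (xq 2)"
      using P.twist_mult_left[OF m(1,2,3) P.twist_zx[OF first_two(1,2)] P.twist_xx[OF first_two(1,2)]] by simp
    have e: "zq 1 * (xq 1 * xq 2) = xq 2 * (zq 1 * xq 1)"
      using t m by (simp add: twist_def P.mat_assoc)
    have "(zq 1 * xq 1) * (zq 1 * xq 1) = (-1) \<cdot>\<^sub>m 1\<^sub>m (2 ^ n)"
      using P.square_mult[OF m(1,2), of "-1" 1 1] P.twist_zx[OF first_two(1,1)] P.x_square[OF first_two(1)] P.z_square[OF first_two(1)]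
      by simp
    then have "(xq 2 * (zq 1 * xq 1)) * (xq 2 * (zq 1 * xq 1)) = (-1) \<cdot>\<^sub>m 1\<^sub>m (2 ^ n)"
      using P.square_mult[of "xq 2" "zq 1 * xq 1" 1 1 "-1"] P.twist_sym[OF _ t] P.x_square[OF first_two(2)] m by simp
    then show ?thesis unfolding K.turning_def using q e by (intro exI[of _ 1]) simp
  qed
  show "xq 1 * quarter_turn (xq 1 * zq 1) \<in> IN_lift"
    using lift_gates(1)[OF first_two(1)] hq_quarter_turn[OF first_two(1)] by simp
  show "xq 1 \<in> IN_lift" if "n = 2" using lift_gates(5) that by simp
qed

lemma in_matrices_twist_y:
  assumes "A \<in> in_matrices"
  shows "\<exists>e. is_sign e \<and> twist e A yq"
proof -
  have m: "zq 1 \<in> P.Mat" "xq 1 \<in> P.Mat" "xq 2 \<in> P.Mat" "yq \<in> P.Mat" by (auto simp: yq_def)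
  have commute: "twist 1 B yq" if "B \<in> P.Mat" "twist 1 B (zq 1)" "twist 1 B (xq 1)" for B
    unfolding yq_def using P.twist_mult_right[OF that(1) m(1,2) that(2,3)] by simp
  have single: "twist 1 (on_qubit n i U) yq" if "U \<in> carrier_mat 2 2" "i \<in> {2..n}" for U i
  proof -
    have i: "i \<in> {1..n}" "i \<noteq> 1" using that by auto
    show ?thesis
      using on_qubit_commute[OF that(1) XZ_closed(1) i(1) first_two(1) i(2)]
        on_qubit_commute[OF that(1) XZ_closed(2) i(1) first_two(1) i(2)] that(1) i(1)
      by (intro commute on_qubit_closed) (auto simp: twist_def)
  qed
  have y1: "twist (-1) (xq 1) yq"
    unfolding yq_def using P.twist_mult_right[OF m(2,1,2), of "-1" 1] P.twist_xz[OF first_two(1,1)] P.twist_self by simp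
  consider "A = hq 1" | i where "i \<in> {2..n}" "A = hq i" | i where "i \<in> {2..n}" "A = sq i"
    | i where "i \<in> {2..n - 1}" "A = czq i" | "A = m_mat" | "A = xq 1"
  proof -
    have "{1..n} = insert 1 {2..n}" using two_le_n by auto
    then show ?thesis using assms that unfolding in_matrices_def by (auto split: if_splits)
  qed
  then show ?thesis
  proof cases
    case 1
    have hm: "hq 1 \<in> P.Mat" by auto
    have "hq 1 * yq = xq 1 * (hq 1 * xq 1)"
      unfolding yq_def using m hm hq_zq[OF first_two(1)] P.mat_assoc[of "hq 1" "zq 1" "xq 1"] by (simp add: P.mat_assoc)
    also have "\<dots> = (xq 1 * zq 1) * hq 1"
      unfolding hq_xq[OF first_two(1)] using m hm by (simp add: P.mat_assoc)
    also have "\<dots> = (-1) \<cdot>\<^sub>m (yq * hq 1)"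
      unfolding zx_sign[OF first_two(1)] yq_def using m hm by (simp add: P.mat_smult_left)
    finally show ?thesis unfolding twist_def 1 by (intro exI[of _ "-1"]) auto
  next
    case (2 i)
    then show ?thesis using single[OF gates_closed(1)] by (intro exI[of _ 1]) auto
  next
    case (3 i)
    then show ?thesis using single[OF gates_closed(2)] by (intro exI[of _ 1]) auto
  next
    case (4 i)
    have i: "i \<in> {1..<n}" "i \<in> {1..n}" "i + 1 \<in> {1..n}" "i \<in> {2..n}" "i + 1 \<in> {2..n}" using 4 two_le_n by auto
    have "twist 1 (czq i) yq" unfolding czq_control[OF i(1)]
      using single[OF XZ_closed(2) i(4)] single[OF XZ_closed(2) i(5)] m i by (intro P.control_commute) auto
    then show ?thesis using 4 by (intro exI[of _ 1]) auto
  next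
    case 5
    have x2: "twist 1 (xq 2) yq" using single[OF XZ_closed(1), of 2] two_le_n by simp
    have "zq 1 * (xq 1 * xq 2) = yq * xq 2" unfolding yq_def using m by (simp add: P.mat_assoc)
    moreover have "twist 1 (yq * xq 2) yq" using P.twist_mult_left[OF m(4,3,4) P.twist_self x2] by simp
    ultimately have "twist 1 (quarter_turn (zq 1 * (xq 1 * xq 2))) yq"
      using P.quarter_turn_commute[of "yq * xq 2" yq] m by auto
    then have "twist 1 m_mat yq"
      unfolding m_mat_def using P.twist_mult_left[OF _ m(3,4) _ x2, of _ 1] m by auto
    then show ?thesis using 5 by (intro exI[of _ 1]) auto
  next
    case 6
    then show ?thesis using y1 by (intro exI[of _ "-1"]) auto
  qed
qed

text \<open>
  For the second inclusion, a class commutes with the class of \<open>y\<close> when a representative \<open>U\<close> commutes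
  with the matrix \<open>y\<close> up to a power of \<open>\<omega>\<close>; because \<open>y\<^sup>2\<close> is a scalar this power is a sign. Then \<open>U\<close> is
  inverse to an element of the preimage of \<open>IN\<^sub>n\<close> up to a scalar of the Clifford group.
\<close>

lemma IN_eq_centralizer: "IN_group \<omega> n = centralizer PC (cl yq)"
proof
  have "cl ` in_matrices \<subseteq> centralizer PC (cl yq)"
  proof
    fix g assume "g \<in> cl ` in_matrices"
    then obtain A where A: "A \<in> in_matrices" "g = cl A" by auto
    obtain e where e: "is_sign e" "A * yq = e \<cdot>\<^sub>m (yq * A)"
      using in_matrices_twist_y[OF A(1)] by (auto simp: twist_def)
    have AC: "A \<in> carrier C" using A(1) in_matrices_clifford by auto
    have "cl (A * yq) = cl (yq * A)" using class_sign[OF _ _ e] AC by (simp add: clifford_mult_closed)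
    then show "g \<in> centralizer PC (cl yq)" using A AC by (simp add: centralizer_def class_mult)
  qed
  then show "IN_group \<omega> n \<subseteq> centralizer PC (cl yq)"
    unfolding IN_group_generated by (intro PC.generate_subgroup_incl PC.subgroup_centralizer) auto
next
  show "centralizer PC (cl yq) \<subseteq> IN_group \<omega> n"
  proof
    fix g assume "g \<in> centralizer PC (cl yq)"
    then have g: "g \<in> carrier PC" "cl yq \<otimes>\<^bsub>PC\<^esub> g = g \<otimes>\<^bsub>PC\<^esub> cl yq" by (auto simp: centralizer_def)
    then obtain U where U: "U \<in> carrier C" "g = cl U" by (auto simp: class_carrier)
    have yU: "S.y = yq" by (simp add: S.y_def yq_def)
    have m: "U \<in> P.Mat" "yq \<in> P.Mat" using U by auto
    have "cl (U * yq) = cl (yq * U)" using g(2) U by (simp add: class_mult)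
    then obtain k where k: "U * yq = \<omega> ^ k \<cdot>\<^sub>m (yq * U)" using U by (auto simp: class_eq clifford_mult_closed)
    define e where "e = \<omega> ^ k"
    have yy: "yq * yq = (-1) \<cdot>\<^sub>m 1\<^sub>m (2 ^ n)" using S.y_square yU by simp
    have "(-1) \<cdot>\<^sub>m U = (U * yq) * yq" using m yy by (simp add: P.mat_norm)
    also have "(U * yq) * yq = (e \<cdot>\<^sub>m (yq * U)) * yq" using k by (simp only: e_def)
    also have "\<dots> = e \<cdot>\<^sub>m (yq * (U * yq))" using m by (simp add: P.mat_norm)
    also have "U * yq = e \<cdot>\<^sub>m (yq * U)" using k by (simp only: e_def)
    also have "e \<cdot>\<^sub>m (yq * (e \<cdot>\<^sub>m (yq * U))) = (e * e) \<cdot>\<^sub>m ((yq * yq) * U)" using m by (simp add: P.mat_norm)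
    also have "\<dots> = (- (e * e)) \<cdot>\<^sub>m U" unfolding yy using m by (simp add: P.mat_norm)
    finally have eU: "(-1) \<cdot>\<^sub>m U = (- (e * e)) \<cdot>\<^sub>m U" .
    obtain V where V: "V \<in> P.Mat" "U * V = 1\<^sub>m (2 ^ n)"
      using P.normalizing_invertible[OF clifford_normalizing[OF U(1)]] .
    have "((-1) \<cdot>\<^sub>m U) * V = ((- (e * e)) \<cdot>\<^sub>m U) * V" using eU by simp
    then have "(-1) \<cdot>\<^sub>m 1\<^sub>m (2 ^ n) = (- (e * e)) \<cdot>\<^sub>m (1\<^sub>m (2 ^ n) :: complex mat)"
      using m V by (simp add: P.mat_smult_left)
    then have "-1 = - (e * e)" by (rule P.scalar_inject)
    then have "is_sign e" by (simp add: is_sign_def square_eq_1_iff)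
    then have "P.sends U S.y S.y" unfolding P.sends_self yU twist_def using k e_def by blast
    then obtain A c where A: "A \<in> IN_lift" "A * U = c \<cdot>\<^sub>m 1\<^sub>m (2 ^ n)"
      using S.stabilizer_in_K[OF clifford_normalizing[OF U(1)]] by blast
    have AC: "A \<in> carrier C" "cl A \<in> IN_group \<omega> n" using A by (auto simp: IN_lift_def)
    have "c \<cdot>\<^sub>m 1\<^sub>m (2 ^ n) \<in> carrier C" using clifford_mult_closed[OF AC(1) U(1)] A(2) by simp
    then obtain j where "c = \<omega> ^ j" using clifford_scalar by blast
    then have "cl (A * U) = cl (1\<^sub>m (2 ^ n))" unfolding A(2) by (auto simp: class_eq)
    then have "cl U \<otimes>\<^bsub>PC\<^esub> cl A = \<one>\<^bsub>PC\<^esub>" using AC U by (simp add: class_mult class_one)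
    then have "cl U = inv\<^bsub>PC\<^esub> (cl A)" using AC U PC.inv_equality by simp
    then show "g \<in> IN_group \<omega> n" using U subgroup.m_inv_closed[OF subgroup_IN AC(2)] by simp
  qed
qed

text \<open>
  The conjugating element is the quarter turn about \<open>X\<^sub>1\<close>, realised by \<open>h\<^sub>1 s\<^sub>1 h\<^sub>1\<close>. Because group
  products are in circuit order, the claim for matrices reads \<open>G y = \<omega>\<^sup>2 Z\<^sub>1 G\<close>.
\<close>

lemma z1_conjugate_y1:
  "\<exists>g \<in> carrier PC. g \<otimes>\<^bsub>PC\<^esub> cl (zq 1) \<otimes>\<^bsub>PC\<^esub> inv\<^bsub>PC\<^esub> g = cl yq"
proof -
  define G where "G = hq 1 * (sq 1 * hq 1)"
  have GC: "G \<in> carrier C" unfolding G_def by (intro clifford_mult_closed gates_in_clifford first_two)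
  have m: "hq 1 \<in> P.Mat" "zq 1 \<in> P.Mat" "xq 1 \<in> P.Mat" "yq \<in> P.Mat" by (auto simp: yq_def)
  define F where "F = quarter_turn ((- (\<omega>\<^sup>2)) \<cdot>\<^sub>m xq 1)"
  have Fm: "F \<in> P.Mat" unfolding F_def using m by auto
  define c where "c = (1 + \<omega>\<^sup>2) * half"
  have "G = c \<cdot>\<^sub>m (hq 1 * (quarter_turn ((- (\<omega>\<^sup>2)) \<cdot>\<^sub>m zq 1) * hq 1))"
    unfolding G_def sq_quarter_turn[OF first_two(1)] c_def using m by (simp add: P.mat_norm)
  also have "hq 1 * (quarter_turn ((- (\<omega>\<^sup>2)) \<cdot>\<^sub>m zq 1) * hq 1) = F"
    unfolding F_def using m hq_square[OF first_two(1)] hq_conjugate[OF first_two(1)]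
    by (simp add: P.quarter_turn_alt P.mat_expand)
  finally have G: "G = c \<cdot>\<^sub>m F" .
  have "twist (-1) (xq 1) yq" using S.twist_xy by (simp add: S.y_def yq_def)
  then have "F * yq = ((- (\<omega>\<^sup>2)) \<cdot>\<^sub>m xq 1) * yq * F"
    unfolding F_def using m P.x_square[OF first_two(1)]
    by (intro P.quarter_turn_anticommute scalar_square P.twist_smult_left) auto
  also have "((- (\<omega>\<^sup>2)) \<cdot>\<^sub>m xq 1) * yq = \<omega>\<^sup>2 \<cdot>\<^sub>m zq 1"
  proof -
    have "xq 1 * yq = (xq 1 * zq 1) * xq 1" unfolding yq_def using m by (simp add: P.mat_assoc)
    also have "\<dots> = (-1) \<cdot>\<^sub>m zq 1"
      unfolding zx_sign[OF first_two(1)] using m P.x_square[OF first_two(1)] by (simp add: P.mat_norm)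
    finally show ?thesis using m by (simp add: P.mat_smult_left smult_smult_mat)
  qed
  finally have "F * yq = \<omega>\<^sup>2 \<cdot>\<^sub>m (zq 1 * F)" using m Fm by (simp add: P.mat_smult_left)
  then have "G * yq = \<omega> ^ 2 \<cdot>\<^sub>m (zq 1 * G)"
    unfolding G using m Fm by (simp add: P.mat_norm mult.commute)
  moreover have "G * yq \<in> carrier C" "zq 1 * G \<in> carrier C"
    using GC by (auto intro: clifford_mult_closed zq_in_clifford[OF first_two(1)] simp del: One_nat_def)
  ultimately have "cl (G * yq) = cl (zq 1 * G)" using class_eq by blast
  then have "cl G \<otimes>\<^bsub>PC\<^esub> cl (zq 1) = cl yq \<otimes>\<^bsub>PC\<^esub> cl G"
    using GC zq_in_clifford[OF first_two(1)] by (simp add: class_mult)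
  then have "cl G \<otimes>\<^bsub>PC\<^esub> cl (zq 1) \<otimes>\<^bsub>PC\<^esub> inv\<^bsub>PC\<^esub> (cl G) = cl yq"
    using GC PC.m_assoc[of "cl yq" "cl G" "inv\<^bsub>PC\<^esub> (cl G)"] by simp
  then show ?thesis using GC by (intro bexI[of _ "cl G"]) auto
qed

end

theorem theorem6p9:
  fixes \<omega> :: complex and n :: nat
  assumes "primitive_root_of_unity 8 \<omega>" and "n \<ge> 2"
  shows "conjugate_in (proj_clifford \<omega> n)
           (centralizer (proj_clifford \<omega> n) (s_gate \<omega> n 1 [^]\<^bsub>proj_clifford \<omega> n\<^esub> (2::nat)))
           (IN_group \<omega> n)"
proof -
  interpret clifford_context \<omega> n by unfold_locales (use assms in auto)
  have z: "cl (zq 1) \<in> carrier PC" by (intro class_closed zq_in_clifford first_two)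
  have s: "s_gate \<omega> n 1 [^]\<^bsub>PC\<^esub> (2::nat) = cl (zq 1)"
    unfolding s_gate_def using class_square[OF gates_in_clifford(2)[OF first_two(1)]] by (simp add: sq_square)
  obtain g where g: "g \<in> carrier PC" "g \<otimes>\<^bsub>PC\<^esub> cl (zq 1) \<otimes>\<^bsub>PC\<^esub> inv\<^bsub>PC\<^esub> g = cl yq"
    using z1_conjugate_y1 by blast
  show ?thesis
    unfolding conjugate_in_def s IN_eq_centralizer
    using PC.conjugate_centralizer[OF g(1) z] g by auto
qed

end
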